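(* Let $\tau\geqslant 1$ be real and $f(n)=\lfloor n^\tau\rfloor$ for $n\in\mathbb{N}$. For every real $\alpha\in(1/2,1)$, $$\dim\mathcal{F}_{f,\alpha}\leqslant\begin{cases}1-\dfrac{4\alpha+\tau-4}{\tau+1-\alpha}&\text{if }\tau<2,\\[2mm] 1-\dfrac{4\alpha-2}{\tau+1-\alpha}&\text{if }\tau\geqslant 2,\end{cases}$$ where $\dim$ denotes Hausdorff dimension.
   Context: Write $\mathbf{e}(z)=\exp(2\pi i z)$ and $\mathsf{T}=[0,1]$. For a real sequence $f(n)$, $x\in\mathsf{T}$ and $N\in\mathbb{N}$ let $V_f(x;N)=\sum_{n=1}^N\mathbf{e}(xf(n))$, and for $\alpha\in(1/2,1)$ let $\mathcal{F}_{f,\alpha}=\{x\in\mathsf{T}:\ |V_f(x;N)|\geqslant N^\alpha\text{ for infinitely many }N\in\mathbb{N}\}$. *)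

theory Defs
  imports "HOL-Analysis.Analysis"
begin

text \<open>The library's \<^const>\<open>diameter\<close> is meaningful only for bounded sets, and
  \<open>0 powr 0 = 0\<close>; the explicit case \<open>s = 0\<close> makes the zero-dimensional Hausdorff measure
  the counting measure, while the empty set always contributes \<open>0\<close>.\<close>

definition diam_pow :: "real \<Rightarrow> 'a::metric_space set \<Rightarrow> ennreal" where
  "diam_pow s U =
     (if U = {} then 0 else if s = 0 then 1 else ennreal (diameter U powr s))"

definition delta_covers :: "real \<Rightarrow> 'a::metric_space set \<Rightarrow> (nat \<Rightarrow> 'a set) set" where
  "delta_covers \<delta> A =
     {U. A \<subseteq> (\<Union>i. U i) \<and> (\<forall>i. bounded (U i) \<and> diameter (U i) \<le> \<delta>)}"

definition hausdorff_premeasure :: "real \<Rightarrow> real \<Rightarrow> 'a::metric_space set \<Rightarrow> ennreal" where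
  "hausdorff_premeasure s \<delta> A = (INF U\<in>delta_covers \<delta> A. \<Sum>i. diam_pow s (U i))"

definition hausdorff_measure :: "real \<Rightarrow> 'a::metric_space set \<Rightarrow> ennreal" where
  "hausdorff_measure s A = (SUP \<delta>\<in>{0<..}. hausdorff_premeasure s \<delta> A)"

definition hausdorff_dim :: "'a::metric_space set \<Rightarrow> ereal" where
  "hausdorff_dim A = (INF s\<in>{s. 0 \<le> s \<and> hausdorff_measure s A = 0}. ereal s)"

definition e_unit :: "real \<Rightarrow> complex" where
  "e_unit z = exp (2 * complex_of_real pi * \<i> * complex_of_real z)"

definition exp_sum :: "(nat \<Rightarrow> real) \<Rightarrow> real \<Rightarrow> nat \<Rightarrow> complex" where
  "exp_sum f x N = (\<Sum>n=1..N. e_unit (x * f n))"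

definition large_sum_set :: "(nat \<Rightarrow> real) \<Rightarrow> real \<Rightarrow> real set" where
  "large_sum_set f \<alpha> =
     {x\<in>{0..1}. infinite {N::nat. 1 \<le> N \<and> norm (exp_sum f x N) \<ge> real N powr \<alpha>}}"

end

theory Submission
  imports Defs
begin

text \<open>
  A fourth moment argument. Everything rests on the bound \<open>\<lless> M\<^sup>4/T + M\<^bsup>2+\<epsilon>\<^esup>\<close>
  for the number of integer quadruples of size \<open>M\<close> with
  \<open>\<bar>a\<^bsup>\<tau>\<^esup> + d\<^bsup>\<tau>\<^esup> - b\<^bsup>\<tau>\<^esup> - c\<^bsup>\<tau>\<^esup>\<bar> \<le> M\<^bsup>\<tau>\<^esup>/T\<close> (Robert and Sargos).

  It is proved by a self-improving duality. The quadruples lie near the cone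
  \<open>a\<^bsup>\<tau>\<^esup> + d\<^bsup>\<tau>\<^esup> = b\<^bsup>\<tau>\<^esup> + c\<^bsup>\<tau>\<^esup>\<close>; cut it into caps of angular size \<open>T\<^bsup>-1/2\<^esup>\<close>, on
  which it is flat up to the permitted error, so that the quadruples of a cap fill a box. By Fourier
  analysis on \<open>(\<int>/R)\<^sup>4\<close>, their number is at most the volume of the box times the number of integer
  points of the polar box. Such a point \<open>k \<noteq> 0\<close> is nearly normal to the cone, hence lies near the dual
  cone, which has the same shape with \<open>\<tau>\<close> replaced by \<open>\<tau>/(\<tau>-1)\<close>. So an error term \<open>M\<^bsup>2+1/n\<^esup>\<close>
  for all exponents improves to \<open>M\<^bsup>2+1/(n+1)\<^esup>\<close>.

  For the theorem, split a large sum over \<open>n \<le> N < 2\<^bsup>k\<^esup>\<close> into \<open>O(k\<^sup>2)\<close> dyadic blocks, one of which must be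
  large, and stays so on an interval of length about \<open>N\<^bsup>\<alpha>-\<tau>-1\<^esup>\<close>. The fourth moment over a grid of this mesh
  bounds the number of such intervals, and their union over \<open>k\<close> is a cover with convergent \<open>s\<close>-dimensional sum.
\<close>

section \<open>Power functions on compact intervals\<close>

text \<open>The gain in the duality is one of size. Over all O(\<open>T\<close>) caps the polar
  points \<open>0\<close> give the term \<open>M^4/T\<close>. A nonzero polar point of size
  \<open>j\<close> has \<open>j\<close> at most about \<open>T/M\<close>, solves the dual problem
  with relative precision about \<open>T/(j M)^2\<close>, and is shared by about
  \<open>(T/(j M))^2\<close> caps. For \<open>T \<le> M^2\<close> this precision is at most about
  \<open>1/j^2\<close>, so only the error term of the dual count matters, and a dual error exponent
  \<open>2 + \<gamma>\<close> costs \<open>M^2 (T/M)^\<gamma>\<close>. At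
  \<open>T = M^(2-\<gamma>')\<close> this balances \<open>M^4/T\<close> when
  \<open>(1-\<gamma>') \<gamma> = \<gamma>'\<close>, which turns \<open>1/n\<close> into
  \<open>1/(n+1)\<close>.

  The integer parts in \<open>f\<close> limit the usable precision to \<open>T\<close> of order
  \<open>M^\<tau>\<close>, so the fourth moment is governed by \<open>M^\<sigma>\<close> with
  \<open>\<sigma> = max (4-\<tau>) 2\<close>, up to \<open>\<epsilon>\<close>: these are the two
  cases of the theorem. With \<open>\<rho> = \<tau>+1-\<alpha>\<close>, about
  \<open>N^(\<rho>+\<sigma>-4\<alpha>)\<close> intervals of length \<open>N^(-\<rho>)\<close>
  remain, and the \<open>s\<close>-dimensional sum converges as soon as
  \<open>(1-s) \<rho> + \<sigma> < 4 \<alpha>\<close>.\<close>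

lemma powr_MVT:
  fixes x y p :: real
  assumes "0 < x" "x < y"
  obtains z where "x < z" "z < y" "y powr p - x powr p = (y - x) * (p * z powr (p - 1))"
proof -
  have "((\<lambda>u. u powr p) has_real_derivative p * u powr (p - 1)) (at u)" if "x \<le> u" for u
    using assms that by (intro has_real_derivative_powr) auto
  then show ?thesis
    using MVT2[of x y "\<lambda>u. u powr p" "\<lambda>u. p * u powr (p - 1)"] assms(2) that by blast
qed

lemma powr_lipschitz_on:
  fixes B p :: real
  assumes "B \<ge> 1"
  obtains K where "K > 0"
    "\<And>x y. \<lbrakk>x \<in> {1/B..B}; y \<in> {1/B..B}\<rbrakk> \<Longrightarrow> \<bar>y powr p - x powr p\<bar> \<le> K * \<bar>y - x\<bar>"
proof -
  \<comment> \<open>The interval is closed under inversion, so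
    \<open>B powr \<bar>p - 1\<bar>\<close> bounds \<open>z powr (p - 1)\<close> for either sign of
    \<open>p - 1\<close>. The summand \<open>1\<close> keeps \<open>K\<close> positive when
    \<open>p = 0\<close>.\<close>
  define K where "K = \<bar>p\<bar> * B powr \<bar>p - 1\<bar> + 1"
  have K: "K > 0" unfolding K_def by (smt (verit) mult_nonneg_nonneg powr_ge_zero)
  have bd: "z powr (p - 1) \<le> B powr \<bar>p - 1\<bar>" if "z \<in> {1/B..B}" for z
  proof (cases "p \<ge> 1")
    case True
    with that assms show ?thesis
      by (simp add: powr_mono2 order_trans[of 0 "1/B" z])
  next
    case False
    have z: "z > 0" using that assms by (auto intro: less_le_trans[of 0 "1/B"])
    have "z powr (p - 1) = (1/z) powr (1 - p)"
      using z by (simp add: powr_divide powr_minus_divide[symmetric])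
    also have "\<dots> \<le> B powr (1 - p)"
      using that assms z False by (intro powr_mono2) (auto simp: field_simps)
    finally show ?thesis using False by simp
  qed
  have *: "\<bar>y powr p - x powr p\<bar> \<le> K * \<bar>y - x\<bar>"
    if "x \<in> {1/B..B}" "y \<in> {1/B..B}" and xy: "x < y" for x y
  proof -
    have x0: "x > 0" using that assms by (auto intro: less_le_trans[of 0 "1/B"])
    obtain z where z: "x < z" "z < y" "y powr p - x powr p = (y - x) * (p * z powr (p - 1))"
      using powr_MVT[OF x0 xy] by metis
    have "\<bar>y powr p - x powr p\<bar> = (\<bar>p\<bar> * z powr (p - 1)) * \<bar>y - x\<bar>"
      unfolding z(3) by (simp add: abs_mult)
    also have "\<dots> \<le> (\<bar>p\<bar> * B powr \<bar>p - 1\<bar>) * \<bar>y - x\<bar>"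
      using bd[of z] z that by (intro mult_right_mono mult_left_mono) auto
    also have "\<dots> \<le> K * \<bar>y - x\<bar>"
      unfolding K_def by (intro mult_right_mono) auto
    finally show ?thesis .
  qed
  show ?thesis
  proof (rule that[OF K])
    fix x y assume "x \<in> {1/B..B}" "y \<in> {1/B..B}"
    then show "\<bar>y powr p - x powr p\<bar> \<le> K * \<bar>y - x\<bar>"
      using *[of x y] *[of y x] by (cases x y rule: linorder_cases) (auto simp: abs_minus_commute)
  qed
qed

text \<open>By the mean value theorem the remainder is
  \<open>p * (z powr (p - 1) - x powr (p - 1)) * (y - x)\<close> with \<open>z\<close> between
  \<open>x\<close> and \<open>y\<close>; the Lipschitz bound for the exponent \<open>p - 1\<close>
  supplies the second factor \<open>\<bar>y - x\<bar>\<close>.\<close>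

lemma powr_taylor_on:
  fixes B p :: real
  assumes "B \<ge> 1"
  obtains K where "K > 0"
    "\<And>x y. \<lbrakk>x \<in> {1/B..B}; y \<in> {1/B..B}\<rbrakk> \<Longrightarrow>
       \<bar>y powr p - x powr p - p * x powr (p - 1) * (y - x)\<bar> \<le> K * (y - x)\<^sup>2"
proof -
  obtain L where L: "L > 0" "\<And>x y. \<lbrakk>x \<in> {1/B..B}; y \<in> {1/B..B}\<rbrakk> \<Longrightarrow>
       \<bar>y powr (p - 1) - x powr (p - 1)\<bar> \<le> L * \<bar>y - x\<bar>"
    using powr_lipschitz_on[OF assms, of "p - 1"] by metis
  define K where "K = \<bar>p\<bar> * L + 1"
  have K: "K > 0" unfolding K_def using L(1) by (smt (verit) mult_nonneg_nonneg)
  show ?thesis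
  proof (rule that[OF K])
    fix x y assume xy: "x \<in> {1/B..B}" "y \<in> {1/B..B}"
    have pos: "u > 0" if "u \<in> {1/B..B}" for u
      using that assms by (auto intro: less_le_trans[of 0 "1/B"])
    have mvt: "\<exists>z. z \<in> {min x y..max x y} \<and> y powr p - x powr p = (y - x) * (p * z powr (p - 1))"
    proof (cases x y rule: linorder_cases)
      case less
      then obtain z where "x < z" "z < y" "y powr p - x powr p = (y - x) * (p * z powr (p - 1))"
        using powr_MVT[OF pos[OF xy(1)] less] by metis
      then show ?thesis using less by (intro exI[of _ z]) auto
    next
      case greater
      then obtain z where "y < z" "z < x" "x powr p - y powr p = (x - y) * (p * z powr (p - 1))"
        using powr_MVT[OF pos[OF xy(2)] greater] by metis
      then show ?thesis using greater by (intro exI[of _ z]) (auto simp: algebra_simps)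
    qed auto
    then obtain z where z: "z \<in> {min x y..max x y}"
        "y powr p - x powr p = (y - x) * (p * z powr (p - 1))" by blast
    have zB: "z \<in> {1/B..B}" using z(1) xy by auto
    have "\<bar>y powr p - x powr p - p * x powr (p - 1) * (y - x)\<bar>
        = \<bar>p\<bar> * \<bar>z powr (p - 1) - x powr (p - 1)\<bar> * \<bar>y - x\<bar>"
      unfolding z(2) by (simp add: abs_mult[symmetric] algebra_simps)
    also have "\<dots> \<le> \<bar>p\<bar> * (L * \<bar>y - x\<bar>) * \<bar>y - x\<bar>"
    proof (intro mult_right_mono mult_left_mono)
      have "\<bar>z powr (p - 1) - x powr (p - 1)\<bar> \<le> L * \<bar>z - x\<bar>" using L(2)[OF xy(1) zB] .
      also have "\<dots> \<le> L * \<bar>y - x\<bar>" using z(1) L(1) by (intro mult_left_mono) auto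
      finally show "\<bar>z powr (p - 1) - x powr (p - 1)\<bar> \<le> L * \<bar>y - x\<bar>" .
    qed auto
    also have "\<dots> = \<bar>p\<bar> * L * (y - x)\<^sup>2"
      by (simp add: power2_eq_square mult.assoc)
    also have "\<dots> \<le> K * (y - x)\<^sup>2"
      unfolding K_def by (intro mult_right_mono) auto
    finally show "\<bar>y powr p - x powr p - p * x powr (p - 1) * (y - x)\<bar> \<le> K * (y - x)\<^sup>2" .
  qed
qed

section \<open>A transference principle for integer points\<close>

lemma e_unit_cis: "e_unit z = cis (2 * pi * z)"
  unfolding e_unit_def cis_conv_exp by (simp add: mult_ac)

lemma e_unit_add: "e_unit (x + y) = e_unit x * e_unit y"
  by (simp add: e_unit_cis cis_mult algebra_simps)

lemma cnj_e_unit: "cnj (e_unit x) = e_unit (- x)"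
  by (simp add: e_unit_cis cis_cnj)

lemma norm_e_unit [simp]: "norm (e_unit x) = 1"
  by (simp add: e_unit_cis)

lemma e_unit_of_int [simp]: "e_unit (real_of_int k) = 1"
  by (simp add: e_unit_cis cis_multiple_2pi)

lemma e_unit_eq_1_iff: "e_unit x = 1 \<longleftrightarrow> x \<in> \<int>"
proof
  assume "e_unit x = 1"
  then have "cos (2 * pi * x) = 1" by (auto simp: e_unit_cis complex_eq_iff)
  then obtain n :: int where "2 * pi * x = of_int n * 2 * pi"
    using cos_one_2pi_int by auto
  then have "x = of_int n" by simp
  then show "x \<in> \<int>" by simp
qed (auto elim: Ints_cases)

lemma e_unit_power: "e_unit x ^ n = e_unit (real n * x)"
  using Complex.DeMoivre[of "2 * pi * x" n] by (simp add: e_unit_cis mult_ac)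

lemma sum_e_unit_int:
  fixes R :: nat and d :: int
  assumes "R > 0"
  shows "(\<Sum>g\<in>{0..<int R}. e_unit (real_of_int (g * d) / real R)) =
     (if int R dvd d then of_nat R else 0)"
proof -
  let ?w = "e_unit (real_of_int d / real R)"
  have "(\<Sum>g\<in>{0..<int R}. e_unit (real_of_int (g * d) / real R))
      = (\<Sum>g<R. e_unit (real_of_int (int g * d) / real R))"
    by (rule sum.reindex_bij_witness[of _ int nat]) auto
  also have "\<dots> = (\<Sum>g<R. ?w ^ g)"
    by (intro sum.cong) (auto simp: e_unit_power)
  also have "\<dots> = (if int R dvd d then of_nat R else 0)"
  proof (cases "int R dvd d")
    case True
    then obtain k where "d = int R * k" by auto
    then show ?thesis using assms True by simp
  next
    case False
    have "?w \<noteq> 1"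
    proof
      assume "?w = 1"
      then have "real_of_int d / real R \<in> \<int>" by (simp add: e_unit_eq_1_iff)
      then obtain k where "real_of_int d / real R = of_int k" by (elim Ints_cases)
      then have "real_of_int d = of_int (int R * k)" using assms by (simp add: field_simps)
      then have "d = int R * k" by linarith
      then show False using False by simp
    qed
    moreover have "?w ^ R = 1"
      using assms by (simp add: e_unit_power)
    ultimately show ?thesis using False by (simp add: geometric_sum)
  qed
  finally show ?thesis .
qed

lemma norm_sum_sq_eq:
  fixes F :: "'b \<Rightarrow> complex"
  shows "complex_of_real ((norm (\<Sum>m\<in>S. F m))\<^sup>2) = (\<Sum>m\<in>S. \<Sum>m'\<in>S. F m * cnj (F m'))"
  unfolding complex_norm_square by (simp add: sum_product)

type_synonym int4 = "int \<times> int \<times> int \<times> int"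

fun dot4 :: "int4 \<Rightarrow> int4 \<Rightarrow> int" where
  "dot4 (a, b, c, d) (a', b', c', d') = a * a' + b * b' + c * c' + d * d'"

fun lin4 :: "int4 \<Rightarrow> int \<Rightarrow> int4 \<Rightarrow> int4" where
  "lin4 (a, b, c, d) R (a', b', c', d') = (a + R * a', b + R * b', c + R * c', d + R * d')"

lemma sum_e_unit_dot4:
  fixes R :: nat and m m' :: int4
  assumes "R > 0"
    and m: "m \<in> {0..<int R} \<times> {0..<int R} \<times> {0..<int R} \<times> {0..<int R}"
    and m': "m' \<in> {0..<int R} \<times> {0..<int R} \<times> {0..<int R} \<times> {0..<int R}"
  shows "(\<Sum>g\<in>{0..<int R} \<times> {0..<int R} \<times> {0..<int R} \<times> {0..<int R}.
     e_unit (real_of_int (dot4 g m) / R) * cnj (e_unit (real_of_int (dot4 g m') / R))) =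
     (if m = m' then of_nat (R ^ 4) else 0)"
proof -
  obtain a b c d where mm: "m = (a, b, c, d)" by (cases m) auto
  obtain a' b' c' d' where mm': "m' = (a', b', c', d')" by (cases m') auto
  let ?s = "\<lambda>u. (\<Sum>g\<in>{0..<int R}. e_unit (real_of_int (g * u) / real R))"
  have *: "e_unit (real_of_int (dot4 g m) / R) * cnj (e_unit (real_of_int (dot4 g m') / R)) =
     (case g of (x, y, z, w) \<Rightarrow> e_unit (real_of_int (x * (a - a')) / real R) *
        (e_unit (real_of_int (y * (b - b')) / real R) * (e_unit (real_of_int (z * (c - c')) / real R) *
        e_unit (real_of_int (w * (d - d')) / real R))))" for g
    by (cases g) (simp add: mm mm' cnj_e_unit e_unit_add[symmetric]
        add_divide_distrib diff_divide_distrib algebra_simps)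
  have "(\<Sum>g\<in>{0..<int R} \<times> {0..<int R} \<times> {0..<int R} \<times> {0..<int R}.
     e_unit (real_of_int (dot4 g m) / R) * cnj (e_unit (real_of_int (dot4 g m') / R))) =
     ?s (a - a') * (?s (b - b') * (?s (c - c') * ?s (d - d')))"
    unfolding * by (simp add: sum.cartesian_product[symmetric] sum_distrib_left[symmetric]
        sum_distrib_right[symmetric])
  also have "\<dots> = (if m = m' then of_nat (R ^ 4) else 0)"
  proof -
    have dvd: "int R dvd u - u' \<longleftrightarrow> u = u'" if "u \<in> {0..<int R}" "u' \<in> {0..<int R}" for u u'
    proof
      assume "int R dvd u - u'"
      moreover have "\<bar>u - u'\<bar> < int R" using that by auto
      ultimately show "u = u'" using dvd_imp_le_int[of "u - u'" "int R"] by force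
    qed simp
    have "int R dvd a - a' \<longleftrightarrow> a = a'" "int R dvd b - b' \<longleftrightarrow> b = b'"
      "int R dvd c - c' \<longleftrightarrow> c = c'" "int R dvd d - d' \<longleftrightarrow> d = d'"
      using m m' mm mm' dvd by auto
    then show ?thesis
      unfolding sum_e_unit_int[OF assms(1)] mm mm' by (auto simp: power4_eq_xxxx)
  qed
  finally show ?thesis .
qed

text \<open>
  The sum \<open>\<Psi>\<close> of the characters of \<open>S\<close> has modulus at least \<open>|S|/\<surd>2\<close> on \<open>G\<close>, and
  \<open>\<Sum>\<^sub>Q |\<Psi>|\<^sup>2 = R\<^sup>4 |S|\<close>, so \<open>G\<close> cannot be large modulo \<open>R\<close>; the fibres of the
  reduction of \<open>G\<close> modulo \<open>R\<close> embed into \<open>D\<close>.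
\<close>

lemma transference:
  fixes R :: nat and S G D :: "int4 set"
  assumes R: "R > 0"
    and S: "S \<subseteq> {0..<int R} \<times> {0..<int R} \<times> {0..<int R} \<times> {0..<int R}"
    and G: "finite G" and D: "finite D"
    and small: "\<And>g m. g \<in> G \<Longrightarrow> m \<in> S \<Longrightarrow> 8 * \<bar>dot4 g m\<bar> \<le> int R"
    and diff: "\<And>g k. g \<in> G \<Longrightarrow> lin4 g (int R) k \<in> G \<Longrightarrow> k \<in> D"
  shows "real (card S) * real (card G) \<le> 2 * real R ^ 4 * real (card D)"
proof -
  define Q where "Q = {0..<int R} \<times> {0..<int R} \<times> {0..<int R} \<times> {0..<int R}"
  define \<Psi> where "\<Psi> g = (\<Sum>m\<in>S. e_unit (real_of_int (dot4 g m) / R))" for g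
  have finQ: "finite Q" by (simp add: Q_def)
  have finS: "finite S" using S finQ finite_subset unfolding Q_def by blast
  have parseval: "(\<Sum>g\<in>Q. (norm (\<Psi> g))\<^sup>2) = real R ^ 4 * real (card S)"
  proof -
    have "complex_of_real (\<Sum>g\<in>Q. (norm (\<Psi> g))\<^sup>2) = (\<Sum>g\<in>Q. \<Sum>m\<in>S. \<Sum>m'\<in>S.
        e_unit (real_of_int (dot4 g m) / R) * cnj (e_unit (real_of_int (dot4 g m') / R)))"
      unfolding \<Psi>_def of_real_sum norm_sum_sq_eq ..
    also have "\<dots> = (\<Sum>m\<in>S. \<Sum>m'\<in>S. \<Sum>g\<in>Q.
        e_unit (real_of_int (dot4 g m) / R) * cnj (e_unit (real_of_int (dot4 g m') / R)))"
      by (subst sum.swap, rule sum.cong[OF refl], rule sum.swap)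
    also have "\<dots> = (\<Sum>m\<in>S. \<Sum>m'\<in>S. if m = m' then of_nat (R ^ 4) else 0)"
      unfolding Q_def using S R by (intro sum.cong refl sum_e_unit_dot4) auto
    also have "\<dots> = of_nat (card S * R ^ 4)"
      using finS by simp
    finally have "complex_of_real (\<Sum>g\<in>Q. (norm (\<Psi> g))\<^sup>2) = complex_of_real (real (card S * R ^ 4))"
      by simp
    then show ?thesis unfolding of_real_eq_iff by simp
  qed
  define red where "red g = (case g of (a, b, c, d) \<Rightarrow>
     (a mod int R, b mod int R, c mod int R, d mod int R))" for g :: int4
  have red_Q: "red g \<in> Q" for g
    using R by (cases g) (auto simp: red_def Q_def)
  have lin_red: "\<exists>k. g = lin4 (red g) (int R) k" for g
  proof (cases g)
    case (fields a b c d)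
    then show ?thesis
      by (intro exI[of _ "(a div int R, b div int R, c div int R, d div int R)"]) (simp add: red_def)
  qed
  have red_\<Psi>: "\<Psi> (red g) = \<Psi> g" for g
    unfolding \<Psi>_def
  proof (rule sum.cong[OF refl])
    fix m
    obtain k where k: "g = lin4 (red g) (int R) k" using lin_red by blast
    have "real_of_int (dot4 g m) / R = real_of_int (dot4 (red g) m) / R + real_of_int (dot4 k m)"
      by (subst k, cases "red g"; cases k; cases m)
        (use R in \<open>auto simp: field_simps\<close>)
    then show "e_unit (real_of_int (dot4 (red g) m) / R) = e_unit (real_of_int (dot4 g m) / R)"
      by (simp add: e_unit_add)
  qed
  \<comment> \<open>On \<open>G\<close> each phase is at most an eighth of a turn, so each character
    has real part at least \<open>cos (pi / 4)\<close>. Squaring this is the origin of the factor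
    \<open>2\<close> in the conclusion.\<close>
  have low: "(real (card S))\<^sup>2 / 2 \<le> (norm (\<Psi> g))\<^sup>2" if g: "g \<in> G" for g
  proof -
    have "real (card S) * (sqrt 2 / 2) \<le> (\<Sum>m\<in>S. Re (e_unit (real_of_int (dot4 g m) / R)))"
    proof -
      have "sqrt 2 / 2 \<le> Re (e_unit (real_of_int (dot4 g m) / R))" if m: "m \<in> S" for m
      proof -
        let ?t = "real_of_int (dot4 g m) / R"
        have "8 * \<bar>real_of_int (dot4 g m)\<bar> \<le> real R"
          using small[OF g m] by linarith
        then have t: "\<bar>?t\<bar> \<le> 1/8" using R by (simp add: field_simps abs_divide)
        have "cos (pi / 4) \<le> cos \<bar>2 * pi * ?t\<bar>"
        proof (rule cos_monotone_0_pi_le)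
          have "\<bar>2 * pi * ?t\<bar> = 2 * pi * \<bar>?t\<bar>" by (simp add: abs_mult)
          also have "\<dots> \<le> 2 * pi * (1/8)" using t by (intro mult_left_mono) auto
          finally show "\<bar>2 * pi * ?t\<bar> \<le> pi / 4" by simp
        qed auto
        then show ?thesis unfolding cos_abs_real by (simp add: e_unit_cis cos_45)
      qed
      from sum_mono[of S "\<lambda>_. sqrt 2 / 2", OF this] show ?thesis by simp
    qed
    also have "\<dots> = Re (\<Psi> g)" by (simp add: \<Psi>_def)
    also have "\<dots> \<le> norm (\<Psi> g)" by (rule complex_Re_le_cmod)
    finally have "(real (card S) * (sqrt 2 / 2))\<^sup>2 \<le> (norm (\<Psi> g))\<^sup>2"
      by (intro power_mono) auto
    then show ?thesis by (simp add: power_mult_distrib power_divide)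
  qed
  have "real (card G) * ((real (card S))\<^sup>2 / 2) \<le> (\<Sum>g\<in>G. (norm (\<Psi> g))\<^sup>2)"
    using sum_mono[of G "\<lambda>_. (real (card S))\<^sup>2 / 2", OF low] by simp
  also have "\<dots> = (\<Sum>g\<in>G. (norm (\<Psi> (red g)))\<^sup>2)" by (simp add: red_\<Psi>)
  also have "\<dots> = (\<Sum>h\<in>Q. \<Sum>g\<in>{g\<in>G. red g = h}. (norm (\<Psi> (red g)))\<^sup>2)"
    using G finQ red_Q by (intro sum.group[symmetric]) auto
  also have "\<dots> = (\<Sum>h\<in>Q. real (card {g\<in>G. red g = h}) * (norm (\<Psi> h))\<^sup>2)"
    by (intro sum.cong refl) simp
  also have "\<dots> \<le> (\<Sum>h\<in>Q. real (card D) * (norm (\<Psi> h))\<^sup>2)"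
  proof (intro sum_mono mult_right_mono)
    fix h assume "h \<in> Q"
    show "real (card {g\<in>G. red g = h}) \<le> real (card D)"
    proof (cases "{g\<in>G. red g = h} = {}")
      case False
      then obtain g0 where g0: "g0 \<in> G" "red g0 = h" by blast
      have "{g\<in>G. red g = h} \<subseteq> (\<lambda>k. lin4 g0 (int R) k) ` D"
      proof
        fix g assume "g \<in> {g\<in>G. red g = h}"
        then have g: "g \<in> G" "red g = h" by auto
        obtain a b c d where gg: "g = (a, b, c, d)" by (cases g) auto
        obtain a' b' c' d' where gg0: "g0 = (a', b', c', d')" by (cases g0) auto
        \<comment> \<open>Equal remainders leave a difference of \<open>R\<close> times the
          difference of the quotients, and \<open>diff\<close> places that vector in
          \<open>D\<close>.\<close>
        have "g = lin4 g0 (int R) (a div R - a' div R, b div R - b' div R, c div R - c' div R, d div R - d' div R)"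
        proof -
          have *: "u = u' + int R * (u div int R - u' div int R)" if "u mod int R = u' mod int R" for u u'
            using that mult_div_mod_eq[of "int R" u] mult_div_mod_eq[of "int R" u']
            unfolding right_diff_distrib by linarith
          show ?thesis
            using g(2) g0(2) by (auto simp: gg gg0 red_def intro!: *)
        qed
        then show "g \<in> (\<lambda>k. lin4 g0 (int R) k) ` D"
          using diff[OF g0(1)] g(1) by (metis imageI)
      qed
      then have "card {g\<in>G. red g = h} \<le> card D"
        using D by (meson card_image_le card_mono finite_imageI le_trans)
      then show ?thesis by simp
    next
      case True
      then show ?thesis by (metis card.empty of_nat_0 of_nat_0_le_iff)
    qed
  qed auto
  also have "\<dots> = real (card D) * (real R ^ 4 * real (card S))"
    by (simp add: sum_distrib_left[symmetric] parseval)
  finally have *: "real (card S) * (real (card S) * real (card G)) \<le>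
       real (card S) * (2 * real R ^ 4 * real (card D))"
    by (simp add: power2_eq_square algebra_simps)
  show ?thesis
  proof (cases "card S = 0")
    case False
    then show ?thesis using * by (simp add: mult_le_cancel_left)
  qed simp
qed

section \<open>The cone and its dual\<close>

text \<open>This is the flatness of a cap in the chart \<open>x4 = 1\<close>. Closeness is assumed
  in two coordinates only: the cone equation then controls
  \<open>y1 powr \<tau> - x1 powr \<tau>\<close>, and taking \<open>\<tau>\<close>-th roots gives
  \<open>y1 - x1 = O(1 / sqrt T)\<close>. All displacements being of that order, the quadratic
  Taylor remainders are \<open>O(1/T)\<close>, no larger than the error allowed in the
  equation.\<close>

lemma tangent_plane_bound:
  fixes \<tau> A :: real
  assumes "\<tau> > 1" "A \<ge> 1"
  obtains C where "C > 0"
    "\<And>T x1 x2 x3 y1 y2 y3. \<lbrakk>T \<ge> 1;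
       x1 \<in> {1/A..A}; x2 \<in> {1/A..A}; x3 \<in> {1/A..A};
       y1 \<in> {1/A..A}; y2 \<in> {1/A..A}; y3 \<in> {1/A..A};
       \<bar>x1 powr \<tau> - x2 powr \<tau> - x3 powr \<tau> + 1\<bar> \<le> 1/T;
       \<bar>y1 powr \<tau> - y2 powr \<tau> - y3 powr \<tau> + 1\<bar> \<le> 1/T;
       \<bar>y2 - x2\<bar> \<le> 1 / sqrt T; \<bar>y3 - x3\<bar> \<le> 1 / sqrt T\<rbrakk> \<Longrightarrow>
       \<bar>x1 powr (\<tau> - 1) * (y1 - x1) - x2 powr (\<tau> - 1) * (y2 - x2)
         - x3 powr (\<tau> - 1) * (y3 - x3)\<bar> \<le> C / T"
proof -
  obtain L where L: "L > 0" "\<And>x y. \<lbrakk>x \<in> {1/A..A}; y \<in> {1/A..A}\<rbrakk> \<Longrightarrow>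
       \<bar>y powr \<tau> - x powr \<tau>\<bar> \<le> L * \<bar>y - x\<bar>"
    using powr_lipschitz_on[OF assms(2), of \<tau>] by metis
  obtain K where K: "K > 0" "\<And>x y. \<lbrakk>x \<in> {1/A..A}; y \<in> {1/A..A}\<rbrakk> \<Longrightarrow>
       \<bar>y powr \<tau> - x powr \<tau> - \<tau> * x powr (\<tau> - 1) * (y - x)\<bar> \<le> K * (y - x)\<^sup>2"
    using powr_taylor_on[OF assms(2), of \<tau>] by metis
  define B where "B = A powr \<tau>"
  have B: "B \<ge> 1" using assms by (simp add: B_def ge_one_powr_ge_zero)
  obtain L' where L': "L' > 0" "\<And>x y. \<lbrakk>x \<in> {1/B..B}; y \<in> {1/B..B}\<rbrakk> \<Longrightarrow>
       \<bar>y powr (1/\<tau>) - x powr (1/\<tau>)\<bar> \<le> L' * \<bar>y - x\<bar>"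
    using powr_lipschitz_on[OF B, of "1/\<tau>"] by metis
  define E where "E = L' * (2 + 2 * L)"
  define C where "C = 2 + K * (E\<^sup>2 + 2)"
  have C: "C > 0" using K(1) by (simp add: C_def add_pos_nonneg)
  have inB: "x powr \<tau> \<in> {1/B..B}" "x > 0" "(x powr \<tau>) powr (1/\<tau>) = x" if "x \<in> {1/A..A}" for x
  proof -
    show x: "x > 0" using that assms(2) by (auto intro: less_le_trans[of 0 "1/A"])
    have "(1/A) powr \<tau> \<le> x powr \<tau>" "x powr \<tau> \<le> A powr \<tau>"
      using that assms x by (auto intro!: powr_mono2)
    then show "x powr \<tau> \<in> {1/B..B}" using assms by (simp add: B_def powr_divide)
    show "(x powr \<tau>) powr (1/\<tau>) = x" using x assms by (simp add: powr_powr)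
  qed
  show ?thesis
  proof (rule that[OF C])
    fix T x1 x2 x3 y1 y2 y3 :: real
    assume T: "T \<ge> 1"
      and x: "x1 \<in> {1/A..A}" "x2 \<in> {1/A..A}" "x3 \<in> {1/A..A}"
      and y: "y1 \<in> {1/A..A}" "y2 \<in> {1/A..A}" "y3 \<in> {1/A..A}"
      and hx: "\<bar>x1 powr \<tau> - x2 powr \<tau> - x3 powr \<tau> + 1\<bar> \<le> 1/T"
      and hy: "\<bar>y1 powr \<tau> - y2 powr \<tau> - y3 powr \<tau> + 1\<bar> \<le> 1/T"
      and d: "\<bar>y2 - x2\<bar> \<le> 1 / sqrt T" "\<bar>y3 - x3\<bar> \<le> 1 / sqrt T"
    have T': "1/T \<le> 1 / sqrt T"
    proof -
      have "sqrt T \<le> T" using T real_le_lsqrt[of T T] by (simp add: power2_eq_square)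
      then show ?thesis using T by (intro divide_left_mono) auto
    qed
    have sq: "(1 / sqrt T)\<^sup>2 = 1/T" using T by (simp add: power_divide)
    have sd: "(y2 - x2)\<^sup>2 \<le> 1/T" "(y3 - x3)\<^sup>2 \<le> 1/T"
      using power_mono[OF d(1), of 2] power_mono[OF d(2), of 2] by (auto simp: sq)
    have "\<bar>y2 powr \<tau> - x2 powr \<tau>\<bar> \<le> L * (1 / sqrt T)" "\<bar>y3 powr \<tau> - x3 powr \<tau>\<bar> \<le> L * (1 / sqrt T)"
      using L(2)[OF x(2) y(2)] L(2)[OF x(3) y(3)] d L(1)
      by (meson less_imp_le mult_left_mono order_trans)+
    then have "\<bar>y1 powr \<tau> - x1 powr \<tau>\<bar> \<le> (2 + 2 * L) * (1 / sqrt T)"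
      using hx hy T' unfolding distrib_right by linarith
    then have "L' * \<bar>y1 powr \<tau> - x1 powr \<tau>\<bar> \<le> E * (1 / sqrt T)"
      using L'(1) unfolding E_def mult.assoc by (intro mult_left_mono) auto
    moreover have "\<bar>y1 - x1\<bar> \<le> L' * \<bar>y1 powr \<tau> - x1 powr \<tau>\<bar>"
      using L'(2)[OF inB(1)[OF x(1)] inB(1)[OF y(1)]] inB(3)[OF x(1)] inB(3)[OF y(1)] by simp
    ultimately have "\<bar>y1 - x1\<bar> \<le> E * (1 / sqrt T)" by linarith
    then have "\<bar>y1 - x1\<bar>\<^sup>2 \<le> (E * (1 / sqrt T))\<^sup>2" by (intro power_mono) auto
    then have sd1: "(y1 - x1)\<^sup>2 \<le> E\<^sup>2 * (1/T)"
      unfolding power_mult_distrib sq by simp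
    let ?r = "\<lambda>x y. y powr \<tau> - x powr \<tau> - \<tau> * x powr (\<tau> - 1) * (y - x)"
    have "\<bar>?r x1 y1\<bar> \<le> K * (E\<^sup>2 * (1/T))" "\<bar>?r x2 y2\<bar> \<le> K * (1/T)" "\<bar>?r x3 y3\<bar> \<le> K * (1/T)"
      using K(2)[OF x(1) y(1)] K(2)[OF x(2) y(2)] K(2)[OF x(3) y(3)] sd sd1 K(1)
      by (meson less_imp_le mult_left_mono order_trans)+
    \<comment> \<open>The linear part is \<open>\<tau>\<close> times the tangent form: it is the
      difference of the two defects in the cone equation, corrected by the three Taylor
      remainders.\<close>
    moreover have "\<tau> * (x1 powr (\<tau> - 1) * (y1 - x1) - x2 powr (\<tau> - 1) * (y2 - x2)
         - x3 powr (\<tau> - 1) * (y3 - x3)) =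
       (y1 powr \<tau> - y2 powr \<tau> - y3 powr \<tau> + 1) - (x1 powr \<tau> - x2 powr \<tau> - x3 powr \<tau> + 1)
       - ?r x1 y1 + ?r x2 y2 + ?r x3 y3" (is "\<tau> * ?t = _")
      by (simp add: algebra_simps)
    ultimately have "\<bar>\<tau> * ?t\<bar> \<le> 2 * (1/T) + (K * (E\<^sup>2 * (1/T)) + K * (1/T) + K * (1/T))"
      using hx hy by linarith
    also have "\<dots> = C / T" by (simp add: C_def algebra_simps add_divide_distrib)
    finally have "\<bar>\<tau> * ?t\<bar> \<le> C / T" .
    moreover have "\<bar>?t\<bar> \<le> \<bar>\<tau> * ?t\<bar>"
      using assms(1) mult_right_mono[of 1 \<tau> "\<bar>?t\<bar>"] by (simp add: abs_mult)
    ultimately show "\<bar>?t\<bar> \<le> C / T" by linarith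
  qed
qed

text \<open>
  Here \<open>x\<close> is a point of the cone, normalised by \<open>x\<^sub>4 = 1\<close>, and \<open>z\<close> an almost normal vector: with
  \<open>p = \<tau>/(\<tau>-1)\<close> the normal \<open>x\<^bsup>\<tau>-1\<^esup>\<close> satisfies \<open>(x\<^bsup>\<tau>-1\<^esup>)\<^bsup>p\<^esup> = x\<^bsup>\<tau>\<^esup>\<close> and
  \<open>(x\<^bsup>\<tau>-1\<^esup>)\<^bsup>p-1\<^esup> = x\<close>, so the first order term of \<open>z\<^bsup>p\<^esup>\<close> is controlled by \<open>z \<bullet> x\<close>.
\<close>

lemma dual_point_bound:
  fixes \<tau> A :: real
  assumes "\<tau> > 1" "A \<ge> 1"
  defines "p \<equiv> \<tau> / (\<tau> - 1)"
  obtains \<omega> B C where "\<omega> > 0" "B \<ge> 1" "C > 0"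
    "\<And>\<epsilon> x1 x2 x3 z1 z2 z3 z4. \<lbrakk>0 \<le> \<epsilon>; \<epsilon> \<le> \<omega>;
       x1 \<in> {1/A..A}; x2 \<in> {1/A..A}; x3 \<in> {1/A..A};
       \<bar>x1 powr \<tau> - x2 powr \<tau> - x3 powr \<tau> + 1\<bar> \<le> A powr (2 * (\<tau> - 1)) * \<epsilon>\<^sup>2;
       z1 = x1 powr (\<tau> - 1); \<bar>z2 - x2 powr (\<tau> - 1)\<bar> \<le> \<epsilon>; \<bar>z3 - x3 powr (\<tau> - 1)\<bar> \<le> \<epsilon>;
       \<bar>z1 * x1 - z2 * x2 - z3 * x3 + z4\<bar> \<le> A powr (2 * (\<tau> - 1)) * \<epsilon>\<^sup>2\<rbrakk> \<Longrightarrow>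
       z1 \<in> {1/B..B} \<and> z2 \<in> {1/B..B} \<and> z3 \<in> {1/B..B} \<and> z4 \<in> {1/B..B} \<and>
       \<bar>z1 powr p - z2 powr p - z3 powr p + z4 powr p\<bar> \<le> C * \<epsilon>\<^sup>2 \<and>
       \<bar>x2 - (z2 / z4) powr (1 / (\<tau> - 1))\<bar> \<le> C * \<epsilon> \<and>
       \<bar>x3 - (z3 / z4) powr (1 / (\<tau> - 1))\<bar> \<le> C * \<epsilon>"
proof -
  define q where "q = \<tau> - 1"
  have q: "q > 0" using assms by (simp add: q_def)
  have p: "p > 0" "q * p = \<tau>" "q * (p - 1) = 1" using assms by (auto simp: p_def q_def field_simps)
  define Aq where "Aq = A powr q"
  have Aq: "Aq \<ge> 1" using assms q by (simp add: Aq_def ge_one_powr_ge_zero)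
  define A2 where "A2 = A powr (2 * q)"
  have A2: "A2 \<ge> 1" using assms q by (simp add: A2_def ge_one_powr_ge_zero)
  define D where "D = 2 * A2 + 2 * A"
  have D: "D \<ge> 4" using A2 assms by (simp add: D_def)
  \<comment> \<open>Small enough for two purposes: \<open>D * \<omega> \<le> 1/2\<close> keeps
    \<open>z4\<close> within \<open>1/2\<close> of \<open>1\<close>, and
    \<open>\<omega> \<le> 1 / (2 * Aq)\<close> lets \<open>z2\<close> and \<open>z3\<close> lose at
    most half of the lower bound \<open>1 / Aq\<close> of the powers that they approximate.\<close>
  define \<omega> where "\<omega> = 1 / (2 * D * Aq)"
  define B where "B = 2 * Aq"
  have B: "B \<ge> 1" using Aq by (simp add: B_def)
  have \<omega>: "\<omega> > 0" "\<omega> \<le> 1" "D * \<omega> \<le> 1/2" "\<omega> \<le> 1 / (2 * Aq)"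
  proof -
    show "\<omega> > 0" using D Aq by (simp add: \<omega>_def)
    have "D * Aq \<ge> 1" using D Aq by (smt (verit) mult_le_cancel_left1)
    then have "2 * D * Aq \<ge> 1" by simp
    then show "\<omega> \<le> 1" unfolding \<omega>_def by (smt (verit) divide_le_eq_1)
    show "D * \<omega> \<le> 1/2" using D Aq by (simp add: \<omega>_def field_simps)
    show "\<omega> \<le> 1 / (2 * Aq)" using D Aq by (simp add: \<omega>_def field_simps)
  qed
  obtain K where K: "K > 0" "\<And>x y. \<lbrakk>x \<in> {1/B..B}; y \<in> {1/B..B}\<rbrakk> \<Longrightarrow>
       \<bar>y powr p - x powr p - p * x powr (p - 1) * (y - x)\<bar> \<le> K * (y - x)\<^sup>2"
    using powr_taylor_on[OF B, of p] by metis
  \<comment> \<open>The quotients \<open>z2 / z4\<close> and \<open>z3 / z4\<close> of numbers in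
    \<open>{1/B..B}\<close> lie in this larger interval, on which the \<open>q\<close>-th root must
    be Lipschitz.\<close>
  define B' where "B' = B * B"
  have B': "B' \<ge> 1" "B \<le> B'" using B by (auto simp: B'_def mult_ge1_I)
  obtain L where L: "L > 0" "\<And>x y. \<lbrakk>x \<in> {1/B'..B'}; y \<in> {1/B'..B'}\<rbrakk> \<Longrightarrow>
       \<bar>y powr (1/q) - x powr (1/q)\<bar> \<le> L * \<bar>y - x\<bar>"
    using powr_lipschitz_on[OF B'(1), of "1/q"] by metis
  define C where "C = (A2 + p * (2 * A2) + K * (2 + D\<^sup>2)) + L * (2 * B * D + 1)"
  have C: "C > 0"
    unfolding C_def using A2 p K(1) L(1) B D by (intro add_pos_pos mult_pos_pos) (auto intro: add_pos_pos)
  have C1: "A2 + p * (2 * A2) + K * (2 + D\<^sup>2) \<le> C"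
    unfolding C_def using L(1) B D by (smt (verit) mult_nonneg_nonneg)
  have C2: "L * (2 * B * D + 1) \<le> C"
    unfolding C_def using A2 p K(1) D by (smt (verit) mult_nonneg_nonneg zero_le_power2)
  have th: "x powr q \<in> {1/Aq..Aq}" "x > 0" "(x powr q) powr p = x powr \<tau>"
       "(x powr q) powr (p - 1) = x" "(x powr q) powr (1/q) = x" "x powr q * x = x powr \<tau>"
    if "x \<in> {1/A..A}" for x
  proof -
    show x: "x > 0" using that assms(2) by (auto intro: less_le_trans[of 0 "1/A"])
    have "(1/A) powr q \<le> x powr q" "x powr q \<le> A powr q"
      using that assms x q by (auto intro!: powr_mono2)
    then show "x powr q \<in> {1/Aq..Aq}" using assms by (simp add: Aq_def powr_divide)
    show "(x powr q) powr p = x powr \<tau>" "(x powr q) powr (p - 1) = x" "(x powr q) powr (1/q) = x"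
      using x p q by (auto simp: powr_powr)
    show "x powr q * x = x powr \<tau>" using x powr_add[of x q 1] by (simp add: q_def)
  qed
  show ?thesis
  proof (rule that[OF \<omega>(1) B C])
    fix \<epsilon> x1 x2 x3 z1 z2 z3 z4 :: real
    assume e: "0 \<le> \<epsilon>" "\<epsilon> \<le> \<omega>"
      and x: "x1 \<in> {1/A..A}" "x2 \<in> {1/A..A}" "x3 \<in> {1/A..A}"
      and "\<bar>x1 powr \<tau> - x2 powr \<tau> - x3 powr \<tau> + 1\<bar> \<le> A powr (2 * (\<tau> - 1)) * \<epsilon>\<^sup>2"
      and "z1 = x1 powr (\<tau> - 1)" "\<bar>z2 - x2 powr (\<tau> - 1)\<bar> \<le> \<epsilon>" "\<bar>z3 - x3 powr (\<tau> - 1)\<bar> \<le> \<epsilon>"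
      and "\<bar>z1 * x1 - z2 * x2 - z3 * x3 + z4\<bar> \<le> A powr (2 * (\<tau> - 1)) * \<epsilon>\<^sup>2"
    then have hx: "\<bar>x1 powr \<tau> - x2 powr \<tau> - x3 powr \<tau> + 1\<bar> \<le> A2 * \<epsilon>\<^sup>2"
      and z: "z1 = x1 powr q" "\<bar>z2 - x2 powr q\<bar> \<le> \<epsilon>" "\<bar>z3 - x3 powr q\<bar> \<le> \<epsilon>"
      and hz: "\<bar>z1 * x1 - z2 * x2 - z3 * x3 + z4\<bar> \<le> A2 * \<epsilon>\<^sup>2"
      by (auto simp: q_def A2_def)
    note [simp] = th(2)[OF x(2), THEN less_imp_le] th(2)[OF x(3), THEN less_imp_le]
    have e1: "\<epsilon> \<le> 1" using e \<omega>(2) by linarith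
    have e2: "\<epsilon>\<^sup>2 \<le> \<epsilon>" using e(1) e1 by (simp add: power2_eq_square mult_left_le)
    \<comment> \<open>As \<open>x powr q * x = x powr \<tau>\<close>, the exact normal is orthogonal
      to an exact cone point. Subtracting the cone equation from the near orthogonality therefore
      isolates \<open>z4 - 1\<close>.\<close>
    have z4eq: "z4 - 1 = (z1 * x1 - z2 * x2 - z3 * x3 + z4) - (x1 powr \<tau> - x2 powr \<tau> - x3 powr \<tau> + 1)
        + (z2 - x2 powr q) * x2 + (z3 - x3 powr q) * x3"
      unfolding z(1) using th(6)[OF x(1)] th(6)[OF x(2)] th(6)[OF x(3)] by (simp add: algebra_simps)
    have "\<bar>(z2 - x2 powr q) * x2\<bar> \<le> \<epsilon> * A" "\<bar>(z3 - x3 powr q) * x3\<bar> \<le> \<epsilon> * A"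
      unfolding abs_mult using z x e(1) by (auto intro!: mult_mono)
    then have "\<bar>z4 - 1\<bar> \<le> 2 * (A2 * \<epsilon>\<^sup>2) + 2 * (\<epsilon> * A)"
      unfolding z4eq using hx hz by linarith
    also have "\<dots> \<le> 2 * (A2 * \<epsilon>) + 2 * (\<epsilon> * A)"
      using e2 A2 by simp
    also have "\<dots> = D * \<epsilon>" by (simp add: D_def algebra_simps)
    finally have z4: "\<bar>z4 - 1\<bar> \<le> D * \<epsilon>" .
    have "D * \<epsilon> \<le> D * \<omega>" using e D by simp
    then have z4h: "\<bar>z4 - 1\<bar> \<le> 1/2" using z4 \<omega>(3) by linarith
    then have z4ge: "1/2 \<le> z4" by linarith
    have z4B: "z4 \<in> {1/B..B}" and oneB: "1 \<in> {1/B..B}"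
    proof -
      have "1/B \<le> 1/2" using Aq by (simp add: B_def field_simps)
      moreover have "B \<ge> 3/2" using Aq by (simp add: B_def)
      ultimately show "z4 \<in> {1/B..B}" "1 \<in> {1/B..B}"
        using z4h unfolding atLeastAtMost_iff by linarith+
    qed
    have thB: "x powr q \<in> {1/B..B}" if "x \<in> {1/A..A}" for x
    proof -
      have "1/B \<le> 1/Aq" using Aq by (simp add: B_def field_simps)
      then show ?thesis using th(1)[OF that] Aq by (auto simp: B_def)
    qed
    have zB: "z \<in> {1/B..B}" if "x \<in> {1/A..A}" "\<bar>z - x powr q\<bar> \<le> \<epsilon>" for x z
    proof -
      have "\<bar>z - x powr q\<bar> \<le> 1 / (2 * Aq)" using that e \<omega>(4) by linarith
      moreover have "1/Aq \<le> x powr q" "x powr q \<le> Aq" using th(1)[OF that(1)] by auto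
      moreover have "1 / (2 * Aq) \<le> Aq" using Aq
        by (smt (verit) divide_le_eq_1)
      moreover have "1/Aq = 1 / (2 * Aq) + 1 / (2 * Aq)" using Aq by (simp add: field_simps)
      ultimately show ?thesis unfolding B_def atLeastAtMost_iff abs_le_iff by linarith
    qed
    have zzB: "z1 \<in> {1/B..B}" "z2 \<in> {1/B..B}" "z3 \<in> {1/B..B}"
      using zB[OF x(1), of z1] zB[OF x(2), of z2] zB[OF x(3), of z3] z e by auto
    let ?r = "\<lambda>x z. z powr p - x powr \<tau> - p * x * (z - x powr q)"
    have r: "\<bar>?r x z\<bar> \<le> K * \<epsilon>\<^sup>2" if "x \<in> {1/A..A}" "\<bar>z - x powr q\<bar> \<le> \<epsilon>" for x z
    proof -
      have "\<bar>?r x z\<bar> \<le> K * (z - x powr q)\<^sup>2"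
        using K(2)[OF thB[OF that(1)] zB[OF that]] th[OF that(1)] by simp
      also have "\<dots> \<le> K * \<epsilon>\<^sup>2"
        using power_mono[OF that(2), of 2] K(1) by (intro mult_left_mono) auto
      finally show ?thesis .
    qed
    have r4: "\<bar>z4 powr p - 1 - p * (z4 - 1)\<bar> \<le> K * (D\<^sup>2 * \<epsilon>\<^sup>2)"
    proof -
      have "\<bar>z4 powr p - 1 - p * (z4 - 1)\<bar> \<le> K * (z4 - 1)\<^sup>2"
        using K(2)[OF oneB z4B] by simp
      also have "\<dots> \<le> K * (D * \<epsilon>)\<^sup>2"
        using power_mono[OF z4, of 2] K(1) by (intro mult_left_mono) auto
      finally show ?thesis by (simp add: power_mult_distrib)
    qed
    have z1p: "z1 powr p = x1 powr \<tau>" unfolding z(1) using th(3)[OF x(1)] .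
    \<comment> \<open>Expand at the exact normal. The zeroth order terms form the cone equation and
      the first order terms recombine to \<open>p\<close> times the defect of orthogonality, so
      everything of order \<open>\<epsilon>\<close> cancels.\<close>
    have "z1 powr p - z2 powr p - z3 powr p + z4 powr p =
        (x1 powr \<tau> - x2 powr \<tau> - x3 powr \<tau> + 1)
        + p * ((z1 * x1 - z2 * x2 - z3 * x3 + z4) - (x1 powr \<tau> - x2 powr \<tau> - x3 powr \<tau> + 1))
        - ?r x2 z2 - ?r x3 z3 + (z4 powr p - 1 - p * (z4 - 1))"
    proof -
      have "(z1 * x1 - z2 * x2 - z3 * x3 + z4) - (x1 powr \<tau> - x2 powr \<tau> - x3 powr \<tau> + 1) =
         (z4 - 1) - (z2 - x2 powr q) * x2 - (z3 - x3 powr q) * x3"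
        using z4eq by linarith
      then show ?thesis unfolding z1p by (simp only:) (simp add: algebra_simps)
    qed
    moreover have "\<bar>p * ((z1 * x1 - z2 * x2 - z3 * x3 + z4) - (x1 powr \<tau> - x2 powr \<tau> - x3 powr \<tau> + 1))\<bar>
        \<le> p * (2 * (A2 * \<epsilon>\<^sup>2))"
      unfolding abs_mult using hx hz p(1) by (intro mult_mono) auto
    ultimately have "\<bar>z1 powr p - z2 powr p - z3 powr p + z4 powr p\<bar> \<le>
        A2 * \<epsilon>\<^sup>2 + p * (2 * (A2 * \<epsilon>\<^sup>2)) + K * \<epsilon>\<^sup>2 + K * \<epsilon>\<^sup>2 + K * (D\<^sup>2 * \<epsilon>\<^sup>2)"
      using hx r[OF x(2) z(2)] r[OF x(3) z(3)] r4 by linarith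
    also have "\<dots> = (A2 + p * (2 * A2) + K * (2 + D\<^sup>2)) * \<epsilon>\<^sup>2" by (simp add: algebra_simps)
    also have "\<dots> \<le> C * \<epsilon>\<^sup>2" using C1 by (intro mult_right_mono) auto
    finally have S: "\<bar>z1 powr p - z2 powr p - z3 powr p + z4 powr p\<bar> \<le> C * \<epsilon>\<^sup>2" .
    have R: "\<bar>x - (z / z4) powr (1 / (\<tau> - 1))\<bar> \<le> C * \<epsilon>" if "x \<in> {1/A..A}" "\<bar>z - x powr q\<bar> \<le> \<epsilon>" for x z
    proof -
      have zb: "1/B \<le> z" "z \<le> B" "1/B \<le> z4" "z4 \<le> B" using zB[OF that] z4B by auto
      have pos: "z > 0" "z4 > 0" using zb B by (auto intro: less_le_trans[of 0 "1/B"])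
      have in1: "z / z4 \<in> {1/B'..B'}"
      proof -
        have "z / z4 \<le> B / (1/B)" using zb pos B by (intro frac_le) auto
        moreover have "(1/B) / B \<le> z / z4" using zb pos B by (intro frac_le) auto
        ultimately show ?thesis by (simp add: B'_def)
      qed
      have in2: "x powr q \<in> {1/B'..B'}"
      proof -
        have "1/B' \<le> 1/B" using B B' by (intro divide_left_mono) auto
        then show ?thesis using thB[OF that(1)] B' by auto
      qed
      have "\<bar>x - (z / z4) powr (1/q)\<bar> \<le> L * \<bar>x powr q - z / z4\<bar>"
        using L(2)[OF in1 in2] th(5)[OF that(1)] by simp
      also have "\<bar>x powr q - z / z4\<bar> \<le> (2 * B * D + 1) * \<epsilon>"
      proof -
        have "\<bar>z - z / z4\<bar> = z * \<bar>z4 - 1\<bar> / z4"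
        proof -
          have "z - z / z4 = z * (z4 - 1) / z4" using pos by (simp add: field_simps)
          then show ?thesis using pos by (simp add: abs_mult)
        qed
        also have "\<dots> \<le> B * (D * \<epsilon>) / (1/2)"
          using zb pos z4 z4ge B D e by (intro frac_le mult_mono) auto
        finally show ?thesis using that(2) by (simp add: algebra_simps)
      qed
      finally have "\<bar>x - (z / z4) powr (1/q)\<bar> \<le> L * (2 * B * D + 1) * \<epsilon>" using L(1) by (simp add: mult.assoc)
      also have "\<dots> \<le> C * \<epsilon>" using C2 e by (intro mult_right_mono) auto
      finally show ?thesis by (simp add: q_def)
    qed
    show "z1 \<in> {1/B..B} \<and> z2 \<in> {1/B..B} \<and> z3 \<in> {1/B..B} \<and> z4 \<in> {1/B..B} \<and>
       \<bar>z1 powr p - z2 powr p - z3 powr p + z4 powr p\<bar> \<le> C * \<epsilon>\<^sup>2 \<and>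
       \<bar>x2 - (z2 / z4) powr (1 / (\<tau> - 1))\<bar> \<le> C * \<epsilon> \<and>
       \<bar>x3 - (z3 / z4) powr (1 / (\<tau> - 1))\<bar> \<le> C * \<epsilon>"
      using zzB z4B S R[OF x(2) z(2)] R[OF x(3) z(3)] by blast
  qed
qed

section \<open>Counting quadruples in a cap\<close>

text \<open>\<open>T\<close> measures precision relative to the size \<open>M powr \<tau>\<close> of
  the terms. The free ratio \<open>A\<close> allows the dual problem, whose variables range over
  another interval, to be an instance of the same definition.\<close>

definition near_sols :: "real \<Rightarrow> real \<Rightarrow> real \<Rightarrow> real \<Rightarrow> int4 set" where
  "near_sols \<tau> A M T = {(a, b, c, d).
     real_of_int a \<in> {M..A * M} \<and> real_of_int b \<in> {M..A * M} \<and>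
     real_of_int c \<in> {M..A * M} \<and> real_of_int d \<in> {M..A * M} \<and>
     \<bar>a powr \<tau> - b powr \<tau> - c powr \<tau> + d powr \<tau>\<bar> \<le> M powr \<tau> / T}"

text \<open>
  The polar of the cap around the direction \<open>(x1, x2, x3, 1)\<close> of the cone; in \<open>k\<close> it is a shear of a product
  of intervals, whence its volume.
\<close>

definition dual_box :: "real \<Rightarrow> real \<Rightarrow> real \<Rightarrow> real \<Rightarrow> real \<Rightarrow> real \<Rightarrow> real \<Rightarrow> int4 set" where
  "dual_box q x1 x2 x3 u v w = {(k1, k2, k3, k4).
     \<bar>real_of_int k1\<bar> \<le> u \<and>
     \<bar>k2 + k1 * (x2 powr q / x1 powr q)\<bar> \<le> v \<and>
     \<bar>k3 + k1 * (x3 powr q / x1 powr q)\<bar> \<le> v \<and>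
     \<bar>real_of_int k1 * x1 + real_of_int k2 * x2 + real_of_int k3 * x3 + real_of_int k4\<bar> \<le> w}"

section \<open>Integer points in sheared boxes\<close>

lemma int_interval_eq:
  fixes c w :: real
  shows "{k::int. \<bar>k + c\<bar> \<le> w} = {\<lceil>- c - w\<rceil>..\<lfloor>w - c\<rfloor>}"
  by (auto simp: abs_le_iff ceiling_le_iff le_floor_iff)

lemma card_int_interval_le:
  fixes c w :: real
  assumes "w \<ge> 0"
  shows "finite {k::int. \<bar>k + c\<bar> \<le> w}" "real (card {k::int. \<bar>k + c\<bar> \<le> w}) \<le> 2 * w + 1"
proof -
  show "finite {k::int. \<bar>k + c\<bar> \<le> w}" by (simp add: int_interval_eq)
  have "real_of_int (\<lfloor>w - c\<rfloor> - \<lceil>- c - w\<rceil> + 1) \<le> 2 * w + 1"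
    using of_int_floor_le[of "w - c"] le_of_int_ceiling[of "- c - w"]
    unfolding of_int_add of_int_diff of_int_1 by linarith
  then show "real (card {k::int. \<bar>k + c\<bar> \<le> w}) \<le> 2 * w + 1"
    using assms by (simp add: int_interval_eq of_nat_nat nat_le_iff)
qed

lemma card_int_interval_ge:
  fixes c w :: real
  assumes "w \<ge> 1"
  shows "w \<le> real (card {k::int. \<bar>k + c\<bar> \<le> w})"
proof -
  \<comment> \<open>An interval of length \<open>2 * w\<close> contains more than
    \<open>2 * w - 1\<close> integers, and this is at least \<open>w\<close> because
    \<open>w \<ge> 1\<close>.\<close>
  have "w \<le> real_of_int (\<lfloor>w - c\<rfloor> - \<lceil>- c - w\<rceil> + 1)"
    using floor_correct[of "w - c"] ceiling_correct[of "- c - w"] assms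
    unfolding of_int_add of_int_diff of_int_1 by linarith
  also have "\<dots> \<le> real (nat (\<lfloor>w - c\<rfloor> - \<lceil>- c - w\<rceil> + 1))" by linarith
  finally show ?thesis unfolding int_interval_eq card_atLeastAtMost_int by (simp add: algebra_simps)
qed

lemma card_Sigma_ge:
  fixes P :: "'b set" and Q :: "'b \<Rightarrow> 'c set"
  assumes "finite P" "\<And>x. x \<in> P \<Longrightarrow> finite (Q x)"
    and "u \<le> real (card P)" "\<And>x. x \<in> P \<Longrightarrow> v \<le> real (card (Q x))" "v \<ge> 0"
  shows "u * v \<le> real (card (Sigma P Q))"
proof -
  have "u * v \<le> real (card P) * v" using assms by (intro mult_right_mono) auto
  also have "\<dots> = (\<Sum>x\<in>P. v)" by simp
  also have "\<dots> \<le> (\<Sum>x\<in>P. real (card (Q x)))" using assms by (intro sum_mono) auto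
  also have "\<dots> = real (card (Sigma P Q))" using assms by (simp add: card_SigmaI)
  finally show ?thesis .
qed

text \<open>Once the earlier coordinates are fixed, the next one runs through an interval whose
  centre depends on them but whose length does not. Hence the number of points is governed by the
  product of the lengths.\<close>

lemma dual_box_Sigma:
  fixes x1 x2 x3 w :: real
  shows "dual_box q x1 x2 x3 u v w = (SIGMA k1:{k. \<bar>real_of_int k + 0\<bar> \<le> u}.
     SIGMA k2:{k. \<bar>k + k1 * (x2 powr q / x1 powr q)\<bar> \<le> v}.
     SIGMA k3:{k. \<bar>k + k1 * (x3 powr q / x1 powr q)\<bar> \<le> v}.
     {k. \<bar>k + (k1 * x1 + k2 * x2 + k3 * x3)\<bar> \<le> w})"
  by (auto simp: dual_box_def add_ac)

lemma finite_dual_box: "finite (dual_box q x1 x2 x3 u v w)"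
proof -
  have fin: "finite {k::int. \<bar>k + c\<bar> \<le> b}" for b c :: real
    by (simp add: int_interval_eq)
  show ?thesis unfolding dual_box_Sigma by (intro finite_SigmaI fin)
qed

lemma card_dual_box_ge:
  assumes "u \<ge> 1" "v \<ge> 1" "w \<ge> 1"
  shows "u * (v * (v * w)) \<le> real (card (dual_box q x1 x2 x3 u v w))"
proof -
  have fin: "finite {k::int. \<bar>k + c\<bar> \<le> b}" for b c :: real
    by (simp add: int_interval_eq)
  have "0 \<le> w" "0 \<le> v * w" "0 \<le> v * (v * w)" using assms by auto
  then show ?thesis
    unfolding dual_box_Sigma using assms
    by (intro card_Sigma_ge card_int_interval_ge finite_SigmaI fin)
qed

text \<open>All four conditions bound linear forms. Two points of the box therefore differ by a
  vector \<open>R * k\<close> in the doubled box, and dividing by \<open>R\<close> locates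
  \<open>k\<close>.\<close>

lemma dual_box_diff:
  fixes x1 x2 x3 w :: real
  assumes R: "R > (0::nat)"
    and "g \<in> dual_box q x1 x2 x3 u v w" "lin4 g (int R) k \<in> dual_box q x1 x2 x3 u v w"
  shows "k \<in> dual_box q x1 x2 x3 (2 * u / R) (2 * v / R) (2 * w / R)"
proof -
  obtain g1 g2 g3 g4 where g: "g = (g1, g2, g3, g4)" by (cases g) auto
  obtain k1 k2 k3 k4 where k: "k = (k1, k2, k3, k4)" by (cases k) auto
  have *: "\<bar>t\<bar> \<le> 2 * b / R" if "\<bar>s\<bar> \<le> b" "\<bar>s + real R * t\<bar> \<le> b" for s t b :: real
  proof -
    have "real R * \<bar>t\<bar> = \<bar>(s + real R * t) - s\<bar>" by (simp add: abs_mult)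
    also have "\<dots> \<le> 2 * b" using that by linarith
    finally show ?thesis using R by (simp add: field_simps)
  qed
  let ?\<theta>2 = "x2 powr q / x1 powr q"
  let ?\<theta>3 = "x3 powr q / x1 powr q"
  have G: "\<bar>real_of_int g1\<bar> \<le> u" "\<bar>g2 + g1 * ?\<theta>2\<bar> \<le> v" "\<bar>g3 + g1 * ?\<theta>3\<bar> \<le> v"
      "\<bar>g1 * x1 + g2 * x2 + g3 * x3 + g4\<bar> \<le> w"
    using assms(2) by (auto simp: g dual_box_def)
  have "\<bar>real_of_int (g1 + int R * k1)\<bar> \<le> u"
      "\<bar>real_of_int (g2 + int R * k2) + real_of_int (g1 + int R * k1) * ?\<theta>2\<bar> \<le> v"
      "\<bar>real_of_int (g3 + int R * k3) + real_of_int (g1 + int R * k1) * ?\<theta>3\<bar> \<le> v"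
      "\<bar>real_of_int (g1 + int R * k1) * x1 + real_of_int (g2 + int R * k2) * x2
        + real_of_int (g3 + int R * k3) * x3 + real_of_int (g4 + int R * k4)\<bar> \<le> w"
    using assms(3) by (auto simp: g k dual_box_def)
  then have H: "\<bar>real_of_int g1 + real R * k1\<bar> \<le> u"
      "\<bar>(g2 + g1 * ?\<theta>2) + real R * (k2 + k1 * ?\<theta>2)\<bar> \<le> v"
      "\<bar>(g3 + g1 * ?\<theta>3) + real R * (k3 + k1 * ?\<theta>3)\<bar> \<le> v"
      "\<bar>(g1 * x1 + g2 * x2 + g3 * x3 + g4) + real R * (k1 * x1 + k2 * x2 + k3 * x3 + k4)\<bar> \<le> w"
    by (simp_all add: algebra_simps)
  show ?thesis
    using *[OF G(1) H(1)] *[OF G(2) H(2)] *[OF G(3) H(3)] *[OF G(4) H(4)]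
    by (simp add: k dual_box_def)
qed

text \<open>The equation is homogeneous: dividing by \<open>d powr \<tau>\<close>, which is at least
  \<open>M powr \<tau>\<close>, passes to the chart \<open>x4 = 1\<close> with error at most
  \<open>1/T\<close>.\<close>

lemma near_solsD:
  assumes "(a, b, c, d) \<in> near_sols \<tau> A M T" "M > 0" "T > 0" "\<tau> \<ge> 0"
  shows "real_of_int a / d \<in> {1/A..A}" "real_of_int b / d \<in> {1/A..A}" "real_of_int c / d \<in> {1/A..A}"
    "\<bar>(a / d) powr \<tau> - (b / d) powr \<tau> - (c / d) powr \<tau> + 1\<bar> \<le> 1/T"
    "real_of_int d \<in> {M..A * M}"
proof -
  have S: "real_of_int a \<in> {M..A * M}" "real_of_int b \<in> {M..A * M}"
     "real_of_int c \<in> {M..A * M}" and d: "real_of_int d \<in> {M..A * M}"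
     and E: "\<bar>a powr \<tau> - b powr \<tau> - c powr \<tau> + d powr \<tau>\<bar> \<le> M powr \<tau> / T"
    using assms(1) by (auto simp: near_sols_def)
  have d0: "real_of_int d > 0" using d assms by auto
  have "0 < A * M" using d d0 by simp
  then have A: "A > 0" using assms(2) by (simp add: zero_less_mult_iff)
  have *: "real_of_int u / d \<in> {1/A..A}" if "real_of_int u \<in> {M..A * M}" for u
  proof -
    have "M * A \<le> real_of_int u * A" using that A by (intro mult_right_mono) auto
    then have "real_of_int u * A \<ge> d" using d unfolding atLeastAtMost_iff by (simp add: mult.commute)
    moreover have "A * M \<le> A * d" using d A by (intro mult_left_mono) auto
    then have "real_of_int u \<le> A * d" using that unfolding atLeastAtMost_iff by linarith
    ultimately show ?thesis using d0 A by (simp add: field_simps)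
  qed
  show "real_of_int a / d \<in> {1/A..A}" "real_of_int b / d \<in> {1/A..A}" "real_of_int c / d \<in> {1/A..A}"
    using * S by auto
  show "real_of_int d \<in> {M..A * M}" by fact
  have "(a / d) powr \<tau> - (b / d) powr \<tau> - (c / d) powr \<tau> + 1 =
     (a powr \<tau> - b powr \<tau> - c powr \<tau> + d powr \<tau>) / d powr \<tau>"
  proof -
    have "(u / d) powr \<tau> = u powr \<tau> / d powr \<tau>" if "u \<in> {M..A * M}" for u
      using that assms d0 by (simp add: powr_divide)
    then show ?thesis using S d0 by (simp add: diff_divide_distrib add_divide_distrib)
  qed
  also have "\<bar>\<dots>\<bar> \<le> (M powr \<tau> / T) / d powr \<tau>"
    using divide_right_mono[OF E, of "d powr \<tau>"] by simp
  also have "\<dots> \<le> (d powr \<tau> / T) / d powr \<tau>"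
    using d assms d0 by (intro divide_right_mono powr_mono2) auto
  also have "\<dots> = 1/T" using d0 by simp
  finally show "\<bar>(a / d) powr \<tau> - (b / d) powr \<tau> - (c / d) powr \<tau> + 1\<bar> \<le> 1/T" .
qed

lemma near_sols_subset_pos:
  assumes "M > 0"
  shows "near_sols \<tau> A M T \<subseteq> {1..\<lfloor>A * M\<rfloor>} \<times> {1..\<lfloor>A * M\<rfloor>} \<times> {1..\<lfloor>A * M\<rfloor>} \<times> {1..\<lfloor>A * M\<rfloor>}"
proof -
  have "1 \<le> a \<and> a \<le> \<lfloor>A * M\<rfloor>" if "real_of_int a \<in> {M..A * M}" for a
  proof -
    have "real_of_int a > 0" using that assms by auto
    then show ?thesis using that by (simp add: le_floor_iff)
  qed
  then show ?thesis unfolding near_sols_def by auto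
qed

lemma finite_near_sols: "M > 0 \<Longrightarrow> finite (near_sols \<tau> A M T)"
  by (rule finite_subset[OF near_sols_subset_pos]) auto

text \<open>Transference is applied to \<open>R\<close> times the polar of the cap, for a large
  auxiliary \<open>R\<close>. The sides of this box then exceed \<open>1\<close>, so that it has
  about as many points as its volume, and \<open>R\<close> cancels: the number of solutions is
  bounded by the reciprocal volume of the polar box, about \<open>M^4 / T\<^sup>2\<close>, times the
  number of its integer points.\<close>

lemma cell_card_le:
  fixes \<tau> A :: real
  assumes \<tau>: "\<tau> > 1" and A: "A \<ge> 1"
  obtains \<eta>0 where "\<eta>0 > 0"
    "\<And>\<eta> M T a0 b0 c0 d0 S. \<lbrakk>0 < \<eta>; \<eta> \<le> \<eta>0; M > 0; T \<ge> 1;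
       (a0, b0, c0, d0) \<in> near_sols \<tau> A M T; S \<subseteq> near_sols \<tau> A M T;
       \<And>a b c d. (a, b, c, d) \<in> S \<Longrightarrow>
         \<bar>b / d - b0 / d0\<bar> \<le> 1 / sqrt T \<and> \<bar>c / d - c0 / d0\<bar> \<le> 1 / sqrt T\<rbrakk> \<Longrightarrow>
       real (card S) \<le> 2 * A / \<eta> ^ 4 * (M ^ 4 / T\<^sup>2) *
         real (card (dual_box (\<tau> - 1) (a0 / d0) (b0 / d0) (c0 / d0)
           (2 * \<eta> * T / M) (2 * \<eta> * sqrt T / M) (2 * \<eta> / (A * M))))"
proof -
  obtain C where C: "C > 0" and tangent: "\<And>T x1 x2 x3 y1 y2 y3. \<lbrakk>T \<ge> 1;
       x1 \<in> {1/A..A}; x2 \<in> {1/A..A}; x3 \<in> {1/A..A};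
       y1 \<in> {1/A..A}; y2 \<in> {1/A..A}; y3 \<in> {1/A..A};
       \<bar>x1 powr \<tau> - x2 powr \<tau> - x3 powr \<tau> + 1\<bar> \<le> 1/T;
       \<bar>y1 powr \<tau> - y2 powr \<tau> - y3 powr \<tau> + 1\<bar> \<le> 1/T;
       \<bar>y2 - x2\<bar> \<le> 1 / sqrt T; \<bar>y3 - x3\<bar> \<le> 1 / sqrt T\<rbrakk> \<Longrightarrow>
       \<bar>x1 powr (\<tau> - 1) * (y1 - x1) - x2 powr (\<tau> - 1) * (y2 - x2)
         - x3 powr (\<tau> - 1) * (y3 - x3)\<bar> \<le> C / T"
    using tangent_plane_bound[OF \<tau> A] by metis
  define q where "q = \<tau> - 1"
  have q: "q > 0" using \<tau> by (simp add: q_def)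
  define Aq where "Aq = A powr q"
  have Aq: "Aq \<ge> 1" using A q by (simp add: Aq_def ge_one_powr_ge_zero)
  \<comment> \<open>The summands are the contributions to \<open>dot4 g m / (R * \<eta>)\<close> of
    the value at the base point, of the tangent form and of the two transverse displacements;
    \<open>\<eta>0\<close> then makes the total at most \<open>R / 8\<close>.\<close>
  define E where "E = 1 + A * Aq * C + 2 * A"
  have E: "E > 0" using A Aq C by (simp add: E_def add_pos_nonneg)
  define \<eta>0 where "\<eta>0 = 1 / (8 * E)"
  have \<eta>0: "\<eta>0 > 0" using E by (simp add: \<eta>0_def)
  show ?thesis
  proof (rule that[OF \<eta>0])
    fix \<eta> M T a0 b0 c0 d0 S
    assume \<eta>: "0 < \<eta>" "\<eta> \<le> \<eta>0" and M: "M > 0" and T: "T \<ge> 1"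
      and m0: "(a0, b0, c0, d0) \<in> near_sols \<tau> A M T" and S: "S \<subseteq> near_sols \<tau> A M T"
      and cell: "\<And>a b c d. (a, b, c, d) \<in> S \<Longrightarrow>
         \<bar>b / d - b0 / d0\<bar> \<le> 1 / sqrt T \<and> \<bar>c / d - c0 / d0\<bar> \<le> 1 / sqrt T"
    define x1 x2 x3 where "x1 = a0 / d0" "x2 = b0 / d0" "x3 = c0 / d0"
    note x_def = x1_x2_x3_def
    have T0: "T > 0" using T by simp
    have x: "x1 \<in> {1/A..A}" "x2 \<in> {1/A..A}" "x3 \<in> {1/A..A}"
        "\<bar>x1 powr \<tau> - x2 powr \<tau> - x3 powr \<tau> + 1\<bar> \<le> 1/T"
      using near_solsD[OF m0 M T0] \<tau> unfolding x_def by auto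
    have x1: "x1 > 0" using x(1) A by (auto intro: less_le_trans[of 0 "1/A"])
    have \<theta>1: "1 / x1 powr q \<le> Aq"
    proof -
      have "(1/x1) powr q \<le> A powr q"
        using x(1) x1 A q by (intro powr_mono2) (auto simp: field_simps)
      then show ?thesis using x1 by (simp add: Aq_def powr_divide)
    qed
    \<comment> \<open>The bound \<open>A * M\<close> makes the quadruples distinct residues modulo
      \<open>R\<close>; the other three make \<open>u\<close>, \<open>v\<close> and \<open>w\<close>
      at least \<open>1\<close>.\<close>
    obtain R :: nat where R: "real R > Max {A * M, M / (\<eta> * T), M / (\<eta> * sqrt T), A * M / \<eta>}"
      using reals_Archimedean2 by blast
    then have R': "real R > A * M" "real R > M / (\<eta> * T)" "real R > M / (\<eta> * sqrt T)" "real R > A * M / \<eta>"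
      by auto
    have R0: "R > 0" using R'(1) A M by (smt (verit) mult_pos_pos of_nat_0_less_iff)
    define u v w where "u = R * (\<eta> * T / M)" "v = R * (\<eta> * sqrt T / M)" "w = R * (\<eta> / (A * M))"
    note uvw_def = u_v_w_def
    have uvw: "u \<ge> 1" "v \<ge> 1" "w \<ge> 1"
      using R' \<eta> T0 M A by (auto simp: uvw_def field_simps)
    define G where "G = dual_box q x1 x2 x3 u v w"
    define D where "D = dual_box q x1 x2 x3 (2 * u / R) (2 * v / R) (2 * w / R)"
    have "real (card S) * real (card G) \<le> 2 * real R ^ 4 * real (card D)"
    proof (rule transference[OF R0])
      have "\<lfloor>A * M\<rfloor> < int R" using R'(1) by (simp add: floor_less_iff)
      then have "{1..\<lfloor>A * M\<rfloor>} \<subseteq> {0..<int R}" by auto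
      then show "S \<subseteq> {0..<int R} \<times> {0..<int R} \<times> {0..<int R} \<times> {0..<int R}"
        using S near_sols_subset_pos[OF M, of \<tau> A T] by blast
      show "finite G" "finite D" by (simp_all add: G_def D_def finite_dual_box)
      show "k \<in> D" if "g \<in> G" "lin4 g (int R) k \<in> G" for g k
        using that dual_box_diff[OF R0] unfolding G_def D_def by blast
      fix g m assume g: "g \<in> G" and m: "m \<in> S"
      obtain g1 g2 g3 g4 where gg: "g = (g1, g2, g3, g4)" by (cases g) auto
      obtain a b c d where mm: "m = (a, b, c, d)" by (cases m) auto
      define y1 y2 y3 where "y1 = a / d" "y2 = b / d" "y3 = c / d"
      note y_def = y1_y2_y3_def
      have mS: "(a, b, c, d) \<in> near_sols \<tau> A M T" using S m mm by auto
      have y: "y1 \<in> {1/A..A}" "y2 \<in> {1/A..A}" "y3 \<in> {1/A..A}"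
        "\<bar>y1 powr \<tau> - y2 powr \<tau> - y3 powr \<tau> + 1\<bar> \<le> 1/T" and d: "real_of_int d \<in> {M..A * M}"
        using near_solsD[OF mS M T0] \<tau> unfolding y_def by auto
      have d0: "real_of_int d > 0" using d M by auto
      have dy: "\<bar>y2 - x2\<bar> \<le> 1 / sqrt T" "\<bar>y3 - x3\<bar> \<le> 1 / sqrt T"
        using cell[of a b c d] m unfolding mm x_def y_def by auto
      define t where "t = x1 powr q * (y1 - x1) - x2 powr q * (y2 - x2) - x3 powr q * (y3 - x3)"
      have t: "\<bar>t\<bar> \<le> C / T"
        unfolding t_def q_def using tangent[OF T x(1-3) y(1-3) x(4) y(4) dy] .
      define e2 where "e2 = g2 + g1 * (x2 powr q / x1 powr q)"
      define e3 where "e3 = g3 + g1 * (x3 powr q / x1 powr q)"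
      have e: "\<bar>real_of_int g1\<bar> \<le> u" "\<bar>e2\<bar> \<le> v" "\<bar>e3\<bar> \<le> v" "\<bar>g1 * x1 + g2 * x2 + g3 * x3 + g4\<bar> \<le> w"
        using g by (auto simp: G_def gg dual_box_def e2_def e3_def)
      have ay: "a = d * y1" "b = d * y2" "c = d * y3" using d0 by (auto simp: y_def)
      \<comment> \<open>Coordinates adapted to the cap: the base direction, the tangent form
        \<open>t\<close>, which is \<open>O(1/T)\<close>, and two displacements of size
        \<open>1 / sqrt T\<close>. The sides \<open>w\<close>, \<open>u\<close> and \<open>v\<close>
        of the box are reciprocal to these, so each product has the same order.\<close>
      have "real_of_int (dot4 g m) = d * ((g1 * x1 + g2 * x2 + g3 * x3 + g4)
          + (g1 * (1 / x1 powr q)) * t + e2 * (y2 - x2) + e3 * (y3 - x3))"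
      proof -
        have "(g1 * (1 / x1 powr q)) * t = g1 * (y1 - x1)
           - g1 * (x2 powr q / x1 powr q) * (y2 - x2) - g1 * (x3 powr q / x1 powr q) * (y3 - x3)"
          using x1 by (simp add: t_def field_simps)
        then have *: "(g1 * x1 + g2 * x2 + g3 * x3 + g4) + (g1 * (1 / x1 powr q)) * t
            + e2 * (y2 - x2) + e3 * (y3 - x3) = g1 * y1 + g2 * y2 + g3 * y3 + g4"
          by (simp add: e2_def e3_def algebra_simps)
        show ?thesis unfolding * by (simp add: gg mm ay algebra_simps)
      qed
      also have "\<bar>\<dots>\<bar> \<le> (A * M) * (w + u * Aq * (C / T) + v * (1 / sqrt T) + v * (1 / sqrt T))"
      proof -
        have "\<bar>(g1 * (1 / x1 powr q)) * t\<bar> \<le> u * Aq * (C / T)"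
          unfolding abs_mult using e(1) \<theta>1 t uvw Aq by (intro mult_mono) auto
        moreover have "\<bar>e2 * (y2 - x2)\<bar> \<le> v * (1 / sqrt T)" "\<bar>e3 * (y3 - x3)\<bar> \<le> v * (1 / sqrt T)"
          unfolding abs_mult using e dy uvw by (intro mult_mono; simp)+
        ultimately have "\<bar>(g1 * x1 + g2 * x2 + g3 * x3 + g4)
          + (g1 * (1 / x1 powr q)) * t + e2 * (y2 - x2) + e3 * (y3 - x3)\<bar> \<le>
           w + u * Aq * (C / T) + v * (1 / sqrt T) + v * (1 / sqrt T)"
          using e(4) by (intro order_trans[OF abs_triangle_ineq add_mono])
        then show ?thesis
          unfolding abs_mult using d d0 A M by (intro mult_mono) auto
      qed
      also have "\<dots> = R * \<eta> * E"
      proof -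
        have "(A * M) * w = R * \<eta>" "(A * M) * (u * Aq * (C / T)) = R * \<eta> * (A * Aq * C)"
          "(A * M) * (v * (1 / sqrt T)) = R * \<eta> * A"
          using M T0 A by (simp_all add: uvw_def)
        then show ?thesis unfolding distrib_left E_def by (simp add: algebra_simps)
      qed
      also have "\<dots> \<le> R * \<eta>0 * E" using \<eta> E by (intro mult_right_mono mult_left_mono) auto
      also have "\<dots> = R / 8" using E by (simp add: \<eta>0_def)
      finally show "8 * \<bar>dot4 g m\<bar> \<le> int R" by linarith
    qed
    moreover have "u * (v * (v * w)) \<le> real (card G)"
      unfolding G_def using uvw by (rule card_dual_box_ge)
    ultimately have *: "real (card S) * (u * (v * (v * w))) \<le> 2 * real R ^ 4 * real (card D)"
      by (meson mult_left_mono of_nat_0_le_iff order_trans)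
    have "u * (v * (v * w)) = real R ^ 4 * (\<eta> ^ 4 * T\<^sup>2 / (A * M ^ 4))"
    proof -
      have "v * v = R\<^sup>2 * (\<eta>\<^sup>2 * T / M\<^sup>2)" using T0 by (simp add: uvw_def power2_eq_square)
      then have "u * (v * (v * w)) = u * w * (R\<^sup>2 * (\<eta>\<^sup>2 * T / M\<^sup>2))" by (metis mult.assoc mult.commute)
      also have "\<dots> = real R ^ 4 * (\<eta> ^ 4 * T\<^sup>2 / (A * M ^ 4))"
        by (simp add: uvw_def power2_eq_square power4_eq_xxxx mult_ac)
      finally show ?thesis .
    qed
    with * have "real R ^ 4 * (real (card S) * (\<eta> ^ 4 * T\<^sup>2 / (A * M ^ 4))) \<le> real R ^ 4 * (2 * real (card D))"
      by (simp add: mult_ac)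
    then have "real (card S) * (\<eta> ^ 4 * T\<^sup>2 / (A * M ^ 4)) \<le> 2 * real (card D)"
      by (rule mult_left_le_imp_le) (use R0 in simp)
    then have "real (card S) \<le> 2 * A / \<eta> ^ 4 * (M ^ 4 / T\<^sup>2) * real (card D)"
      using \<eta> T0 M A by (simp add: field_simps)
    moreover have "D = dual_box q x1 x2 x3 (2 * \<eta> * T / M) (2 * \<eta> * sqrt T / M) (2 * \<eta> / (A * M))"
      unfolding D_def uvw_def using R0 by (simp add: mult_ac)
    ultimately show "real (card S) \<le> 2 * A / \<eta> ^ 4 * (M ^ 4 / T\<^sup>2) *
         real (card (dual_box (\<tau> - 1) (a0 / d0) (b0 / d0) (c0 / d0)
           (2 * \<eta> * T / M) (2 * \<eta> * sqrt T / M) (2 * \<eta> / (A * M))))"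
      by (simp add: q_def x_def)
  qed
qed

text \<open>The normal of \<open>a powr \<tau> - b powr \<tau> - c powr \<tau> + d powr
  \<tau>\<close> has signs \<open>+ - - +\<close>, so a nonzero polar point becomes, up to these
  signs and a global sign \<open>\<sigma>\<close>, a positive near solution of the dual equation.
  The last two estimates say that the point in turn nearly determines the direction of the cap; they
  bound how many caps can share it.\<close>

lemma dual_box_near_sols:
  fixes \<tau> A \<eta>0 :: real
  assumes \<tau>: "\<tau> > 1" and A: "A \<ge> 1" and \<eta>0: "\<eta>0 > 0"
  defines "p \<equiv> \<tau> / (\<tau> - 1)"
  obtains \<eta> A' B c W where "0 < \<eta>" "\<eta> \<le> \<eta>0" "\<eta> \<le> 1/4" "A' \<ge> 1" "B \<ge> 1" "c > 0" "W \<ge> 1"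
    "\<And>M T x1 x2 x3 k. \<lbrakk>M \<ge> 1; T \<ge> 1; T \<le> M\<^sup>2;
       x1 \<in> {1/A..A}; x2 \<in> {1/A..A}; x3 \<in> {1/A..A};
       \<bar>x1 powr \<tau> - x2 powr \<tau> - x3 powr \<tau> + 1\<bar> \<le> 1/T;
       k \<in> dual_box (\<tau> - 1) x1 x2 x3 (2 * \<eta> * T / M) (2 * \<eta> * sqrt T / M) (2 * \<eta> / (A * M));
       k \<noteq> (0, 0, 0, 0)\<rbrakk> \<Longrightarrow>
       \<exists>\<sigma>\<in>{1, -1}. \<exists>i::nat. \<exists>l1 l2 l3 l4. k = (\<sigma> * l1, - \<sigma> * l2, - \<sigma> * l3, \<sigma> * l4) \<and>
         2 ^ i \<le> 2 * \<eta> * T / M \<and>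
         (l1, l2, l3, l4) \<in> near_sols p A' (2 ^ i / B) (c * (2 ^ i * M)\<^sup>2 / T) \<and>
         \<bar>of_int \<lfloor>x2 * sqrt T\<rfloor> - sqrt T * (l2 / l4) powr (1 / (\<tau> - 1))\<bar> \<le> W * (2 * \<eta> * T / (2 ^ i * M)) \<and>
         \<bar>of_int \<lfloor>x3 * sqrt T\<rfloor> - sqrt T * (l3 / l4) powr (1 / (\<tau> - 1))\<bar> \<le> W * (2 * \<eta> * T / (2 ^ i * M))"
proof -
  obtain \<omega> B C where \<omega>: "\<omega> > 0" and B: "B \<ge> 1" and C: "C > 0" and dual:
    "\<And>\<epsilon> x1 x2 x3 z1 z2 z3 z4. \<lbrakk>0 \<le> \<epsilon>; \<epsilon> \<le> \<omega>;
       x1 \<in> {1/A..A}; x2 \<in> {1/A..A}; x3 \<in> {1/A..A};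
       \<bar>x1 powr \<tau> - x2 powr \<tau> - x3 powr \<tau> + 1\<bar> \<le> A powr (2 * (\<tau> - 1)) * \<epsilon>\<^sup>2;
       z1 = x1 powr (\<tau> - 1); \<bar>z2 - x2 powr (\<tau> - 1)\<bar> \<le> \<epsilon>; \<bar>z3 - x3 powr (\<tau> - 1)\<bar> \<le> \<epsilon>;
       \<bar>z1 * x1 - z2 * x2 - z3 * x3 + z4\<bar> \<le> A powr (2 * (\<tau> - 1)) * \<epsilon>\<^sup>2\<rbrakk> \<Longrightarrow>
       z1 \<in> {1/B..B} \<and> z2 \<in> {1/B..B} \<and> z3 \<in> {1/B..B} \<and> z4 \<in> {1/B..B} \<and>
       \<bar>z1 powr p - z2 powr p - z3 powr p + z4 powr p\<bar> \<le> C * \<epsilon>\<^sup>2 \<and>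
       \<bar>x2 - (z2 / z4) powr (1 / (\<tau> - 1))\<bar> \<le> C * \<epsilon> \<and>
       \<bar>x3 - (z3 / z4) powr (1 / (\<tau> - 1))\<bar> \<le> C * \<epsilon>"
    using dual_point_bound[OF \<tau> A] unfolding p_def by metis
  define q where "q = \<tau> - 1"
  have q: "q > 0" using \<tau> by (simp add: q_def)
  have p: "p > 0" using \<tau> by (simp add: p_def)
  define Aq where "Aq = A powr q"
  have Aq: "Aq \<ge> 1" using A q by (simp add: Aq_def ge_one_powr_ge_zero)
  have Aq2: "A powr (2 * (\<tau> - 1)) = Aq\<^sup>2"
    using A by (simp add: Aq_def power2_eq_square powr_add[symmetric] q_def)
  \<comment> \<open>The bound \<open>1/4\<close> forces \<open>k1 \<noteq> 0\<close> below, the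
    bound \<open>\<omega> / (2 * Aq)\<close> gives \<open>\<epsilon> \<le> \<omega>\<close>, and
    \<open>\<eta>0\<close> is prescribed by the count in a cap.\<close>
  define \<eta> where "\<eta> = min \<eta>0 (min (1/4) (\<omega> / (2 * Aq)))"
  have \<eta>: "0 < \<eta>" "\<eta> \<le> \<eta>0" "\<eta> \<le> 1/4" "2 * \<eta> * Aq \<le> \<omega>"
  proof -
    show "0 < \<eta>" "\<eta> \<le> \<eta>0" "\<eta> \<le> 1/4" using \<omega> Aq \<eta>0 by (auto simp: \<eta>_def)
    have "\<eta> \<le> \<omega> / (2 * Aq)" by (simp add: \<eta>_def)
    then show "2 * \<eta> * Aq \<le> \<omega>" using Aq by (simp add: field_simps)
  qed
  define D where "D = Aq * B"
  have D: "D \<ge> 1" using Aq B by (simp add: D_def mult_ge1_I)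
  define A' where "A' = 2 * D\<^sup>2"
  have A': "A' \<ge> 1" using one_le_power[OF D, of 2] by (simp add: A'_def)
  define E where "E = C * (2 * Aq) powr p * (4 * \<eta>\<^sup>2) * Aq\<^sup>2"
  have E: "E > 0" using C Aq \<eta> by (simp add: E_def)
  \<comment> \<open>With this value the error \<open>E * j powr p * T / (j * M)\<^sup>2\<close>
    becomes exactly the tolerance of the dual \<open>near_sols\<close>.\<close>
  define c where "c = 1 / (D powr p * E)"
  have c: "c > 0" using D E by (simp add: c_def)
  define W where "W = 1 + C * Aq"
  have W: "W \<ge> 1" using C Aq by (simp add: W_def)
  show ?thesis
  \<comment> \<open>\<open>D\<close> instantiates the \<open>B\<close> of the conclusion: besides
    the range of the normals it absorbs the factor between \<open>s\<close> and the dyadic size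
    \<open>j\<close>.\<close>
  proof (rule that[OF \<eta>(1,2,3) A' D c W])
    fix M T x1 x2 x3 :: real and k :: int4
    assume M: "M \<ge> 1" and T: "T \<ge> 1" "T \<le> M\<^sup>2"
      and x: "x1 \<in> {1/A..A}" "x2 \<in> {1/A..A}" "x3 \<in> {1/A..A}"
      and hx: "\<bar>x1 powr \<tau> - x2 powr \<tau> - x3 powr \<tau> + 1\<bar> \<le> 1/T"
      and kbox: "k \<in> dual_box (\<tau> - 1) x1 x2 x3 (2 * \<eta> * T / M) (2 * \<eta> * sqrt T / M) (2 * \<eta> / (A * M))"
      and knz: "k \<noteq> (0, 0, 0, 0)"
    obtain k1 k2 k3 k4 where kk: "k = (k1, k2, k3, k4)" by (cases k) auto
    have k: "\<bar>real_of_int k1\<bar> \<le> 2 * \<eta> * T / M"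
      "\<bar>k2 + k1 * (x2 powr q / x1 powr q)\<bar> \<le> 2 * \<eta> * sqrt T / M"
      "\<bar>k3 + k1 * (x3 powr q / x1 powr q)\<bar> \<le> 2 * \<eta> * sqrt T / M"
      "\<bar>k1 * x1 + k2 * x2 + k3 * x3 + k4\<bar> \<le> 2 * \<eta> / (A * M)"
      using kbox by (auto simp: kk dual_box_def q_def)
    have sqT: "sqrt T \<le> M" "sqrt T > 0" "sqrt T * sqrt T = T" using M T by (auto intro: real_le_lsqrt)
    have sqTM: "sqrt T / M \<le> 1" using sqT M by simp
    \<comment> \<open>If \<open>k1 = 0\<close>, the shears vanish and, since
      \<open>sqrt T \<le> M\<close>, the other sides are shorter than \<open>1\<close>; the
      remaining coordinates then vanish one after the other.\<close>
    have k1: "k1 \<noteq> 0"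
    proof
      assume k10: "k1 = 0"
      have "2 * \<eta> * sqrt T / M \<le> 2 * \<eta>" using sqTM \<eta> mult_left_mono[OF sqTM, of "2 * \<eta>"] by simp
      then have lt: "2 * \<eta> * sqrt T / M < 1" using \<eta>(3) by linarith
      have k23: "k2 = 0" "k3 = 0" using k(2,3) k10 lt by auto
      have "A * M \<ge> 1" using A M by (simp add: mult_ge1_I)
      then have "2 * \<eta> / (A * M) < 1" using \<eta> A M by (simp add: divide_less_eq)
      then have "k4 = 0" using k(4) k10 k23 by auto
      then show False using knz k10 k23 kk by simp
    qed
    define \<sigma> :: int where "\<sigma> = sgn k1"
    have \<sigma>: "\<sigma> \<in> {1, -1}" "\<sigma> * \<sigma> = 1" "real_of_int \<sigma> * real_of_int \<sigma> = 1" "\<bar>real_of_int \<sigma>\<bar> = 1"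
      using k1 by (auto simp: \<sigma>_def sgn_if)
    define l1 l2 l3 l4 where "l1 = \<sigma> * k1" "l2 = - \<sigma> * k2" "l3 = - \<sigma> * k3" "l4 = \<sigma> * k4"
    note l_def = l1_l2_l3_l4_def
    have kl: "k = (\<sigma> * l1, - \<sigma> * l2, - \<sigma> * l3, \<sigma> * l4)"
      using \<sigma>(2) unfolding l_def kk by (simp add: mult.assoc[symmetric])
    have l1abs: "real_of_int l1 = \<bar>real_of_int k1\<bar>" using k1 by (simp add: l_def \<sigma>_def sgn_if)
    have l1: "l1 \<ge> 1" using k1 l1abs by linarith
    define \<theta>1 where "\<theta>1 = x1 powr q"
    have x1: "x1 > 0" using x(1) A by (auto intro: less_le_trans[of 0 "1/A"])
    have \<theta>1: "\<theta>1 \<le> Aq" "1 \<le> \<theta>1 * Aq" "\<theta>1 > 0"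
    proof -
      show "\<theta>1 \<le> Aq" unfolding \<theta>1_def Aq_def using x(1) x1 q by (intro powr_mono2) auto
      have "1 \<le> (x1 * A) powr q" using x(1) x1 A q by (intro ge_one_powr_ge_zero) (auto simp: field_simps)
      then show "1 \<le> \<theta>1 * Aq" using x1 A by (simp add: \<theta>1_def Aq_def powr_mult)
      show "\<theta>1 > 0" using x1 by (simp add: \<theta>1_def)
    qed
    \<comment> \<open>This scale makes the first normalised coordinate exactly
      \<open>x1 powr q\<close>, as the comparison with the normal at \<open>x\<close>
      presupposes.\<close>
    define s where "s = l1 / \<theta>1"
    have s0: "s > 0" using l1 \<theta>1 by (simp add: s_def)
    have sl: "l1 \<le> s * Aq" "s \<le> l1 * Aq"
    proof -
      have "l1 * \<theta>1 \<le> l1 * Aq" using \<theta>1(1) l1 by (intro mult_left_mono) auto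
      then show "l1 \<le> s * Aq" using \<theta>1 by (simp add: s_def field_simps)
      have "real_of_int l1 * 1 \<le> l1 * (\<theta>1 * Aq)" using \<theta>1(2) l1 by (intro mult_left_mono) auto
      then show "s \<le> l1 * Aq" using \<theta>1 by (simp add: s_def field_simps)
    qed
    have sM: "s * M \<le> 2 * \<eta> * T * Aq"
    proof -
      have "l1 * M \<le> 2 * \<eta> * T" using k(1) M unfolding l1abs by (simp add: field_simps)
      then have "l1 * M * Aq \<le> 2 * \<eta> * T * Aq" using Aq by (intro mult_right_mono) auto
      moreover have "s * M \<le> l1 * Aq * M" using sl(2) M by (intro mult_right_mono) auto
      ultimately show ?thesis by (simp add: mult_ac)
    qed
    define \<epsilon> where "\<epsilon> = 2 * \<eta> * (sqrt T / M) / s"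
    have \<epsilon>0: "\<epsilon> \<ge> 0" using \<eta> sqT M s0 by (simp add: \<epsilon>_def)
    have \<epsilon>\<omega>: "\<epsilon> \<le> \<omega>"
    proof -
      have "1 / s \<le> Aq" using sl(1) l1 s0 by (simp add: divide_le_eq mult.commute)
      then have "2 * \<eta> * (sqrt T / M) * (1 / s) \<le> 2 * \<eta> * 1 * Aq"
        using sqTM \<eta> Aq s0 M sqT by (intro mult_mono) auto
      then show ?thesis using \<eta>(4) by (simp add: \<epsilon>_def)
    qed
    have \<epsilon>2: "\<epsilon>\<^sup>2 = 4 * \<eta>\<^sup>2 * T / (M\<^sup>2 * s\<^sup>2)"
      using T by (simp add: \<epsilon>_def power_divide power_mult_distrib)
    \<comment> \<open>This is the condition \<open>\<bar>k1\<bar> \<le> 2 * \<eta> * T / M\<close>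
      in disguise: because the size is bounded, both the defect \<open>1/T\<close> of the base point
      and, in the next step, the defect of orthogonality are
      \<open>O(\<epsilon>\<^sup>2)\<close>.\<close>
    have Teps: "1 / T \<le> Aq\<^sup>2 * \<epsilon>\<^sup>2"
    proof -
      have "(s * M)\<^sup>2 \<le> (2 * \<eta> * T * Aq)\<^sup>2" using sM s0 M by (intro power_mono) auto
      then show ?thesis unfolding \<epsilon>2 using s0 M T by (simp add: field_simps power2_eq_square)
    qed
    have keps: "2 * \<eta> / (A * M) / s \<le> Aq\<^sup>2 * \<epsilon>\<^sup>2"
    proof -
      have "s * M * 1 \<le> (2 * \<eta> * T * Aq) * (A * Aq)"
      proof (rule mult_mono[OF sM])
        show "1 \<le> A * Aq" using A Aq by (simp add: mult_ge1_I)
      qed (use \<eta> T Aq in auto)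
      then have "\<eta> * (s * M * 1) \<le> \<eta> * ((2 * \<eta> * T * Aq) * (A * Aq))"
        using \<eta> by (intro mult_left_mono) auto
      then show ?thesis unfolding \<epsilon>2 using s0 M T A by (simp add: field_simps power2_eq_square)
    qed
    define z1 z2 z3 z4 where "z1 = l1 / s" "z2 = l2 / s" "z3 = l3 / s" "z4 = l4 / s"
    note z_def = z1_z2_z3_z4_def
    have z1: "z1 = x1 powr (\<tau> - 1)"
      using l1 \<theta>1 by (simp add: z_def s_def \<theta>1_def q_def)
    have zz: "\<bar>- real_of_int \<sigma> * y / s - x powr q\<bar> \<le> \<epsilon>" if "\<bar>y + k1 * (x powr q / x1 powr q)\<bar> \<le> 2 * \<eta> * sqrt T / M" for x y
    proof -
      have "- real_of_int \<sigma> * y / s - x powr q = - real_of_int \<sigma> * (y + k1 * (x powr q / x1 powr q)) / s"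
      proof -
        have "real_of_int \<sigma> * k1 / s = \<theta>1" using k1 \<sigma>(1) \<theta>1 by (auto simp: s_def l_def)
        moreover have "real_of_int \<sigma> * k1 * (x powr q / x1 powr q) / s
            = (real_of_int \<sigma> * k1 / s) * (x powr q / x1 powr q)" by simp
        ultimately have "real_of_int \<sigma> * k1 * (x powr q / x1 powr q) / s = x powr q"
          using x1 unfolding \<theta>1_def by simp
        moreover have "- real_of_int \<sigma> * (y + X) / s = - real_of_int \<sigma> * y / s - real_of_int \<sigma> * X / s" for X
          by (simp add: algebra_simps diff_divide_distrib)
        ultimately show ?thesis unfolding mult.assoc by simp
      qed
      also have "\<bar>\<dots>\<bar> = \<bar>y + k1 * (x powr q / x1 powr q)\<bar> / s"
        using \<sigma>(4) s0 by (simp add: abs_mult)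
      also have "\<dots> \<le> (2 * \<eta> * sqrt T / M) / s" using that s0 by (intro divide_right_mono) auto
      finally show ?thesis by (simp add: \<epsilon>_def)
    qed
    have z2: "\<bar>z2 - x2 powr (\<tau> - 1)\<bar> \<le> \<epsilon>" using zz[OF k(2)] by (simp add: z_def l_def q_def)
    have z3: "\<bar>z3 - x3 powr (\<tau> - 1)\<bar> \<le> \<epsilon>" using zz[OF k(3)] by (simp add: z_def l_def q_def)
    have hz: "\<bar>z1 * x1 - z2 * x2 - z3 * x3 + z4\<bar> \<le> A powr (2 * (\<tau> - 1)) * \<epsilon>\<^sup>2"
    proof -
      have "z1 * x1 - z2 * x2 - z3 * x3 + z4 = \<sigma> * (k1 * x1 + k2 * x2 + k3 * x3 + k4) / s"
        by (simp add: z_def l_def algebra_simps add_divide_distrib)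
      also have "\<bar>\<dots>\<bar> = \<bar>k1 * x1 + k2 * x2 + k3 * x3 + k4\<bar> / s"
        using \<sigma>(4) s0 by (simp add: abs_mult)
      also have "\<dots> \<le> 2 * \<eta> / (A * M) / s" using k(4) s0 by (intro divide_right_mono) auto
      also note keps
      finally show ?thesis unfolding Aq2 .
    qed
    have hx': "\<bar>x1 powr \<tau> - x2 powr \<tau> - x3 powr \<tau> + 1\<bar> \<le> A powr (2 * (\<tau> - 1)) * \<epsilon>\<^sup>2"
      using hx Teps unfolding Aq2 by linarith
    note res = dual[OF \<epsilon>0 \<epsilon>\<omega> x hx' z1 z2 z3 hz]
    have "1 \<le> nat l1" using l1 by simp
    then obtain i where i: "2 ^ i \<le> nat l1" "nat l1 < 2 ^ (i + 1)" using ex_power_ivl1[of 2 "nat l1"] by auto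
    define j :: real where "j = 2 ^ i"
    have j: "j \<le> l1" "l1 < 2 * j" "j \<ge> 1"
    proof -
      have "real (2 ^ i) \<le> real (nat l1)" "real (nat l1) < real (2 ^ (i + 1))" using i by (simp_all only: of_nat_le_iff of_nat_less_iff)
      then show "j \<le> l1" "l1 < 2 * j" using l1 by (auto simp: j_def)
      show "j \<ge> 1" by (simp add: j_def)
    qed
    have jT: "j \<le> 2 * \<eta> * T / M" using j(1) k(1) l1abs by linarith
    have sj: "j \<le> s * Aq" "s \<le> 2 * j * Aq"
    proof -
      show "j \<le> s * Aq" using j sl by linarith
      have "real_of_int l1 * Aq \<le> 2 * j * Aq" using j Aq by (intro mult_right_mono) auto
      then show "s \<le> 2 * j * Aq" using sl by linarith
    qed
    have rng: "real_of_int l \<in> {j / D..A' * (j / D)}" if "l / s \<in> {1/B..B}" for l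
    proof -
      have "s \<le> l * B" "l \<le> B * s" using that s0 B by (auto simp: field_simps)
      then have "s * Aq \<le> l * B * Aq" "l \<le> B * (2 * j * Aq)"
        using Aq sj(2) B by (auto intro: mult_right_mono order_trans[OF _ mult_left_mono])
      then have "j \<le> l * D" "l \<le> 2 * D * j" using sj by (auto simp: D_def mult_ac)
      then show ?thesis using D by (auto simp: A'_def power2_eq_square field_simps)
    qed
    have sum: "\<bar>l1 powr p - l2 powr p - l3 powr p + l4 powr p\<bar> \<le> (j / D) powr p / (c * (j * M)\<^sup>2 / T)"
    proof -
      have pw: "l powr p = s powr p * (l / s) powr p" if "l / s \<in> {1/B..B}" for l
      proof -
        have "l / s \<ge> 0" using that B by (auto intro: order_trans[of 0 "1/B"])
        then show ?thesis using s0 by (simp add: powr_mult[symmetric])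
      qed
      have "l1 powr p - l2 powr p - l3 powr p + l4 powr p =
          s powr p * (z1 powr p - z2 powr p - z3 powr p + z4 powr p)"
        using res pw[of l1] pw[of l2] pw[of l3] pw[of l4] unfolding z_def by (simp add: algebra_simps)
      also have "\<bar>\<dots>\<bar> \<le> s powr p * (C * \<epsilon>\<^sup>2)"
        unfolding abs_mult using res by (intro mult_mono) auto
      also have "\<dots> = s powr p * (C * (4 * \<eta>\<^sup>2) * (T / M\<^sup>2)) * (1 / s)\<^sup>2"
        by (simp add: \<epsilon>2 power_divide)
      also have "\<dots> \<le> (2 * j * Aq) powr p * (C * (4 * \<eta>\<^sup>2) * (T / M\<^sup>2)) * (Aq / j)\<^sup>2"
      proof (intro mult_mono power_mono)
        show "s powr p \<le> (2 * j * Aq) powr p" using sj s0 p by (intro powr_mono2) auto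
        show "1 / s \<le> Aq / j" using sj s0 j by (simp add: field_simps)
      qed (use C \<eta> T M s0 in auto)
      also have "(2 * j * Aq) powr p = (2 * Aq) powr p * j powr p"
        using Aq j by (simp add: powr_mult[symmetric] mult_ac)
      also have "(2 * Aq) powr p * j powr p * (C * (4 * \<eta>\<^sup>2) * (T / M\<^sup>2)) * (Aq / j)\<^sup>2 =
          E * j powr p * T / (j * M)\<^sup>2"
        by (simp add: E_def power_divide power_mult_distrib mult_ac)
      also have "\<dots> = (j / D) powr p / (c * (j * M)\<^sup>2 / T)"
        using D j E by (simp add: c_def powr_divide)
      finally show ?thesis .
    qed
    have near: "(l1, l2, l3, l4) \<in> near_sols p A' (j / D) (c * (j * M)\<^sup>2 / T)"
      using sum rng[of l1] rng[of l2] rng[of l3] rng[of l4] res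
      unfolding near_sols_def z_def by blast
    have cell: "\<bar>of_int \<lfloor>x * sqrt T\<rfloor> - sqrt T * y\<bar> \<le> W * (2 * \<eta> * T / (j * M))"
      if "\<bar>x - y\<bar> \<le> C * \<epsilon>" for x y
    proof -
      have "\<bar>x * sqrt T - sqrt T * y\<bar> = \<bar>x - y\<bar> * sqrt T"
        using sqT(2) by (simp add: left_diff_distrib[symmetric] abs_mult mult.commute)
      also have "\<dots> \<le> C * \<epsilon> * sqrt T" using that sqT by (intro mult_right_mono) auto
      also have "\<dots> = C * (2 * \<eta> * T / M) * (1 / s)"
        using sqT(3) by (simp add: \<epsilon>_def mult_ac)
      also have "\<dots> \<le> C * (2 * \<eta> * T / M) * (Aq / j)"
        using sj s0 j C \<eta> T M by (intro mult_left_mono) (auto simp: field_simps)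
      finally have 1: "\<bar>x * sqrt T - sqrt T * y\<bar> \<le> C * Aq * (2 * \<eta> * T / (j * M))" by (simp add: mult_ac)
      \<comment> \<open>The rounding error of the cell index is at most \<open>1\<close> and is
        absorbed here, because \<open>j\<close> stays below
        \<open>2 * \<eta> * T / M\<close>.\<close>
      have 2: "1 \<le> 2 * \<eta> * T / (j * M)" using jT j M by (simp add: field_simps)
      have "\<bar>of_int \<lfloor>x * sqrt T\<rfloor> - x * sqrt T\<bar> \<le> 1" by linarith
      then show ?thesis using 1 2 unfolding W_def distrib_right by linarith
    qed
    have "z2 / z4 = l2 / l4" "z3 / z4 = l3 / l4" using s0 by (auto simp: z_def)
    then have "\<bar>x2 - (l2 / l4) powr (1 / (\<tau> - 1))\<bar> \<le> C * \<epsilon>" "\<bar>x3 - (l3 / l4) powr (1 / (\<tau> - 1))\<bar> \<le> C * \<epsilon>"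
      using res by auto
    note cc = this[THEN cell]
    show "\<exists>\<sigma>\<in>{1, -1}. \<exists>i::nat. \<exists>l1 l2 l3 l4. k = (\<sigma> * l1, - \<sigma> * l2, - \<sigma> * l3, \<sigma> * l4) \<and>
         2 ^ i \<le> 2 * \<eta> * T / M \<and>
         (l1, l2, l3, l4) \<in> near_sols p A' (2 ^ i / D) (c * (2 ^ i * M)\<^sup>2 / T) \<and>
         \<bar>of_int \<lfloor>x2 * sqrt T\<rfloor> - sqrt T * (l2 / l4) powr (1 / (\<tau> - 1))\<bar> \<le> W * (2 * \<eta> * T / (2 ^ i * M)) \<and>
         \<bar>of_int \<lfloor>x3 * sqrt T\<rfloor> - sqrt T * (l3 / l4) powr (1 / (\<tau> - 1))\<bar> \<le> W * (2 * \<eta> * T / (2 ^ i * M))"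
      using \<sigma>(1) kl jT near cc unfolding j_def by blast
  qed
qed

section \<open>Summation over the caps\<close>

lemma card_int_interval_centre:
  fixes y w :: real
  assumes "w \<ge> 0"
  shows "finite {k::int. \<bar>k - y\<bar> \<le> w}" "real (card {k::int. \<bar>k - y\<bar> \<le> w}) \<le> 2 * w + 1"
  using card_int_interval_le[OF assms, of "- y"] by simp_all

text \<open>Pairs of a cap and an integer point of its polar box are counted twice. Summed by caps
  they bound the number of solutions. Summed by points, \<open>0\<close> contributes the
  \<open>O(T)\<close> caps, while each of the \<open>O((2 ^ i) powr \<beta>)\<close> points of size
  about \<open>2 ^ i\<close> meets \<open>O((T / (2 ^ i * M))\<^sup>2)\<close> caps. Multiplication
  by \<open>M^4 / T\<^sup>2\<close> gives the two terms.\<close>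

lemma card_near_sols_le_dual:
  fixes \<tau> A \<beta> :: real
  assumes \<tau>: "\<tau> > 1" and A: "A \<ge> 1" and \<beta>: "\<beta> \<ge> 2"
    and IH: "\<And>A'. A' \<ge> 1 \<Longrightarrow> \<exists>C. \<forall>M>0. \<forall>T>0.
      real (card (near_sols (\<tau> / (\<tau> - 1)) A' M T)) \<le> C * (M ^ 4 / T + M powr \<beta>)"
  obtains C where "C > 0" "\<And>M T. \<lbrakk>M \<ge> 1; T \<ge> 1; T \<le> M\<^sup>2\<rbrakk> \<Longrightarrow>
      real (card (near_sols \<tau> A M T)) \<le>
        C * (M ^ 4 / T + M\<^sup>2 * (\<Sum>i\<in>{i::nat. 2 ^ i \<le> T / M}. (2 ^ i) powr (\<beta> - 2)))"
proof -
  define p where "p = \<tau> / (\<tau> - 1)"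
  define q where "q = \<tau> - 1"
  obtain \<eta>0 where \<eta>0: "\<eta>0 > 0" and cell:
    "\<And>\<eta> M T a0 b0 c0 d0 S. \<lbrakk>0 < \<eta>; \<eta> \<le> \<eta>0; M > 0; T \<ge> 1;
       (a0, b0, c0, d0) \<in> near_sols \<tau> A M T; S \<subseteq> near_sols \<tau> A M T;
       \<And>a b c d. (a, b, c, d) \<in> S \<Longrightarrow>
         \<bar>b / d - b0 / d0\<bar> \<le> 1 / sqrt T \<and> \<bar>c / d - c0 / d0\<bar> \<le> 1 / sqrt T\<rbrakk> \<Longrightarrow>
       real (card S) \<le> 2 * A / \<eta> ^ 4 * (M ^ 4 / T\<^sup>2) *
         real (card (dual_box q (a0 / d0) (b0 / d0) (c0 / d0)
           (2 * \<eta> * T / M) (2 * \<eta> * sqrt T / M) (2 * \<eta> / (A * M))))"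
    using cell_card_le[OF \<tau> A] unfolding q_def by metis
  obtain \<eta> A' B c W where \<eta>: "0 < \<eta>" "\<eta> \<le> \<eta>0" "\<eta> \<le> 1/4" and A': "A' \<ge> 1" and B: "B \<ge> 1"
    and c: "c > 0" and W: "W \<ge> 1" and dual:
    "\<And>M T x1 x2 x3 k. \<lbrakk>M \<ge> 1; T \<ge> 1; T \<le> M\<^sup>2;
       x1 \<in> {1/A..A}; x2 \<in> {1/A..A}; x3 \<in> {1/A..A};
       \<bar>x1 powr \<tau> - x2 powr \<tau> - x3 powr \<tau> + 1\<bar> \<le> 1/T;
       k \<in> dual_box q x1 x2 x3 (2 * \<eta> * T / M) (2 * \<eta> * sqrt T / M) (2 * \<eta> / (A * M));
       k \<noteq> (0, 0, 0, 0)\<rbrakk> \<Longrightarrow>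
       \<exists>\<sigma>\<in>{1, -1}. \<exists>i::nat. \<exists>l1 l2 l3 l4. k = (\<sigma> * l1, - \<sigma> * l2, - \<sigma> * l3, \<sigma> * l4) \<and>
         2 ^ i \<le> 2 * \<eta> * T / M \<and>
         (l1, l2, l3, l4) \<in> near_sols p A' (2 ^ i / B) (c * (2 ^ i * M)\<^sup>2 / T) \<and>
         \<bar>of_int \<lfloor>x2 * sqrt T\<rfloor> - sqrt T * (l2 / l4) powr (1 / q)\<bar> \<le> W * (2 * \<eta> * T / (2 ^ i * M)) \<and>
         \<bar>of_int \<lfloor>x3 * sqrt T\<rfloor> - sqrt T * (l3 / l4) powr (1 / q)\<bar> \<le> W * (2 * \<eta> * T / (2 ^ i * M))"
    using dual_box_near_sols[OF \<tau> A \<eta>0] unfolding q_def p_def by metis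
  obtain C0 where "\<forall>M>0. \<forall>T>0. real (card (near_sols p A' M T)) \<le> C0 * (M ^ 4 / T + M powr \<beta>)"
    using IH[OF A'] unfolding p_def by metis
  then have C0: "real (card (near_sols p A' M T)) \<le> \<bar>C0\<bar> * (M ^ 4 / T + M powr \<beta>)" if "M > 0" "T > 0" for M T
    using that by (smt (verit, best) divide_nonneg_pos mult_right_mono powr_ge_zero zero_le_even_power even_numeral zero_less_power)
  define K where "K = 2 * A / \<eta> ^ 4"
  have K: "K > 0" using A \<eta> by (simp add: K_def)
  define G where "G = \<bar>C0\<bar> * (1 / c + 1)"
  have G: "G \<ge> 0" using c by (simp add: G_def)
  define L where "L = 2 * (9 * W\<^sup>2) * G"
  have L: "L \<ge> 0" using G by (simp add: L_def)
  define C where "C = K * (4 * A\<^sup>2 + L)"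
  have C: "C > 0" using K A L by (simp add: C_def add_pos_nonneg)
  show ?thesis
  proof (rule that[OF C])
    fix M T :: real assume M: "M \<ge> 1" and T: "T \<ge> 1" "T \<le> M\<^sup>2"
    have M0: "M > 0" and T0: "T > 0" using M T by auto
    define Sol where "Sol = near_sols \<tau> A M T"
    have finSol: "finite Sol" using finite_near_sols M0 by (simp add: Sol_def)
    \<comment> \<open>Two of the three ratios suffice as cell index, since the equation nearly
      determines \<open>a / d\<close>.\<close>
    define cel where "cel = (\<lambda>(a::int, b::int, c::int, d::int). (\<lfloor>b / d * sqrt T\<rfloor>, \<lfloor>c / d * sqrt T\<rfloor>))"
    define Cells where "Cells = cel ` Sol"
    \<comment> \<open>The polar box has to be centred at an actual near solution, since the base
      direction must satisfy the cone equation up to \<open>1/T\<close>; a corner of the cell need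
      not.\<close>
    define rep where "rep e = (SOME m. m \<in> Sol \<and> cel m = e)" for e
    have rep: "rep e \<in> Sol" "cel (rep e) = e" if "e \<in> Cells" for e
    proof -
      have "\<exists>m. m \<in> Sol \<and> cel m = e" using that by (auto simp: Cells_def)
      then show "rep e \<in> Sol" "cel (rep e) = e" unfolding rep_def by (metis (mono_tags, lifting) someI_ex)+
    qed
    define N where "N e = (case rep e of (a, b, c, d) \<Rightarrow>
       dual_box q (a / d) (b / d) (c / d) (2 * \<eta> * T / M) (2 * \<eta> * sqrt T / M) (2 * \<eta> / (A * M)))" for e
    have finN: "finite (N e)" for e unfolding N_def by (simp add: finite_dual_box split: prod.split)
    have finCells: "finite Cells" using finSol by (simp add: Cells_def)
    have cells_le: "real (card {m\<in>Sol. cel m = e}) \<le> K * (M ^ 4 / T\<^sup>2) * real (card (N e))" if e: "e \<in> Cells" for e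
    proof -
      obtain a0 b0 c0 d0 where r: "rep e = (a0, b0, c0, d0)" by (cases "rep e") auto
      have r1: "(a0, b0, c0, d0) \<in> near_sols \<tau> A M T" "cel (a0, b0, c0, d0) = e"
        using rep[OF e] r by (auto simp: Sol_def)
      have fl: "\<bar>x - y\<bar> \<le> 1 / sqrt T" if "\<lfloor>x * sqrt T\<rfloor> = \<lfloor>y * sqrt T\<rfloor>" for x y
      proof -
        have "\<bar>x * sqrt T - y * sqrt T\<bar> \<le> 1" using that by linarith
        then have "\<bar>x - y\<bar> * sqrt T \<le> 1" using T0 by (simp add: left_diff_distrib[symmetric] abs_mult)
        then show ?thesis using T0 by (simp add: field_simps)
      qed
      show ?thesis
        unfolding N_def r K_def prod.case
      proof (rule cell[OF \<eta>(1,2) M0 T(1) r1(1)])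
        show "{m \<in> Sol. cel m = e} \<subseteq> near_sols \<tau> A M T" by (auto simp: Sol_def)
        fix a b c d assume "(a, b, c, d) \<in> {m \<in> Sol. cel m = e}"
        then have "cel (a, b, c, d) = cel (a0, b0, c0, d0)" using r1 by auto
        then show "\<bar>b / d - b0 / d0\<bar> \<le> 1 / sqrt T \<and> \<bar>c / d - c0 / d0\<bar> \<le> 1 / sqrt T"
          by (auto simp: cel_def intro!: fl)
      qed
    qed
    have "real (card Sol) = (\<Sum>e\<in>Cells. real (card {m\<in>Sol. cel m = e}))"
    proof -
      have "(\<Sum>m\<in>Sol. 1::real) = (\<Sum>e\<in>Cells. \<Sum>m\<in>{m\<in>Sol. cel m = e}. 1)"
        using finSol finCells by (intro sum.group[symmetric]) (auto simp: Cells_def)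
      then show ?thesis by simp
    qed
    also have "\<dots> \<le> (\<Sum>e\<in>Cells. K * (M ^ 4 / T\<^sup>2) * real (card (N e)))"
      by (intro sum_mono cells_le)
    also have "\<dots> = K * (M ^ 4 / T\<^sup>2) * real (card (Sigma Cells N))"
      using finCells finN by (simp add: card_SigmaI sum_distrib_left)
    finally have main: "real (card Sol) \<le> K * (M ^ 4 / T\<^sup>2) * real (card (Sigma Cells N))" .
    define I where "I = {i::nat. 2 ^ i \<le> T / M}"
    have finI: "finite I"
    proof -
      obtain n :: nat where n: "T / M < 2 ^ n" using real_arch_pow[of 2 "T / M"] by auto
      have "I \<subseteq> {..<n}"
      proof
        fix i assume "i \<in> I"
        then have "(2::real) ^ i < 2 ^ n" using n unfolding I_def mem_Collect_eq by linarith
        then show "i \<in> {..<n}" by simp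
      qed
      then show ?thesis using finite_subset by blast
    qed
    define w where "w i = W * (2 * \<eta> * T / (2 ^ i * M))" for i :: nat
    define NS where "NS i = near_sols p A' (2 ^ i / B) (c * (2 ^ i * M)\<^sup>2 / T)" for i :: nat
    define Bx where "Bx i = (\<lambda>(l1::int, l2::int, l3::int, l4::int).
       {u::int. \<bar>u - sqrt T * (l2 / l4) powr (1/q)\<bar> \<le> w i} \<times> {u::int. \<bar>u - sqrt T * (l3 / l4) powr (1/q)\<bar> \<le> w i})" for i
    define tw where "tw \<sigma> = (\<lambda>((l1, l2, l3, l4), e). (e :: int \<times> int, (\<sigma> * l1, - \<sigma> * l2, - \<sigma> * l3, \<sigma> * l4)))" for \<sigma> :: int
    \<comment> \<open>The sharp range is kept until the final sum because it yields
      \<open>w i \<ge> 1\<close>, which absorbs the \<open>1\<close> in the count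
      \<open>2 * w i + 1\<close>.\<close>
    define J where "J = {i\<in>I. 2 ^ i \<le> 2 * \<eta> * T / M}"
    have finJ: "finite J" and JI: "J \<subseteq> I" using finI by (auto simp: J_def)
    have finNS: "finite (NS i)" for i
      unfolding NS_def using B by (intro finite_near_sols) auto
    have sub: "Sigma Cells N \<subseteq> Cells \<times> {(0, 0, 0, 0)} \<union> (\<Union>i\<in>J. \<Union>\<sigma>\<in>{1, -1}. tw \<sigma> ` Sigma (NS i) (Bx i))"
    proof
      fix ek assume ek: "ek \<in> Sigma Cells N"
      obtain e k where ek': "ek = (e, k)" by (cases ek)
      have e: "e \<in> Cells" and k: "k \<in> N e" using ek ek' by auto
      show "ek \<in> Cells \<times> {(0, 0, 0, 0)} \<union> (\<Union>i\<in>J. \<Union>\<sigma>\<in>{1, -1}. tw \<sigma> ` Sigma (NS i) (Bx i))"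
      proof (cases "k = (0, 0, 0, 0)")
        case True
        then show ?thesis using e ek' by auto
      next
        case False
        obtain a0 b0 c0 d0 where r: "rep e = (a0, b0, c0, d0)" by (cases "rep e") auto
        have r1: "(a0, b0, c0, d0) \<in> near_sols \<tau> A M T" using rep[OF e] r by (auto simp: Sol_def)
        have ee: "e = (\<lfloor>b0 / d0 * sqrt T\<rfloor>, \<lfloor>c0 / d0 * sqrt T\<rfloor>)" using rep(2)[OF e] r by (simp add: cel_def)
        have kb: "k \<in> dual_box q (a0 / d0) (b0 / d0) (c0 / d0) (2 * \<eta> * T / M) (2 * \<eta> * sqrt T / M) (2 * \<eta> / (A * M))"
          using k by (simp add: N_def r)
        have \<tau>0: "\<tau> \<ge> 0" using \<tau> by simp
        obtain \<sigma> i l1 l2 l3 l4 where *: "\<sigma> \<in> {1, -1}" "k = (\<sigma> * l1, - \<sigma> * l2, - \<sigma> * l3, \<sigma> * l4)"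
          "2 ^ i \<le> 2 * \<eta> * T / M" "(l1, l2, l3, l4) \<in> NS i"
          "\<bar>of_int \<lfloor>b0 / d0 * sqrt T\<rfloor> - sqrt T * (l2 / l4) powr (1 / q)\<bar> \<le> w i"
          "\<bar>of_int \<lfloor>c0 / d0 * sqrt T\<rfloor> - sqrt T * (l3 / l4) powr (1 / q)\<bar> \<le> w i"
          using dual[OF M T near_solsD(1-4)[OF r1 M0 T0 \<tau>0] kb False] unfolding NS_def w_def by blast
        have "2 * \<eta> * T / M \<le> T / M" using \<eta> T0 M0 by (intro divide_right_mono) auto
        then have "i \<in> J" using *(3) by (simp add: J_def I_def)
        moreover have "((l1, l2, l3, l4), e) \<in> Sigma (NS i) (Bx i)"
          using *(4-6) by (simp add: Bx_def ee)
        moreover have "ek = tw \<sigma> ((l1, l2, l3, l4), e)" using *(2) ek' by (simp add: tw_def)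
        ultimately show ?thesis using *(1) by blast
      qed
    qed
    have w1: "w i \<ge> 1" if "i \<in> J" for i
    proof -
      have "1 \<le> 2 * \<eta> * T / (2 ^ i * M)" using that M0 by (simp add: J_def field_simps)
      then show ?thesis unfolding w_def using W by (intro mult_ge1_I)
    qed
    have Bx: "finite (Bx i l)" "real (card (Bx i l)) \<le> 9 * (w i)\<^sup>2" if i: "i \<in> J" for i l
    proof -
      obtain l1 l2 l3 l4 where l: "l = (l1, l2, l3, l4)" by (cases l) auto
      have w0: "w i \<ge> 0" using w1[OF i] by simp
      note c1 = card_int_interval_centre[OF w0, of "sqrt T * (l2 / l4) powr (1/q)"]
      note c2 = card_int_interval_centre[OF w0, of "sqrt T * (l3 / l4) powr (1/q)"]
      show "finite (Bx i l)" unfolding l Bx_def prod.case using c1(1) c2(1) by (rule finite_cartesian_product)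
      have "real (card (Bx i l)) \<le> (2 * w i + 1) * (2 * w i + 1)"
        unfolding l Bx_def prod.case card_cartesian_product of_nat_mult
        using c1(2) c2(2) w0 by (intro mult_mono) auto
      also have "\<dots> \<le> (3 * w i) * (3 * w i)" using w1[OF i] by (intro mult_mono) auto
      finally show "real (card (Bx i l)) \<le> 9 * (w i)\<^sup>2" by (simp add: power2_eq_square)
    qed
    have NSle: "real (card (NS i)) \<le> G * (2 ^ i) powr \<beta>" for i
    proof -
      have j: "(2::real) ^ i \<ge> 1" by simp
      have "real (card (NS i)) \<le> \<bar>C0\<bar> * ((2 ^ i / B) ^ 4 / (c * (2 ^ i * M)\<^sup>2 / T) + (2 ^ i / B) powr \<beta>)"
        unfolding NS_def using B c M0 T0 by (intro C0) auto
      also have "\<dots> \<le> \<bar>C0\<bar> * ((1 / c + 1) * (2 ^ i) powr \<beta>)"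
      proof (intro mult_left_mono)
        \<comment> \<open>In the dual problem the main term never dominates: by
          \<open>T \<le> M\<^sup>2\<close> it is at most \<open>(2 ^ i)\<^sup>2 / c\<close>, and
          \<open>\<beta> \<ge> 2\<close>.\<close>
        have "(2 ^ i / B) ^ 4 / (c * (2 ^ i * M)\<^sup>2 / T) \<le> (2 ^ i) ^ 4 / (c * (2 ^ i * M)\<^sup>2 / T)"
          using B c M0 T0 by (intro divide_right_mono power_mono) (auto simp: field_simps)
        also have "\<dots> = (1 / c) * (2 ^ i)\<^sup>2 * (T / M\<^sup>2)"
          using M0 c T0 by (simp add: field_simps power2_eq_square power4_eq_xxxx)
        also have "\<dots> \<le> (1 / c) * (2 ^ i)\<^sup>2 * 1"
          using T M0 c by (intro mult_left_mono) auto
        also have "\<dots> \<le> (1 / c) * ((2::real) ^ i) powr \<beta>"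
        proof -
          have "(2 ^ i)\<^sup>2 \<le> ((2::real) ^ i) powr \<beta>" using powr_mono[OF \<beta> j] by (simp add: powr_numeral)
          then show ?thesis unfolding mult_1_right using c by (intro mult_left_mono) auto
        qed
        finally have 1: "(2 ^ i / B) ^ 4 / (c * (2 ^ i * M)\<^sup>2 / T) \<le> (1 / c) * (2 ^ i) powr \<beta>" .
        have "(2 ^ i / B) powr \<beta> \<le> (2 ^ i) powr \<beta>"
          using B \<beta> by (intro powr_mono2) (auto simp: field_simps)
        with 1 show "(2 ^ i / B) ^ 4 / (c * (2 ^ i * M)\<^sup>2 / T) + (2 ^ i / B) powr \<beta> \<le> (1 / c + 1) * (2 ^ i) powr \<beta>"
          by (simp add: distrib_right)
      qed auto
      finally show ?thesis unfolding G_def mult.assoc .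
    qed
    have fin2: "finite (tw \<sigma> ` Sigma (NS i) (Bx i))" if "i \<in> J" for \<sigma> i
      using finNS Bx(1)[OF that] by (intro finite_imageI finite_SigmaI) auto
    have img: "real (card (tw \<sigma> ` Sigma (NS i) (Bx i))) \<le> (L / 2) * (T\<^sup>2 / M\<^sup>2) * (2 ^ i) powr (\<beta> - 2)" if i: "i \<in> J" for \<sigma> i
    proof -
      have "card (tw \<sigma> ` Sigma (NS i) (Bx i)) \<le> card (Sigma (NS i) (Bx i))"
        using finNS Bx(1)[OF i] by (intro card_image_le finite_SigmaI) auto
      also have "\<dots> = (\<Sum>l\<in>NS i. card (Bx i l))" using finNS Bx(1)[OF i] by (simp add: card_SigmaI)
      finally have "real (card (tw \<sigma> ` Sigma (NS i) (Bx i))) \<le> (\<Sum>l\<in>NS i. real (card (Bx i l)))"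
        by (simp add: of_nat_mono flip: of_nat_sum)
      also have "\<dots> \<le> (\<Sum>l\<in>NS i. 9 * (w i)\<^sup>2)" using Bx(2)[OF i] by (intro sum_mono) auto
      also have "\<dots> = real (card (NS i)) * (9 * (w i)\<^sup>2)" by simp
      also have "\<dots> \<le> (G * (2 ^ i) powr \<beta>) * (9 * (W * (T / (2 ^ i * M)))\<^sup>2)"
      proof (rule mult_mono[OF NSle])
        have "2 * \<eta> * T / (2 ^ i * M) \<le> T / (2 ^ i * M)" using \<eta> T0 M0 by (intro divide_right_mono) auto
        then have "w i \<le> W * (T / (2 ^ i * M))" unfolding w_def using W by (intro mult_left_mono) auto
        then show "9 * (w i)\<^sup>2 \<le> 9 * (W * (T / (2 ^ i * M)))\<^sup>2"
          using w1[OF i] by (intro mult_left_mono power_mono) auto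
      qed (use G in auto)
      also have "\<dots> = (L / 2) * (T\<^sup>2 / M\<^sup>2) * ((2 ^ i) powr \<beta> / (2 ^ i)\<^sup>2)"
        by (simp add: L_def power_mult_distrib power_divide mult_ac)
      also have "(2 ^ i) powr \<beta> / (2 ^ i)\<^sup>2 = ((2::real) ^ i) powr (\<beta> - 2)"
        by (simp add: powr_diff powr_numeral)
      finally show ?thesis .
    qed
    have cardU: "real (card (\<Union>i\<in>J. \<Union>\<sigma>\<in>{1, -1}. tw \<sigma> ` Sigma (NS i) (Bx i))) \<le>
        L * (T\<^sup>2 / M\<^sup>2) * (\<Sum>i\<in>I. (2 ^ i) powr (\<beta> - 2))"
    proof -
      have "card (\<Union>i\<in>J. \<Union>\<sigma>\<in>{1, -1}. tw \<sigma> ` Sigma (NS i) (Bx i)) \<le>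
          (\<Sum>i\<in>J. card (\<Union>\<sigma>\<in>{1, -1}. tw \<sigma> ` Sigma (NS i) (Bx i)))"
        using finJ by (rule card_UN_le)
      also have "\<dots> \<le> (\<Sum>i\<in>J. \<Sum>\<sigma>\<in>{1, -1}. card (tw \<sigma> ` Sigma (NS i) (Bx i)))"
        by (intro sum_mono card_UN_le) auto
      finally have "real (card (\<Union>i\<in>J. \<Union>\<sigma>\<in>{1, -1}. tw \<sigma> ` Sigma (NS i) (Bx i))) \<le>
          (\<Sum>i\<in>J. \<Sum>\<sigma>\<in>{1, -1}. real (card (tw \<sigma> ` Sigma (NS i) (Bx i))))"
        unfolding of_nat_sum[symmetric] of_nat_le_iff .
      also have "\<dots> \<le> (\<Sum>i\<in>J. \<Sum>\<sigma>\<in>{1, -1::int}. (L / 2) * (T\<^sup>2 / M\<^sup>2) * (2 ^ i) powr (\<beta> - 2))"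
        by (intro sum_mono img)
      also have "\<dots> = (\<Sum>i\<in>J. L * (T\<^sup>2 / M\<^sup>2) * (2 ^ i) powr (\<beta> - 2))"
        by (intro sum.cong) auto
      also have "\<dots> \<le> (\<Sum>i\<in>I. L * (T\<^sup>2 / M\<^sup>2) * (2 ^ i) powr (\<beta> - 2))"
        using finI JI L by (intro sum_mono2) auto
      finally show ?thesis by (simp add: sum_distrib_left)
    qed
    have cardC: "real (card Cells) \<le> 4 * A\<^sup>2 * T"
    proof -
      have sT: "sqrt T \<ge> 1" using T by simp
      have "Cells \<subseteq> {0..\<lfloor>A * sqrt T\<rfloor>} \<times> {0..\<lfloor>A * sqrt T\<rfloor>}"
      proof
        fix e assume "e \<in> Cells"
        then obtain a b c d where m: "(a, b, c, d) \<in> near_sols \<tau> A M T" "e = cel (a, b, c, d)"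
          by (auto simp: Cells_def Sol_def)
        have \<tau>0: "\<tau> \<ge> 0" using \<tau> by simp
        have fl0: "0 \<le> \<lfloor>x * sqrt T\<rfloor> \<and> \<lfloor>x * sqrt T\<rfloor> \<le> \<lfloor>A * sqrt T\<rfloor>" if "x \<in> {1/A..A}" for x
        proof -
          have "0 \<le> x" using that A by (auto intro: order_trans[of 0 "1/A"])
          moreover have "x * sqrt T \<le> A * sqrt T" using that T0 by (intro mult_right_mono) auto
          ultimately show ?thesis using T0 by (auto intro: floor_mono)
        qed
        show "e \<in> {0..\<lfloor>A * sqrt T\<rfloor>} \<times> {0..\<lfloor>A * sqrt T\<rfloor>}"
          using fl0[OF near_solsD(2)[OF m(1) M0 T0 \<tau>0]] fl0[OF near_solsD(3)[OF m(1) M0 T0 \<tau>0]]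
          unfolding m(2) cel_def by simp
      qed
      then have "card Cells \<le> card ({0..\<lfloor>A * sqrt T\<rfloor>} \<times> {0..\<lfloor>A * sqrt T\<rfloor>})"
        by (intro card_mono) auto
      also have "\<dots> = nat (\<lfloor>A * sqrt T\<rfloor> + 1) * nat (\<lfloor>A * sqrt T\<rfloor> + 1)" by simp
      finally have "real (card Cells) \<le> real (nat (\<lfloor>A * sqrt T\<rfloor> + 1)) * real (nat (\<lfloor>A * sqrt T\<rfloor> + 1))"
        unfolding of_nat_mult[symmetric] of_nat_le_iff .
      also have "\<dots> \<le> (2 * (A * sqrt T)) * (2 * (A * sqrt T))"
      proof -
        have "A * sqrt T \<ge> 1" using A sT by (simp add: mult_ge1_I)
        then have "real (nat (\<lfloor>A * sqrt T\<rfloor> + 1)) \<le> 2 * (A * sqrt T)" by linarith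
        then show ?thesis by (intro mult_mono) auto
      qed
      also have "\<dots> = 4 * A\<^sup>2 * (sqrt T * sqrt T)" by (simp add: power2_eq_square)
      finally show ?thesis using T0 by simp
    qed
    have "card (Sigma Cells N) \<le> card (Cells \<times> {(0, 0, 0, 0)} \<union> (\<Union>i\<in>J. \<Union>\<sigma>\<in>{1, -1}. tw \<sigma> ` Sigma (NS i) (Bx i)))"
      using finCells finJ fin2 by (intro card_mono[OF _ sub]) auto
    also have "\<dots> \<le> card Cells + card (\<Union>i\<in>J. \<Union>\<sigma>\<in>{1, -1}. tw \<sigma> ` Sigma (NS i) (Bx i))"
      using card_Un_le[of "Cells \<times> {(0, 0, 0, 0)}"] by (simp add: card_cartesian_product)
    finally have "real (card (Sigma Cells N)) \<le> 4 * A\<^sup>2 * T + L * (T\<^sup>2 / M\<^sup>2) * (\<Sum>i\<in>I. (2 ^ i) powr (\<beta> - 2))"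
      using cardC cardU by linarith
    then have "real (card Sol) \<le> K * (M ^ 4 / T\<^sup>2) * (4 * A\<^sup>2 * T + L * (T\<^sup>2 / M\<^sup>2) * (\<Sum>i\<in>I. (2 ^ i) powr (\<beta> - 2)))"
      using K M0 T0 by (intro order_trans[OF main] mult_left_mono) auto
    also have "\<dots> = K * (4 * A\<^sup>2 * (M ^ 4 / T) + L * (M\<^sup>2 * (\<Sum>i\<in>I. (2 ^ i) powr (\<beta> - 2))))"
    proof -
      have "(M ^ 4 / T\<^sup>2) * (4 * A\<^sup>2 * T) = 4 * A\<^sup>2 * (M ^ 4 / T)"
        using T0 by (simp add: power2_eq_square)
      moreover have "(M ^ 4 / T\<^sup>2) * (L * (T\<^sup>2 / M\<^sup>2) * s) = L * (M\<^sup>2 * s)" for s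
        using T0 M0 by (simp add: power2_eq_square power4_eq_xxxx)
      ultimately show ?thesis unfolding mult.assoc[of K] distrib_left by simp
    qed
    also have "\<dots> \<le> K * ((4 * A\<^sup>2 + L) * (M ^ 4 / T) + (4 * A\<^sup>2 + L) * (M\<^sup>2 * (\<Sum>i\<in>I. (2 ^ i) powr (\<beta> - 2))))"
      using K L T0 M0 by (intro mult_left_mono add_mono mult_right_mono) (auto intro!: mult_nonneg_nonneg sum_nonneg)
    also have "\<dots> = C * (M ^ 4 / T + M\<^sup>2 * (\<Sum>i\<in>I. (2 ^ i) powr (\<beta> - 2)))"
      by (simp add: C_def algebra_simps)
    finally show "real (card (near_sols \<tau> A M T)) \<le>
        C * (M ^ 4 / T + M\<^sup>2 * (\<Sum>i\<in>{i::nat. 2 ^ i \<le> T / M}. (2 ^ i) powr (\<beta> - 2)))"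
      unfolding Sol_def I_def .
  qed
qed

section \<open>Iterating the duality\<close>

lemma card_near_sols_trivial:
  assumes "M > 0" "A \<ge> 0"
  shows "real (card (near_sols \<tau> A M T)) \<le> (A * M) ^ 4"
proof -
  let ?I = "{1..\<lfloor>A * M\<rfloor>}"
  have "card (near_sols \<tau> A M T) \<le> card (?I \<times> ?I \<times> ?I \<times> ?I)"
    by (intro card_mono near_sols_subset_pos assms) auto
  also have "\<dots> = card ?I ^ 4" by (simp add: power4_eq_xxxx)
  finally have "real (card (near_sols \<tau> A M T)) \<le> real (card ?I) ^ 4"
    unfolding of_nat_power[symmetric] of_nat_le_iff .
  also have "\<dots> \<le> (A * M) ^ 4" using assms by (intro power_mono) auto
  finally show ?thesis .
qed

lemma near_sols_antimono:
  assumes "0 < T" "T \<le> T'"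
  shows "near_sols \<tau> A M T' \<subseteq> near_sols \<tau> A M T"
proof -
  have "M powr \<tau> / T' \<le> M powr \<tau> / T" using assms by (intro divide_left_mono) auto
  then show ?thesis unfolding near_sols_def by auto
qed

text \<open>For fixed \<open>a\<close>, \<open>b\<close>, \<open>c\<close> the power
  \<open>d powr \<tau>\<close> is confined to an interval of length
  \<open>2 * M powr \<tau> / T\<close>, where the derivative is at least
  \<open>M powr (\<tau> - 1)\<close>; so two admissible \<open>d\<close> differ by at most
  \<open>2 * M / T\<close>. This starts the iteration, as \<open>3 = 2 + 1/1\<close>, and also
  settles \<open>\<tau> = 1\<close>, which has no dual exponent.\<close>

lemma card_near_sols_cubic:
  fixes \<tau> A :: real
  assumes \<tau>: "\<tau> \<ge> 1" and A: "A \<ge> 1" and M: "M > 0" and T: "T > 0"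
  shows "real (card (near_sols \<tau> A M T)) \<le> 4 * A ^ 3 * (M ^ 4 / T + M ^ 3)"
proof -
  define I where "I = {1..\<lfloor>A * M\<rfloor>}"
  define D where "D v = {d::int. M \<le> d \<and> \<bar>d powr \<tau> - v\<bar> \<le> M powr \<tau> / T}" for v
  have sep: "\<bar>real_of_int d - d'\<bar> \<le> 2 * M / T" if "d \<in> D v" "d' \<in> D v" "d' < d" for d d' v
  proof -
    have d: "M \<le> d'" "real_of_int d' < d"
      and dv: "\<bar>d powr \<tau> - v\<bar> \<le> M powr \<tau> / T" "\<bar>d' powr \<tau> - v\<bar> \<le> M powr \<tau> / T"
      using that by (simp_all add: D_def)
    have d0: "0 < real_of_int d'" using d M by linarith
    obtain z :: real where z: "d' < z" "z < d"
      "d powr \<tau> - d' powr \<tau> = (real_of_int d - d') * (\<tau> * z powr (\<tau> - 1))"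
      using powr_MVT[OF d0 d(2), of \<tau>] by metis
    have "M powr (\<tau> - 1) * 1 \<le> z powr (\<tau> - 1) * \<tau>"
      using z d M \<tau> by (intro mult_mono powr_mono2) auto
    then have "(real_of_int d - d') * M powr (\<tau> - 1) \<le> d powr \<tau> - d' powr \<tau>"
      unfolding z(3) using d by (intro mult_left_mono) (auto simp: mult.commute)
    also have "\<dots> \<le> 2 * (M powr \<tau> / T)" using dv by linarith
    also have "M powr \<tau> = M powr (\<tau> - 1) * M" using M powr_add[of M "\<tau> - 1" 1] by simp
    finally have "M powr (\<tau> - 1) * (real_of_int d - d') \<le> M powr (\<tau> - 1) * (2 * M / T)" by (simp add: mult_ac)
    then have "real_of_int d - d' \<le> 2 * M / T" by (rule mult_left_le_imp_le) (use M in simp)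
    then show ?thesis using d by simp
  qed
  have Dfin: "finite (D v)" and Dcard: "real (card (D v)) \<le> 4 * M / T + 1" for v
  proof -
    have "finite (D v) \<and> real (card (D v)) \<le> 4 * M / T + 1"
    proof (cases "D v = {}")
      case False
      then obtain d0 where d0: "d0 \<in> D v" by blast
      have w: "2 * M / T \<ge> 0" using M T by simp
      have sub: "D v \<subseteq> {k::int. \<bar>k - real_of_int d0\<bar> \<le> 2 * M / T}"
      proof
        fix d assume d: "d \<in> D v"
        show "d \<in> {k::int. \<bar>k - real_of_int d0\<bar> \<le> 2 * M / T}"
          using sep[OF d d0] sep[OF d0 d] w by (cases d d0 rule: linorder_cases) (auto simp: abs_minus_commute)
      qed
      note c = card_int_interval_centre[OF w, of "real_of_int d0"]
      have "card (D v) \<le> card {k::int. \<bar>k - real_of_int d0\<bar> \<le> 2 * M / T}"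
        by (rule card_mono[OF c(1) sub])
      then show ?thesis using c finite_subset[OF sub c(1)] by linarith
    qed (use M T in auto)
    then show "finite (D v)" "real (card (D v)) \<le> 4 * M / T + 1" by auto
  qed
  have "near_sols \<tau> A M T \<subseteq> (SIGMA a:I. SIGMA b:I. SIGMA c:I. D (b powr \<tau> + c powr \<tau> - a powr \<tau>))"
  proof
    fix m assume m: "m \<in> near_sols \<tau> A M T"
    obtain a b c d where mm: "m = (a, b, c, d)" by (cases m) auto
    have "a \<in> I" "b \<in> I" "c \<in> I" 
      using subsetD[OF near_sols_subset_pos[OF M] m] by (simp_all add: mm I_def)
    moreover have "d \<in> D (b powr \<tau> + c powr \<tau> - a powr \<tau>)"
      using m mm by (auto simp: near_sols_def D_def algebra_simps)
    ultimately show "m \<in> (SIGMA a:I. SIGMA b:I. SIGMA c:I. D (b powr \<tau> + c powr \<tau> - a powr \<tau>))"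
      using mm by auto
  qed
  then have "card (near_sols \<tau> A M T) \<le> card (SIGMA a:I. SIGMA b:I. SIGMA c:I. D (b powr \<tau> + c powr \<tau> - a powr \<tau>))"
    using Dfin by (intro card_mono finite_SigmaI) (auto simp: I_def)
  also have "\<dots> = (\<Sum>a\<in>I. \<Sum>b\<in>I. \<Sum>c\<in>I. card (D (b powr \<tau> + c powr \<tau> - a powr \<tau>)))"
    using Dfin by (simp add: card_SigmaI I_def)
  finally have "real (card (near_sols \<tau> A M T)) \<le>
      (\<Sum>a\<in>I. \<Sum>b\<in>I. \<Sum>c\<in>I. real (card (D (b powr \<tau> + c powr \<tau> - a powr \<tau>))))"
    unfolding of_nat_sum[symmetric] of_nat_le_iff .
  also have "\<dots> \<le> (\<Sum>a\<in>I. \<Sum>b\<in>I. \<Sum>c\<in>I. 4 * M / T + 1)"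
    by (intro sum_mono Dcard)
  also have "\<dots> = real (card I) ^ 3 * (4 * M / T + 1)"
    by (simp add: power3_eq_cube mult.assoc)
  also have "\<dots> \<le> (A * M) ^ 3 * (4 * M / T + 4)"
  proof (intro mult_mono power_mono)
    have "0 \<le> A * M" using A M by simp
    then show "real (card I) \<le> A * M" unfolding I_def by (simp add: le_floor_iff)
  qed (use A M T in auto)
  also have "\<dots> = 4 * A ^ 3 * (M ^ 4 / T + M ^ 3)"
    by (simp add: power_mult_distrib algebra_simps power3_eq_cube power4_eq_xxxx)
  finally show ?thesis .
qed

lemma dyadic_geometric_sum:
  fixes \<gamma> :: real
  assumes \<gamma>: "\<gamma> > 0"
  obtains K where "K > 0" "\<And>X. X > 0 \<Longrightarrow> (\<Sum>i\<in>{i::nat. 2 ^ i \<le> X}. (2 ^ i) powr \<gamma>) \<le> K * X powr \<gamma>"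
proof -
  define r where "r = 2 powr \<gamma>"
  have r: "r > 1" using \<gamma> by (simp add: r_def)
  define K where "K = r / (r - 1)"
  have K: "K > 0" using r by (simp add: K_def)
  show ?thesis
  proof (rule that[OF K])
    fix X :: real assume X: "X > 0"
    define I where "I = {i::nat. 2 ^ i \<le> X}"
    show "(\<Sum>i\<in>{i::nat. 2 ^ i \<le> X}. (2 ^ i) powr \<gamma>) \<le> K * X powr \<gamma>"
    proof (cases "I = {}")
      case True
      then show ?thesis using K by (simp add: I_def)
    next
      case False
      obtain n :: nat where n: "X < 2 ^ n" using real_arch_pow[of 2 X] by auto
      have "I \<subseteq> {..<n}"
      proof
        fix i assume "i \<in> I"
        then have "(2::real) ^ i < 2 ^ n" using n unfolding I_def mem_Collect_eq by linarith
        then show "i \<in> {..<n}" by simp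
      qed
      then have fin: "finite I" using finite_subset by blast
      define m where "m = Max I"
      have m: "m \<in> I" "\<And>i. i \<in> I \<Longrightarrow> i \<le> m" using False fin by (auto simp: m_def)
      have pw: "((2::real) ^ i) powr \<gamma> = r ^ i" for i
        by (simp add: r_def powr_realpow[symmetric] powr_powr mult.commute)
      have "(\<Sum>i\<in>I. ((2::real) ^ i) powr \<gamma>) \<le> (\<Sum>i<Suc m. r ^ i)"
        unfolding pw using m r by (intro sum_mono2) (auto simp: less_Suc_eq_le)
      also have "\<dots> = (r ^ Suc m - 1) / (r - 1)" using r by (subst geometric_sum) auto
      also have "\<dots> \<le> r ^ Suc m / (r - 1)" using r by (intro divide_right_mono) auto
      also have "\<dots> = K * (2 ^ m) powr \<gamma>" unfolding pw by (simp add: K_def)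
      also have "\<dots> \<le> K * X powr \<gamma>"
        using m(1) K \<gamma> by (intro mult_left_mono powr_mono2) (auto simp: I_def)
      finally show ?thesis by (simp add: I_def)
    qed
  qed
qed

text \<open>
  Since the count decreases in \<open>T\<close>, it may be evaluated at \<open>T = M\<^bsup>2-1/(n+1)\<^esup>\<close>, where the two terms balance.
\<close>

lemma near_sols_bound_step:
  fixes n :: nat
  assumes n: "n \<ge> 1"
    and IH: "\<And>\<tau> A. \<lbrakk>\<tau> > 1; A \<ge> 1\<rbrakk> \<Longrightarrow> \<exists>C. \<forall>M>0. \<forall>T>0.
      real (card (near_sols \<tau> A M T)) \<le> C * (M ^ 4 / T + M powr (2 + 1 / real n))"
    and \<tau>: "\<tau> > 1" and A: "A \<ge> 1"
  shows "\<exists>C. \<forall>M>0. \<forall>T>0.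
      real (card (near_sols \<tau> A M T)) \<le> C * (M ^ 4 / T + M powr (2 + 1 / real (Suc n)))"
proof -
  define \<gamma> where "\<gamma> = 1 / real n"
  define \<gamma>' where "\<gamma>' = 1 / real (Suc n)"
  \<comment> \<open>The last identity is the balance: \<open>T0 / M\<close> equals
    \<open>M powr (1 - \<gamma>')\<close>, and its power \<open>\<gamma>\<close> must come out as
    \<open>M powr \<gamma>'\<close>.\<close>
  have \<gamma>: "\<gamma> > 0" "0 < \<gamma>'" "\<gamma>' \<le> 1" "(1 - \<gamma>') * \<gamma> = \<gamma>'"
    using n by (auto simp: \<gamma>_def \<gamma>'_def field_simps)
  have \<beta>: "2 + \<gamma> \<ge> 2" using \<gamma> by simp
  have p: "\<tau> / (\<tau> - 1) > 1" using \<tau> by simp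
  obtain C1 where C1: "C1 > 0" and b1: "\<And>M T. \<lbrakk>M \<ge> 1; T \<ge> 1; T \<le> M\<^sup>2\<rbrakk> \<Longrightarrow>
      real (card (near_sols \<tau> A M T)) \<le>
        C1 * (M ^ 4 / T + M\<^sup>2 * (\<Sum>i\<in>{i::nat. 2 ^ i \<le> T / M}. (2 ^ i) powr (2 + \<gamma> - 2)))"
    using card_near_sols_le_dual[OF \<tau> A \<beta> IH[OF p, folded \<gamma>_def]] by metis
  obtain K where K: "K > 0" "\<And>X. X > 0 \<Longrightarrow> (\<Sum>i\<in>{i::nat. 2 ^ i \<le> X}. (2 ^ i) powr \<gamma>) \<le> K * X powr \<gamma>"
    using dyadic_geometric_sum[OF \<gamma>(1)] by metis
  \<comment> \<open>The second summand covers what the duality does not reach. For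
    \<open>T < 1\<close> the trivial count is enough. For \<open>M < 1\<close> solutions exist only
    if \<open>A * M \<ge> 1\<close>, and then
    \<open>(A * M) powr (2 + \<gamma>') \<ge> 1\<close>.\<close>
  define C where "C = C1 * (1 + K) + A ^ 4 * A powr (2 + \<gamma>')"
  have Apw: "A ^ 4 \<ge> 1" "A powr (2 + \<gamma>') \<ge> 1" using A \<gamma> by (auto intro: ge_one_powr_ge_zero)
  have CA: "C \<ge> A ^ 4" "C \<ge> A ^ 4 * A powr (2 + \<gamma>')" "C \<ge> C1 * (1 + K)"
  proof -
    have "C1 * (1 + K) \<ge> 0" using C1 K by simp
    moreover have "A ^ 4 * 1 \<le> A ^ 4 * A powr (2 + \<gamma>')" using Apw by (intro mult_left_mono) auto
    ultimately show "C \<ge> A ^ 4" "C \<ge> A ^ 4 * A powr (2 + \<gamma>')" "C \<ge> C1 * (1 + K)"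
      using Apw unfolding C_def by linarith+
  qed
  have "real (card (near_sols \<tau> A M T)) \<le> C * (M ^ 4 / T + M powr (2 + \<gamma>'))" if M: "M > 0" and T: "T > 0" for M T
  proof -
    have triv: "real (card (near_sols \<tau> A M T)) \<le> (A * M) ^ 4"
      using card_near_sols_trivial M A by simp
    have nn: "M ^ 4 / T \<ge> 0" "M powr (2 + \<gamma>') \<ge> 0" using M T by auto
    have Cn: "C \<ge> 0" using CA(1) Apw by linarith
    consider "T < 1" | "M < 1" | "T \<ge> 1" "M \<ge> 1" by linarith
    then show ?thesis
    proof cases
      case 1
      have "M ^ 4 \<le> M ^ 4 / T" using 1 M T by (simp add: field_simps)
      then have "A ^ 4 * M ^ 4 \<le> C * (M ^ 4 / T)" using CA(1) M Cn by (intro mult_mono) auto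
      then show ?thesis using triv mult_nonneg_nonneg[OF Cn nn(2)]
        unfolding distrib_left power_mult_distrib by linarith
    next
      case 2
      show ?thesis
      proof (cases "A * M < 1")
        case True
        then have "\<lfloor>A * M\<rfloor> < 1" by (simp add: floor_less_iff)
        then have "{1..\<lfloor>A * M\<rfloor>} = {}" by simp
        then have "near_sols \<tau> A M T = {}" using near_sols_subset_pos[OF M, of \<tau> A T] by auto
        then show ?thesis using Cn nn by simp
      next
        case False
        have "(A * M) ^ 4 \<le> A ^ 4 * 1" unfolding power_mult_distrib using 2 M A
          by (intro mult_left_mono power_le_one) auto
        also have "\<dots> \<le> A ^ 4 * (A powr (2 + \<gamma>') * M powr (2 + \<gamma>'))"
        proof (intro mult_left_mono)
          have "1 \<le> (A * M) powr (2 + \<gamma>')" using False \<gamma> by (intro ge_one_powr_ge_zero) auto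
          then show "1 \<le> A powr (2 + \<gamma>') * M powr (2 + \<gamma>')" using A M by (simp add: powr_mult)
        qed (use A in auto)
        also have "\<dots> \<le> C * M powr (2 + \<gamma>')"
          unfolding mult.assoc[symmetric] using CA(2) by (intro mult_right_mono) auto
        finally show ?thesis using triv mult_nonneg_nonneg[OF Cn nn(1)] unfolding distrib_left by linarith
      qed
    next
      case 3
      define T0 where "T0 = M powr (2 - \<gamma>')"
      define T1 where "T1 = min T T0"
      have T0: "T0 \<ge> 1" "T0 \<le> M\<^sup>2"
      proof -
        show "T0 \<ge> 1" unfolding T0_def using 3 \<gamma> by (intro ge_one_powr_ge_zero) auto
        have "M powr (2 - \<gamma>') \<le> M powr 2" using 3 \<gamma> by (intro powr_mono) auto
        then show "T0 \<le> M\<^sup>2" using M by (simp add: T0_def powr_numeral)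
      qed
      have T1: "T1 \<ge> 1" "T1 \<le> M\<^sup>2" "T1 \<le> T" "T1 \<le> T0" using T0 3 by (auto simp: T1_def)
      have T1M: "T1 / M > 0" using T1(1) M by simp
      have "real (card (near_sols \<tau> A M T)) \<le> real (card (near_sols \<tau> A M T1))"
        using T1 near_sols_antimono[of T1 T \<tau> A M] finite_near_sols[OF M] by (simp add: card_mono)
      also have "\<dots> \<le> C1 * (M ^ 4 / T1 + M\<^sup>2 * (\<Sum>i\<in>{i::nat. 2 ^ i \<le> T1 / M}. (2 ^ i) powr \<gamma>))"
        using b1[OF 3(2) T1(1,2)] by simp
      also have "\<dots> \<le> C1 * ((M ^ 4 / T + M powr (2 + \<gamma>')) + K * M powr (2 + \<gamma>'))"
      proof (intro mult_left_mono add_mono)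
        \<comment> \<open>The reciprocal of a minimum is at most the sum of the reciprocals, so
          replacing \<open>T\<close> by \<open>T1\<close> costs only \<open>M^4 / T0\<close>, which
          has the size of the error term.\<close>
        have "M ^ 4 / T1 \<le> M ^ 4 / T + M ^ 4 / T0"
          using M T T0 by (auto simp: T1_def min_def)
        also have "M ^ 4 / T0 = M powr (2 + \<gamma>')"
          using M powr_diff[of M 4 "2 - \<gamma>'"] by (simp add: T0_def powr_numeral)
        finally show "M ^ 4 / T1 \<le> M ^ 4 / T + M powr (2 + \<gamma>')" .
        have "(\<Sum>i\<in>{i::nat. 2 ^ i \<le> T1 / M}. (2 ^ i) powr \<gamma>) \<le> K * (T1 / M) powr \<gamma>"
          by (rule K(2)[OF T1M])
        also have "\<dots> \<le> K * (T0 / M) powr \<gamma>"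
          using K(1) T1 M T1M \<gamma> by (intro mult_left_mono powr_mono2 divide_right_mono) auto
        also have "T0 / M = M powr (1 - \<gamma>')"
          using M powr_diff[of M "2 - \<gamma>'" 1] by (simp add: T0_def)
        also have "(M powr (1 - \<gamma>')) powr \<gamma> = M powr \<gamma>'" by (simp add: powr_powr \<gamma>(4))
        finally have "M\<^sup>2 * (\<Sum>i\<in>{i::nat. 2 ^ i \<le> T1 / M}. (2 ^ i) powr \<gamma>) \<le> M\<^sup>2 * (K * M powr \<gamma>')"
          by (intro mult_left_mono) auto
        also have "\<dots> = K * M powr (2 + \<gamma>')" using M by (simp add: powr_add powr_numeral)
        finally show "M\<^sup>2 * (\<Sum>i\<in>{i::nat. 2 ^ i \<le> T1 / M}. (2 ^ i) powr \<gamma>) \<le> K * M powr (2 + \<gamma>')" .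
      qed (use C1 in auto)
      also have "\<dots> \<le> C1 * ((M ^ 4 / T + M powr (2 + \<gamma>')) + K * (M ^ 4 / T + M powr (2 + \<gamma>')))"
        using C1 K nn by (intro mult_left_mono add_mono) auto
      also have "\<dots> = C1 * (1 + K) * (M ^ 4 / T + M powr (2 + \<gamma>'))" by (simp only: algebra_simps)
      also have "\<dots> \<le> C * (M ^ 4 / T + M powr (2 + \<gamma>'))"
        using CA(3) nn by (intro mult_right_mono) auto
      finally show ?thesis .
    qed
  qed
  then show ?thesis unfolding \<gamma>'_def by blast
qed

text \<open>The dual problem has another exponent and a wider range of ratios, so the induction has
  to carry all \<open>\<tau>\<close> and \<open>A\<close> at once.\<close>

lemma near_sols_bound:
  fixes n :: nat
  assumes "n \<ge> 1" "\<tau> > 1" "A \<ge> 1"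
  shows "\<exists>C. \<forall>M>0. \<forall>T>0.
      real (card (near_sols \<tau> A M T)) \<le> C * (M ^ 4 / T + M powr (2 + 1 / real n))"
  using assms
proof (induction n arbitrary: \<tau> A rule: nat_induct_at_least)
  case base
  have "real (card (near_sols \<tau> A M T)) \<le> 4 * A ^ 3 * (M ^ 4 / T + M powr (2 + 1 / real 1))"
    if "M > 0" "T > 0" for M T
    using card_near_sols_cubic[of \<tau> A M T] base that by (simp add: powr_numeral)
  then show ?case by blast
next
  case (Suc n)
  show ?case
    by (rule near_sols_bound_step) (use Suc in auto)
qed

section \<open>Fourth moments over dyadic blocks\<close>

text \<open>The quadruples counted by the additive energy of \<open>F\<close> on \<open>W\<close>
  modulo \<open>Q\<close>. They are grouped into pairs because a fourth power is expanded as the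
  squared modulus of a sum over \<open>W \<times> W\<close>.\<close>

definition pair_energy :: "(nat \<Rightarrow> int) \<Rightarrow> nat \<Rightarrow> nat set \<Rightarrow> ((nat \<times> nat) \<times> nat \<times> nat) set" where
  "pair_energy F Q W = {(u, v). u \<in> W \<times> W \<and> v \<in> W \<times> W \<and>
     int Q dvd F (fst u) + F (snd u) - (F (fst v) + F (snd v))}"

lemma finite_pair_energy: "finite W \<Longrightarrow> finite (pair_energy F Q W)"
  by (rule finite_subset[of _ "(W \<times> W) \<times> (W \<times> W)"]) (auto simp: pair_energy_def)

text \<open>Square the sum, take the squared modulus and use orthogonality modulo \<open>Q\<close>.
  Averaging over the grid instead of the unit interval makes the moment apply directly to the grid
  points at which large values are counted.\<close>

lemma discrete_fourth_moment:
  fixes F :: "nat \<Rightarrow> int" and Q :: nat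
  assumes W: "finite W" and Q: "Q > 0"
  shows "(\<Sum>a<Q. (norm (\<Sum>n\<in>W. e_unit (real a / Q * F n))) ^ 4) = real Q * real (card (pair_energy F Q W))"
proof -
  let ?g = "\<lambda>u. F (fst u) + F (snd u)"
  have sq: "complex_of_real ((norm (\<Sum>n\<in>W. e_unit (real a / Q * F n))) ^ 4) =
      (\<Sum>u\<in>W \<times> W. \<Sum>v\<in>W \<times> W. e_unit (real_of_int (int a * (?g u - ?g v)) / Q))" for a
  proof -
    let ?s = "\<Sum>n\<in>W. e_unit (real a / Q * F n)"
    have ss: "?s * ?s = (\<Sum>u\<in>W \<times> W. e_unit (real a / Q * ?g u))"
    proof -
      have "?s * ?s = (\<Sum>n\<in>W. \<Sum>m\<in>W. e_unit (real a / Q * F n) * e_unit (real a / Q * F m))"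
        by (rule sum_product)
      also have "\<dots> = (\<Sum>n\<in>W. \<Sum>m\<in>W. e_unit (real a / Q * (F n + F m)))"
        by (intro sum.cong refl) (simp only: e_unit_add[symmetric] distrib_left of_int_add)
      finally show ?thesis unfolding sum.cartesian_product case_prod_unfold by simp
    qed
    have "(norm ?s) ^ 4 = (norm (\<Sum>u\<in>W \<times> W. e_unit (real a / Q * ?g u)))\<^sup>2"
    proof -
      have "(norm z) ^ 4 = (norm (z * z))\<^sup>2" for z :: complex
        by (simp add: norm_mult power2_eq_square power4_eq_xxxx)
      with ss show ?thesis by (simp only:)
    qed
    then have "complex_of_real ((norm ?s) ^ 4) =
        (\<Sum>u\<in>W \<times> W. \<Sum>v\<in>W \<times> W. e_unit (real a / Q * ?g u) * cnj (e_unit (real a / Q * ?g v)))"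
      by (simp only: norm_sum_sq_eq)
    also have "\<dots> = (\<Sum>u\<in>W \<times> W. \<Sum>v\<in>W \<times> W. e_unit (real_of_int (int a * (?g u - ?g v)) / Q))"
    proof (intro sum.cong refl)
      fix u v
      have "real a / Q * ?g u + - (real a / Q * ?g v) = real_of_int (int a * (?g u - ?g v)) / Q"
        by (simp add: right_diff_distrib diff_divide_distrib)
      then show "e_unit (real a / Q * ?g u) * cnj (e_unit (real a / Q * ?g v)) =
          e_unit (real_of_int (int a * (?g u - ?g v)) / Q)"
        by (simp only: cnj_e_unit e_unit_add[symmetric])
    qed
    finally show ?thesis .
  qed
  have "complex_of_real (\<Sum>a<Q. (norm (\<Sum>n\<in>W. e_unit (real a / Q * F n))) ^ 4) =
      (\<Sum>a<Q. \<Sum>u\<in>W \<times> W. \<Sum>v\<in>W \<times> W. e_unit (real_of_int (int a * (?g u - ?g v)) / Q))"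
    unfolding of_real_sum sq ..
  also have "\<dots> = (\<Sum>u\<in>W \<times> W. \<Sum>v\<in>W \<times> W. \<Sum>a<Q. e_unit (real_of_int (int a * (?g u - ?g v)) / Q))"
    by (subst sum.swap, rule sum.cong[OF refl], rule sum.swap)
  also have "\<dots> = (\<Sum>u\<in>W \<times> W. \<Sum>v\<in>W \<times> W. if int Q dvd ?g u - ?g v then of_nat Q else 0)"
  proof (intro sum.cong refl)
    fix u v
    have "(\<Sum>a<Q. e_unit (real_of_int (int a * (?g u - ?g v)) / Q)) =
        (\<Sum>g\<in>{0..<int Q}. e_unit (real_of_int (g * (?g u - ?g v)) / real Q))"
      by (rule sum.reindex_bij_witness[of _ nat int]) auto
    then show "(\<Sum>a<Q. e_unit (real_of_int (int a * (?g u - ?g v)) / Q)) =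
        (if int Q dvd ?g u - ?g v then of_nat Q else 0)"
      unfolding sum_e_unit_int[OF Q] .
  qed
  also have "\<dots> = (\<Sum>uv\<in>(W \<times> W) \<times> (W \<times> W). if uv \<in> pair_energy F Q W then of_nat Q else 0)"
  proof -
    have eq: "(if int Q dvd ?g u - ?g v then of_nat Q else 0) = (if (u, v) \<in> pair_energy F Q W then of_nat Q else (0::complex))"
      if "u \<in> W \<times> W" "v \<in> W \<times> W" for u v
      using that by (simp only: pair_energy_def mem_Collect_eq prod.case simp_thms)
    have "(\<Sum>u\<in>W \<times> W. \<Sum>v\<in>W \<times> W. if int Q dvd ?g u - ?g v then of_nat Q else (0::complex)) =
        (\<Sum>u\<in>W \<times> W. \<Sum>v\<in>W \<times> W. if (u, v) \<in> pair_energy F Q W then of_nat Q else 0)"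
      by (rule sum.cong[OF refl], rule sum.cong[OF refl], rule eq)
    also have "\<dots> = (\<Sum>(u, v)\<in>(W \<times> W) \<times> (W \<times> W). if (u, v) \<in> pair_energy F Q W then of_nat Q else 0)"
      by (rule sum.cartesian_product)
    finally show ?thesis unfolding case_prod_unfold prod.collapse .
  qed
  also have "\<dots> = (\<Sum>uv\<in>pair_energy F Q W. of_nat Q)"
  proof -
    have "pair_energy F Q W \<subseteq> (W \<times> W) \<times> (W \<times> W)" unfolding pair_energy_def by blast
    then have ie: "((W \<times> W) \<times> (W \<times> W)) \<inter> pair_energy F Q W = pair_energy F Q W" by blast
    have fin: "finite ((W \<times> W) \<times> (W \<times> W))" using W by blast
    show ?thesis
      using sum.inter_restrict[OF fin, of "\<lambda>_. of_nat Q :: complex" "pair_energy F Q W"]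
      unfolding ie by (rule sym)
  qed
  also have "\<dots> = complex_of_real (real Q * real (card (pair_energy F Q W)))" by simp
  finally show ?thesis unfolding of_real_eq_iff .
qed

text \<open>A quadruple with all entries in one block belongs to no other block. Hence all blocks of
  one length together cost no more than the whole range.\<close>

lemma card_pair_energy_disjoint:
  assumes "finite I" "finite D" "\<And>b. b \<in> I \<Longrightarrow> W b \<subseteq> D"
    and "\<And>b c. \<lbrakk>b \<in> I; c \<in> I; b \<noteq> c\<rbrakk> \<Longrightarrow> W b \<inter> W c = {}"
  shows "(\<Sum>b\<in>I. card (pair_energy F Q (W b))) \<le> card (pair_energy F Q D)"
proof -
  have fin: "finite (W b)" if "b \<in> I" for b using assms(2,3) that finite_subset by blast
  have "(\<Sum>b\<in>I. card (pair_energy F Q (W b))) = card (\<Union>b\<in>I. pair_energy F Q (W b))"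
  proof (rule card_UN_disjoint[symmetric])
    show "\<forall>i\<in>I. finite (pair_energy F Q (W i))" using fin finite_pair_energy by blast
    show "\<forall>i\<in>I. \<forall>j\<in>I. i \<noteq> j \<longrightarrow> pair_energy F Q (W i) \<inter> pair_energy F Q (W j) = {}"
      using assms(4) unfolding pair_energy_def by blast
  qed (use assms in auto)
  also have "\<dots> \<le> card (pair_energy F Q D)"
    using assms(3) finite_pair_energy[OF assms(2)]
    by (intro card_mono) (auto simp: pair_energy_def)
  finally show ?thesis .
qed

text \<open>Every value of the sequence lies in \<open>[0, Q/2)\<close>, so the congruence modulo
  \<open>Q\<close> is an equality. Removing the four integer parts costs at most \<open>2\<close>,
  which is the tolerance \<open>M powr \<tau> / T\<close> for \<open>M = 2 ^ i\<close> and
  \<open>T = M powr \<tau> / 2\<close>.\<close>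

lemma card_pair_energy_le_near_sols:
  fixes \<tau> :: real and i Q :: nat
  assumes \<tau>: "\<tau> \<ge> 1" and Q: "real Q > 2 * (2 ^ (i + 1)) powr \<tau>"
  shows "card (pair_energy (\<lambda>n. \<lfloor>real n powr \<tau>\<rfloor>) Q {2 ^ i..<2 ^ (i + 1)}) \<le>
    card (near_sols \<tau> 2 (2 ^ i) ((2 ^ i) powr \<tau> / 2))"
proof -
  define F where "F n = \<lfloor>real n powr \<tau>\<rfloor>" for n :: nat
  have F: "0 \<le> F n" "real_of_int (F n) \<le> real n powr \<tau>" "real n powr \<tau> < real_of_int (F n) + 1" for n
    by (simp_all add: F_def)
  define D :: "nat set" where "D = {2 ^ i..<2 ^ (i + 1)}"
  define h where "h uv = (int (fst (fst uv)), int (fst (snd uv)), int (snd (snd uv)), int (snd (fst uv)))"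
    for uv :: "(nat \<times> nat) \<times> nat \<times> nat"
  have "card (pair_energy F Q D) \<le> card (near_sols \<tau> 2 (2 ^ i) ((2 ^ i) powr \<tau> / 2))"
  proof (rule card_inj_on_le)
    show "inj_on h (pair_energy F Q D)" by (rule inj_onI) (simp add: h_def prod_eq_iff)
    show "finite (near_sols \<tau> 2 (2 ^ i) ((2 ^ i) powr \<tau> / 2))" by (rule finite_near_sols) simp
    show "h ` pair_energy F Q D \<subseteq> near_sols \<tau> 2 (2 ^ i) ((2 ^ i) powr \<tau> / 2)"
    proof
      fix m assume "m \<in> h ` pair_energy F Q D"
      then obtain uv where uv: "uv \<in> pair_energy F Q D" "m = h uv" by blast
      obtain n1 n4 n2 n3 where nn: "uv = ((n1, n4), (n2, n3))" by (metis surj_pair)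
      have n: "n1 \<in> D" "n2 \<in> D" "n3 \<in> D" "n4 \<in> D"
        and dvd: "int Q dvd F n1 + F n4 - (F n2 + F n3)"
        using uv(1) unfolding nn pair_energy_def by simp_all
      have rng: "real k \<in> {2 ^ i..2 * 2 ^ i}" if "k \<in> D" for k
      proof -
        have "2 ^ i \<le> k" "k \<le> 2 ^ (i + 1)" using that by (simp_all add: D_def)
        then have "real (2 ^ i) \<le> real k" "real k \<le> real (2 ^ (i + 1))" by (simp_all only: of_nat_le_iff)
        then show ?thesis by simp
      qed
      have Fb: "real_of_int (F k) < Q / 2" if "k \<in> D" for k
      proof -
        have "real k powr \<tau> \<le> (2 ^ (i + 1)) powr \<tau>" using rng[OF that] \<tau> by (intro powr_mono2) auto
        then show ?thesis using Q F(2)[of k] by linarith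
      qed
      have "\<bar>real_of_int (F n1 + F n4 - (F n2 + F n3))\<bar> < real Q"
        using Fb[OF n(1)] Fb[OF n(2)] Fb[OF n(3)] Fb[OF n(4)] F(1)[of n1] F(1)[of n2] F(1)[of n3] F(1)[of n4]
        unfolding of_int_add of_int_diff by linarith
      then have "\<bar>F n1 + F n4 - (F n2 + F n3)\<bar> < int Q" by linarith
      then have "F n1 + F n4 - (F n2 + F n3) = 0"
        using dvd dvd_imp_le_int[of "F n1 + F n4 - (F n2 + F n3)" "int Q"] by linarith
      then have "real_of_int (F n1) + F n4 - (F n2 + F n3) = 0"
        by (metis of_int_0 of_int_add of_int_diff)
      then have "\<bar>real n1 powr \<tau> - real n2 powr \<tau> - real n3 powr \<tau> + real n4 powr \<tau>\<bar> \<le> 2"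
        using F(2,3)[of n1] F(2,3)[of n2] F(2,3)[of n3] F(2,3)[of n4] by linarith
      then show "m \<in> near_sols \<tau> 2 (2 ^ i) ((2 ^ i) powr \<tau> / 2)"
        unfolding uv(2) nn h_def near_sols_def using rng[OF n(1)] rng[OF n(2)] rng[OF n(3)] rng[OF n(4)] by simp
    qed
  qed
  then show ?thesis unfolding F_def[abs_def] D_def .
qed

text \<open>At this precision the main term \<open>M^4 / T\<close> is
  \<open>2 * M powr (4 - \<tau>)\<close>; its competition with the error term produces the
  maximum.\<close>

lemma card_near_sols_dyadic:
  fixes \<tau> :: real and n :: nat
  assumes \<tau>: "\<tau> \<ge> 1" and n: "n \<ge> 1"
  obtains C where "C > 0" "\<And>i::nat. real (card (near_sols \<tau> 2 (2 ^ i) ((2 ^ i) powr \<tau> / 2))) \<le>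
    C * (2 ^ i) powr (max (4 - \<tau>) (2 + 1 / real n))"
proof -
  define \<sigma> where "\<sigma> = max (4 - \<tau>) (2 + 1 / real n)"
  have "\<exists>C\<ge>0. \<forall>i::nat. real (card (near_sols \<tau> 2 (2 ^ i) ((2 ^ i) powr \<tau> / 2))) \<le>
      C * ((2 ^ i) ^ 4 / ((2 ^ i) powr \<tau> / 2) + (2 ^ i) powr \<sigma>)"
  proof (cases "\<tau> = 1")
    case True
    have s: "\<sigma> = 3"
      using n True by (simp add: \<sigma>_def max_def divide_le_eq_1)
    show ?thesis
    proof (intro exI[of _ "4 * 2 ^ 3"] conjI allI)
      fix i :: nat
      show "real (card (near_sols \<tau> 2 (2 ^ i) ((2 ^ i) powr \<tau> / 2))) \<le>
        4 * 2 ^ 3 * ((2 ^ i) ^ 4 / ((2 ^ i) powr \<tau> / 2) + (2 ^ i) powr \<sigma>)"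
        using card_near_sols_cubic[OF \<tau>, of 2 "2 ^ i" "(2 ^ i) powr \<tau> / 2"] unfolding s by (simp add: powr_numeral)
    qed simp
  next
    case False
    then have "\<tau> > 1" using \<tau> by simp
    then obtain C where C: "\<forall>M>0. \<forall>T>0.
      real (card (near_sols \<tau> 2 M T)) \<le> C * (M ^ 4 / T + M powr (2 + 1 / real n))"
      using near_sols_bound[OF n, of \<tau> 2] by auto
    show ?thesis
    proof (intro exI[of _ "\<bar>C\<bar>"] conjI allI)
      fix i :: nat
      have "real (card (near_sols \<tau> 2 (2 ^ i) ((2 ^ i) powr \<tau> / 2))) \<le>
         C * ((2 ^ i) ^ 4 / ((2 ^ i) powr \<tau> / 2) + (2 ^ i) powr (2 + 1 / real n))"
        using C[rule_format, of "2 ^ i" "(2 ^ i) powr \<tau> / 2"] by simp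
      also have "\<dots> \<le> \<bar>C\<bar> * ((2 ^ i) ^ 4 / ((2 ^ i) powr \<tau> / 2) + (2 ^ i) powr (2 + 1 / real n))"
        by (intro mult_right_mono) auto
      also have "\<dots> \<le> \<bar>C\<bar> * ((2 ^ i) ^ 4 / ((2 ^ i) powr \<tau> / 2) + (2 ^ i) powr \<sigma>)"
        by (intro mult_left_mono add_left_mono powr_mono) (auto simp: \<sigma>_def)
      finally show "real (card (near_sols \<tau> 2 (2 ^ i) ((2 ^ i) powr \<tau> / 2))) \<le>
        \<bar>C\<bar> * ((2 ^ i) ^ 4 / ((2 ^ i) powr \<tau> / 2) + (2 ^ i) powr \<sigma>)" .
    qed simp
  qed
  then obtain C where C: "C \<ge> 0" "\<And>i::nat. real (card (near_sols \<tau> 2 (2 ^ i) ((2 ^ i) powr \<tau> / 2))) \<le>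
      C * ((2 ^ i) ^ 4 / ((2 ^ i) powr \<tau> / 2) + (2 ^ i) powr \<sigma>)" by blast
  show ?thesis
  proof (rule that[of "3 * C + 1"])
    fix i :: nat
    have "((2::real) ^ i) ^ 4 / ((2 ^ i) powr \<tau> / 2) = 2 * (2 ^ i) powr (4 - \<tau>)"
      by (simp add: powr_diff powr_numeral)
    also have "\<dots> \<le> 2 * (2 ^ i) powr \<sigma>"
      by (intro mult_left_mono powr_mono) (auto simp: \<sigma>_def)
    finally have "(2 ^ i) ^ 4 / ((2 ^ i) powr \<tau> / 2) + (2 ^ i) powr \<sigma> \<le> 3 * ((2::real) ^ i) powr \<sigma>" by simp
    then have "C * ((2 ^ i) ^ 4 / ((2 ^ i) powr \<tau> / 2) + (2 ^ i) powr \<sigma>) \<le> C * (3 * (2 ^ i) powr \<sigma>)"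
      using C(1) by (rule mult_left_mono)
    with C(2)[of i] have "real (card (near_sols \<tau> 2 (2 ^ i) ((2 ^ i) powr \<tau> / 2))) \<le> 3 * C * (2 ^ i) powr \<sigma>"
      by simp
    also have "\<dots> \<le> (3 * C + 1) * (2 ^ i) powr \<sigma>" by (intro mult_right_mono) auto
    finally show "real (card (near_sols \<tau> 2 (2 ^ i) ((2 ^ i) powr \<tau> / 2))) \<le>
      (3 * C + 1) * (2 ^ i) powr (max (4 - \<tau>) (2 + 1 / real n))" unfolding \<sigma>_def .
  qed (use C in auto)
qed

section \<open>Dyadic decomposition of initial sums\<close>

definition dyadic_block :: "nat \<Rightarrow> nat \<Rightarrow> nat set" where
  "dyadic_block l b = {b * 2 ^ l..<(b + 1) * 2 ^ l}"

text \<open>Halving repeatedly writes an initial segment of a block of level \<open>i\<close> as at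
  most \<open>i + 1\<close> dyadic blocks inside it. This is the Rademacher-Menshov device: one
  bound for blocks controls all lengths \<open>t\<close> with a logarithmic loss, as needed when the
  length of a large sum depends on \<open>x\<close>.\<close>

lemma norm_prefix_sum_le:
  fixes g :: "nat \<Rightarrow> complex"
  assumes "\<And>l b. \<lbrakk>l \<le> i; B * 2 ^ (i - l) \<le> b; b < (B + 1) * 2 ^ (i - l)\<rbrakk> \<Longrightarrow>
      norm (\<Sum>n\<in>dyadic_block l b. g n) \<le> Z"
    and "t \<le> 2 ^ i" and "Z \<ge> 0"
  shows "norm (\<Sum>n\<in>{B * 2 ^ i..<B * 2 ^ i + t}. g n) \<le> (real i + 1) * Z"
  using assms
proof (induction i arbitrary: B t)
  case 0
  show ?case
  proof (cases "t = 0")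
    case False
    then have "t = 1" using 0 by simp
    then show ?thesis using 0(1)[of 0 B] by (simp add: dyadic_block_def)
  qed (use 0 in simp)
next
  case (Suc i)
  have half: "norm (\<Sum>n\<in>{B' * 2 ^ i..<B' * 2 ^ i + t'}. g n) \<le> (real i + 1) * Z"
    if "B' = 2 * B \<or> B' = 2 * B + 1" "t' \<le> 2 ^ i" for B' t'
  proof (rule Suc.IH)
    fix l b assume l: "l \<le> i" "B' * 2 ^ (i - l) \<le> b" "b < (B' + 1) * 2 ^ (i - l)"
    have p: "2 ^ (Suc i - l) = 2 * (2::nat) ^ (i - l)" using l by (simp add: Suc_diff_le)
    have "2 * B * 2 ^ (i - l) \<le> B' * 2 ^ (i - l)" "(B' + 1) * 2 ^ (i - l) \<le> (2 * B + 2) * 2 ^ (i - l)"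
      using that(1) by auto
    then have "2 * B * 2 ^ (i - l) \<le> b" "b < (2 * B + 2) * 2 ^ (i - l)"
      using l by linarith+
    then have "B * 2 ^ (Suc i - l) \<le> b" "b < (B + 1) * 2 ^ (Suc i - l)"
      unfolding p by (simp_all add: algebra_simps)
    then show "norm (\<Sum>n\<in>dyadic_block l b. g n) \<le> Z" using l by (intro Suc.prems) auto
  qed (use that Suc.prems in auto)
  show ?case
  proof (cases "t \<le> 2 ^ i")
    case True
    have "norm (\<Sum>n\<in>{B * 2 ^ Suc i..<B * 2 ^ Suc i + t}. g n) \<le> (real i + 1) * Z"
      using half[of "2 * B" t] True by (simp add: mult_ac)
    then show ?thesis using Suc.prems(3) by (simp add: distrib_right)
  next
    case False
    define t' where "t' = t - 2 ^ i"
    have t: "t = 2 ^ i + t'" "t' \<le> 2 ^ i" using False Suc.prems(2) by (auto simp: t'_def)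
    have "{B * 2 ^ Suc i..<B * 2 ^ Suc i + t} =
        dyadic_block i (2 * B) \<union> {(2 * B + 1) * 2 ^ i..<(2 * B + 1) * 2 ^ i + t'}"
      unfolding dyadic_block_def t(1) by (auto simp: algebra_simps)
    moreover have "dyadic_block i (2 * B) \<inter> {(2 * B + 1) * 2 ^ i..<(2 * B + 1) * 2 ^ i + t'} = {}"
      unfolding dyadic_block_def by auto
    ultimately have "(\<Sum>n\<in>{B * 2 ^ Suc i..<B * 2 ^ Suc i + t}. g n) = (\<Sum>n\<in>dyadic_block i (2 * B). g n) +
        (\<Sum>n\<in>{(2 * B + 1) * 2 ^ i..<(2 * B + 1) * 2 ^ i + t'}. g n)"
      by (simp add: sum.union_disjoint dyadic_block_def)
    also have "norm \<dots> \<le> Z + (real i + 1) * Z"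
    proof (intro norm_triangle_le add_mono)
      show "norm (\<Sum>n\<in>dyadic_block i (2 * B). g n) \<le> Z"
        by (intro Suc.prems) (auto simp: Suc_diff_le)
      show "norm (\<Sum>n\<in>{(2 * B + 1) * 2 ^ i..<(2 * B + 1) * 2 ^ i + t'}. g n) \<le> (real i + 1) * Z"
        using half[of "2 * B + 1" t'] t by simp
    qed
    finally show ?thesis by (simp add: algebra_simps)
  qed
qed

text \<open>The ranges from \<open>2 ^ i\<close> to \<open>2 ^ (i + 1)\<close> are decomposed
  separately, so that the members of a block have ratios at most \<open>2\<close>, as the count with
  \<open>A = 2\<close> demands.\<close>

lemma norm_initial_sum_le:
  fixes g :: "nat \<Rightarrow> complex"
  assumes "\<And>i l b. \<lbrakk>i < k; l \<le> i; 2 ^ (i - l) \<le> b; b < 2 * 2 ^ (i - l)\<rbrakk> \<Longrightarrow>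
      norm (\<Sum>n\<in>dyadic_block l b. g n) \<le> Z"
    and "N \<le> 2 ^ k" and "Z \<ge> 0"
  shows "norm (\<Sum>n\<in>{1..<N}. g n) \<le> (real k)\<^sup>2 * Z"
  using assms
proof (induction k arbitrary: N)
  case 0
  then show ?case by simp
next
  case (Suc k)
  have IH: "norm (\<Sum>n\<in>{1..<N'}. g n) \<le> (real k)\<^sup>2 * Z" if "N' \<le> 2 ^ k" for N'
    using that by (intro Suc.IH Suc.prems) auto
  have mono: "(real k)\<^sup>2 * Z \<le> (real (Suc k))\<^sup>2 * Z"
    using Suc.prems(3) by (intro mult_right_mono power_mono) auto
  show ?case
  proof (cases "N \<le> 2 ^ k")
    case True
    then show ?thesis using IH mono by (meson order_trans)
  next
    case False
    define t where "t = N - 2 ^ k"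
    have t: "N = 2 ^ k + t" "t \<le> 2 ^ k" using False Suc.prems(2) by (auto simp: t_def)
    have "{1..<N} = {1..<2 ^ k} \<union> {1 * 2 ^ k..<1 * 2 ^ k + t}"
      using ivl_disj_un_two(3)[of 1 "2 ^ k" "2 ^ k + t"] t(1) by simp
    then have "(\<Sum>n\<in>{1..<N}. g n) = (\<Sum>n\<in>{1..<2 ^ k}. g n) + (\<Sum>n\<in>{1 * 2 ^ k..<1 * 2 ^ k + t}. g n)"
      by (simp add: sum.union_disjoint)
    also have "norm \<dots> \<le> (real k)\<^sup>2 * Z + (real k + 1) * Z"
    proof (intro norm_triangle_le add_mono IH norm_prefix_sum_le)
      fix l b :: nat assume "l \<le> k" "1 * 2 ^ (k - l) \<le> b" "b < (1 + 1) * 2 ^ (k - l)"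
      then show "norm (\<Sum>n\<in>dyadic_block l b. g n) \<le> Z" by (intro Suc.prems(1)[of k]) auto
    qed (use t Suc.prems in auto)
    also have "\<dots> \<le> (real (Suc k))\<^sup>2 * Z"
    proof -
      have "(real k)\<^sup>2 + (real k + 1) \<le> (real (Suc k))\<^sup>2" by (simp add: power2_eq_square algebra_simps)
      then have "((real k)\<^sup>2 + (real k + 1)) * Z \<le> (real (Suc k))\<^sup>2 * Z"
        using Suc.prems(3) by (intro mult_right_mono)
      then show ?thesis by (simp only: distrib_right)
    qed
    finally show ?thesis .
  qed
qed

section \<open>Large values and the Hausdorff dimension\<close>

lemma norm_e_unit_diff_le: "norm (e_unit x - e_unit y) \<le> 2 * pi * \<bar>x - y\<bar>"
proof -
  let ?t = "2 * pi * (x - y)"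
  have "e_unit x - e_unit y = e_unit y * (cis ?t - 1)"
    by (simp add: e_unit_cis cis_mult algebra_simps)
  then have "norm (e_unit x - e_unit y) = norm (cis ?t - 1)" by (simp add: norm_mult)
  moreover have "(norm (cis ?t - 1))\<^sup>2 \<le> \<bar>?t\<bar>\<^sup>2"
  proof -
    have "(norm (cis ?t - 1))\<^sup>2 = 2 - 2 * cos ?t"
      unfolding cmod_power2 using sin_cos_squared_add[of ?t] by (simp add: power2_eq_square algebra_simps)
    also have "\<dots> = 4 * (sin (?t / 2))\<^sup>2"
      using cos_double_sin[of "pi * (x - y)"] by (simp add: mult.assoc)
    also have "\<dots> = (2 * \<bar>sin (?t / 2)\<bar>)\<^sup>2" by (simp add: power_mult_distrib)
    also have "\<dots> \<le> (2 * \<bar>?t / 2\<bar>)\<^sup>2"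
      using abs_sin_x_le_abs_x[of "?t / 2"] by (intro power_mono) auto
    finally show ?thesis by (simp add: power_mult_distrib)
  qed
  then have "norm (cis ?t - 1) \<le> \<bar>?t\<bar>" by (rule power2_le_imp_le) simp
  ultimately show ?thesis by (simp add: abs_mult)
qed

lemma dyadic_block_subset:
  assumes "l \<le> i" "2 ^ (i - l) \<le> b" "b < 2 * 2 ^ (i - l)"
  shows "dyadic_block l b \<subseteq> {2 ^ i..<2 ^ (i + 1)}"
proof -
  have p: "2 ^ i = 2 ^ (i - l) * (2::nat) ^ l" using assms(1) by (simp flip: power_add)
  have "2 ^ (i - l) * 2 ^ l \<le> b * 2 ^ l" using assms(2) by simp
  moreover have "(b + 1) * 2 ^ l \<le> (2 * 2 ^ (i - l)) * 2 ^ l" using assms(3) by (intro mult_right_mono) auto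
  ultimately have "2 ^ i \<le> b * 2 ^ l" "(b + 1) * 2 ^ l \<le> 2 ^ (i + 1)" using p by (auto simp: mult.assoc)
  then show ?thesis unfolding dyadic_block_def by auto
qed

lemma dyadic_block_disjoint:
  assumes "b \<noteq> c"
  shows "dyadic_block l b \<inter> dyadic_block l c = {}"
proof -
  have "n div 2 ^ l = b" if "n \<in> dyadic_block l b" for n b
    using that by (intro div_nat_eqI) (auto simp: dyadic_block_def mult.commute)
  then show ?thesis using assms by blast
qed

lemma finite_dyadic_block: "finite (dyadic_block l b)"
  by (simp add: dyadic_block_def)

text \<open>Chebyshev's inequality for fourth powers. At a counted grid point the fourth powers of
  all block sums add up to at least \<open>Z ^ 4\<close>. For each of the at most
  \<open>k\<^sup>2\<close> pairs \<open>(i, l)\<close> the blocks are disjoint, so their moments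
  over the grid total at most \<open>Q\<close> times the energy of the range from
  \<open>2 ^ i\<close> to \<open>2 ^ (i + 1)\<close>.\<close>

lemma card_large_blocks:
  fixes \<tau> :: real and n :: nat
  assumes \<tau>: "\<tau> \<ge> 1" and n: "n \<ge> 1"
  obtains C where "C > 0" "\<And>k Q Z. \<lbrakk>Z \<ge> 0; real Q > 2 * (2 ^ k) powr \<tau>\<rbrakk> \<Longrightarrow>
     real (card {a\<in>{..<Q}. \<exists>i l b. i < k \<and> l \<le> i \<and> 2 ^ (i - l) \<le> b \<and> b < 2 * 2 ^ (i - l) \<and>
       Z \<le> norm (\<Sum>m\<in>dyadic_block l b. e_unit (real a / Q * \<lfloor>real m powr \<tau>\<rfloor>))}) * Z ^ 4
     \<le> C * real Q * (real k)\<^sup>2 * (2 ^ k) powr max (4 - \<tau>) (2 + 1 / real n)"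
proof -
  define F where "F m = \<lfloor>real m powr \<tau>\<rfloor>" for m :: nat
  define \<sigma> where "\<sigma> = max (4 - \<tau>) (2 + 1 / real n)"
  obtain C where C: "C > 0" and near: "\<And>i::nat. real (card (near_sols \<tau> 2 (2 ^ i) ((2 ^ i) powr \<tau> / 2))) \<le>
    C * (2 ^ i) powr \<sigma>"
    using card_near_sols_dyadic[OF \<tau> n] unfolding \<sigma>_def by metis
  have \<sigma>: "\<sigma> \<ge> 0" by (simp add: \<sigma>_def le_max_iff_disj)
  show ?thesis
  proof (rule that[OF C])
    fix k Q :: nat and Z :: real
    assume Z: "Z \<ge> 0" and Q: "real Q > 2 * (2 ^ k) powr \<tau>"
    have "2 * (2 ^ k) powr \<tau> \<ge> 0" by simp
    then have Q0: "Q > 0" using Q by (smt (verit) of_nat_0_less_iff)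
    define Bs where "Bs i l = {2 ^ (i - l)..<2 * (2::nat) ^ (i - l)}" for i l :: nat
    define N where "N a l b = (norm (\<Sum>m\<in>dyadic_block l b. e_unit (real a / Q * F m))) ^ 4" for a l b
    define Bad where "Bad = {a\<in>{..<Q}. \<exists>i l b. i < k \<and> l \<le> i \<and> 2 ^ (i - l) \<le> b \<and> b < 2 * 2 ^ (i - l) \<and>
       Z \<le> norm (\<Sum>m\<in>dyadic_block l b. e_unit (real a / Q * F m))}"
    have N0: "N a l b \<ge> 0" for a l b by (simp add: N_def)
    have bad: "Z ^ 4 \<le> (\<Sum>i<k. \<Sum>l\<le>i. \<Sum>b\<in>Bs i l. N a l b)" if "a \<in> Bad" for a
    proof -
      obtain i l b where ilb: "i < k" "l \<le> i" "2 ^ (i - l) \<le> b" "b < 2 * 2 ^ (i - l)"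
        and le: "Z \<le> norm (\<Sum>m\<in>dyadic_block l b. e_unit (real a / Q * F m))"
        using \<open>a \<in> Bad\<close> unfolding Bad_def by blast
      have "Z ^ 4 \<le> N a l b" unfolding N_def using le Z by (intro power_mono) auto
      also have "\<dots> \<le> (\<Sum>b\<in>Bs i l. N a l b)"
        using ilb N0 by (intro member_le_sum) (auto simp: Bs_def)
      also have "\<dots> \<le> (\<Sum>l\<le>i. \<Sum>b\<in>Bs i l. N a l b)"
        using ilb N0 by (intro member_le_sum[of l "{..i}" "\<lambda>l. \<Sum>b\<in>Bs i l. N a l b"]) (auto intro: sum_nonneg)
      also have "\<dots> \<le> (\<Sum>i<k. \<Sum>l\<le>i. \<Sum>b\<in>Bs i l. N a l b)"
        using ilb N0 by (intro member_le_sum[of i "{..<k}" "\<lambda>i. \<Sum>l\<le>i. \<Sum>b\<in>Bs i l. N a l b"]) (auto intro!: sum_nonneg)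
      finally show ?thesis .
    qed
    have level: "(\<Sum>b\<in>Bs i l. \<Sum>a<Q. N a l b) \<le> real Q * (C * (2 ^ k) powr \<sigma>)" if "i < k" "l \<le> i" for i l
    proof -
      have Qi: "real Q > 2 * (2 ^ (i + 1)) powr \<tau>"
      proof -
        have "(2::real) ^ (i + 1) \<le> 2 ^ k" using that by (intro power_increasing) auto
        then have "((2::real) ^ (i + 1)) powr \<tau> \<le> (2 ^ k) powr \<tau>" using \<tau> by (intro powr_mono2) auto
        then show ?thesis using Q by linarith
      qed
      have "(\<Sum>b\<in>Bs i l. \<Sum>a<Q. N a l b) = (\<Sum>b\<in>Bs i l. real Q * real (card (pair_energy F Q (dyadic_block l b))))"
        unfolding N_def by (intro sum.cong refl discrete_fourth_moment finite_dyadic_block Q0)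
      also have "\<dots> = real Q * real (\<Sum>b\<in>Bs i l. card (pair_energy F Q (dyadic_block l b)))"
        by (simp only: sum_distrib_left[symmetric] of_nat_sum)
      also have "\<dots> \<le> real Q * real (card (pair_energy F Q {2 ^ i..<2 ^ (i + 1)}))"
      proof (intro mult_left_mono)
        have "(\<Sum>b\<in>Bs i l. card (pair_energy F Q (dyadic_block l b))) \<le> card (pair_energy F Q {2 ^ i..<2 ^ (i + 1)})"
        proof (rule card_pair_energy_disjoint)
          show "dyadic_block l b \<subseteq> {2 ^ i..<2 ^ (i + 1)}" if "b \<in> Bs i l" for b
            using that \<open>l \<le> i\<close> by (intro dyadic_block_subset) (auto simp: Bs_def)
          show "dyadic_block l b \<inter> dyadic_block l c = {}" if "b \<noteq> c" for b c
            using that by (rule dyadic_block_disjoint)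
        qed (auto simp: Bs_def)
        then show "real (\<Sum>b\<in>Bs i l. card (pair_energy F Q (dyadic_block l b))) \<le> real (card (pair_energy F Q {2 ^ i..<2 ^ (i + 1)}))"
          by (simp only: of_nat_le_iff)
      qed simp
      also have "\<dots> \<le> real Q * (C * (2 ^ k) powr \<sigma>)"
      proof (intro mult_left_mono)
        have "real (card (pair_energy F Q {2 ^ i..<2 ^ (i + 1)})) \<le> real (card (near_sols \<tau> 2 (2 ^ i) ((2 ^ i) powr \<tau> / 2)))"
          using card_pair_energy_le_near_sols[OF \<tau> Qi] unfolding F_def[abs_def] of_nat_le_iff .
        also have "\<dots> \<le> C * (2 ^ i) powr \<sigma>" by (rule near)
        also have "\<dots> \<le> C * (2 ^ k) powr \<sigma>"
          using C \<sigma> that by (intro mult_left_mono powr_mono2 power_increasing) auto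
        finally show "real (card (pair_energy F Q {2 ^ i..<2 ^ (i + 1)})) \<le> C * (2 ^ k) powr \<sigma>" .
      qed simp
      finally show ?thesis .
    qed
    have "real (card Bad) * Z ^ 4 = (\<Sum>a\<in>Bad. Z ^ 4)" by simp
    also have "\<dots> \<le> (\<Sum>a\<in>Bad. \<Sum>i<k. \<Sum>l\<le>i. \<Sum>b\<in>Bs i l. N a l b)" by (intro sum_mono bad)
    also have "\<dots> \<le> (\<Sum>a<Q. \<Sum>i<k. \<Sum>l\<le>i. \<Sum>b\<in>Bs i l. N a l b)"
      using N0 by (intro sum_mono2) (auto simp: Bad_def intro!: sum_nonneg)
    also have "\<dots> = (\<Sum>i<k. \<Sum>a<Q. \<Sum>l\<le>i. \<Sum>b\<in>Bs i l. N a l b)" by (rule sum.swap)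
    also have "\<dots> = (\<Sum>i<k. \<Sum>l\<le>i. \<Sum>a<Q. \<Sum>b\<in>Bs i l. N a l b)" by (rule sum.cong[OF refl], rule sum.swap)
    also have "\<dots> = (\<Sum>i<k. \<Sum>l\<le>i. \<Sum>b\<in>Bs i l. \<Sum>a<Q. N a l b)"
      by (rule sum.cong[OF refl], rule sum.cong[OF refl], rule sum.swap)
    also have "\<dots> \<le> (\<Sum>i<k. \<Sum>l\<le>i. real Q * (C * (2 ^ k) powr \<sigma>))"
      by (intro sum_mono level) auto
    also have "\<dots> \<le> (\<Sum>i<k. real k * (real Q * (C * (2 ^ k) powr \<sigma>)))"
    proof (rule sum_mono)
      fix i assume "i \<in> {..<k}"
      then have "real (card {..i}) \<le> real k" by simp
      moreover have "0 \<le> real Q * (C * (2 ^ k) powr \<sigma>)" using C by simp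
      ultimately have "real (card {..i}) * (real Q * (C * (2 ^ k) powr \<sigma>)) \<le> real k * (real Q * (C * (2 ^ k) powr \<sigma>))"
        by (rule mult_right_mono)
      then show "(\<Sum>l\<le>i. real Q * (C * (2 ^ k) powr \<sigma>)) \<le> real k * (real Q * (C * (2 ^ k) powr \<sigma>))"
        by (simp only: sum_constant)
    qed
    also have "\<dots> = C * real Q * (real k)\<^sup>2 * (2 ^ k) powr \<sigma>"
      by (simp add: power2_eq_square mult_ac)
    finally show "real (card {a\<in>{..<Q}. \<exists>i l b. i < k \<and> l \<le> i \<and> 2 ^ (i - l) \<le> b \<and> b < 2 * 2 ^ (i - l) \<and>
       Z \<le> norm (\<Sum>m\<in>dyadic_block l b. e_unit (real a / Q * \<lfloor>real m powr \<tau>\<rfloor>))}) * Z ^ 4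
     \<le> C * real Q * (real k)\<^sup>2 * (2 ^ k) powr max (4 - \<tau>) (2 + 1 / real n)" 
      unfolding Bad_def F_def \<sigma>_def .
  qed
qed

text \<open>A large initial sum forces a large block sum at \<open>x\<close>. A block sum has
  Lipschitz constant at most \<open>2 * pi * (2 ^ k) powr (\<tau> + 1)\<close>, so at this mesh
  moving to the left grid point loses at most half of \<open>Z\<close>.\<close>

lemma large_sum_near_grid:
  fixes \<tau> :: real and f :: "nat \<Rightarrow> real" and Q k N :: nat
  assumes \<tau>: "\<tau> \<ge> 1" and f: "\<And>n. n \<ge> 1 \<Longrightarrow> f n = real_of_int \<lfloor>real n powr \<tau>\<rfloor>"
    and Z: "Z > 0" and Q: "real Q \<ge> 16 * ((2 ^ k) powr (\<tau> + 1) / Z)" and N: "N < 2 ^ k"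
    and x: "x \<in> {0..1}" and large: "norm (exp_sum f x N) \<ge> 2 * (real k)\<^sup>2 * Z" and k: "k \<ge> 1"
  shows "\<exists>a\<in>{a\<in>{..<Q}. \<exists>i l b. i < k \<and> l \<le> i \<and> 2 ^ (i - l) \<le> b \<and> b < 2 * 2 ^ (i - l) \<and>
       Z / 2 \<le> norm (\<Sum>m\<in>dyadic_block l b. e_unit (real a / Q * \<lfloor>real m powr \<tau>\<rfloor>))}.
       x \<in> {real a / Q..(real a + 1) / Q}"
proof -
  have "(2 ^ k) powr (\<tau> + 1) / Z > 0" using Z by simp
  then have Q0: "real Q > 0" using Q by linarith
  have sum_eq: "exp_sum f x N = (\<Sum>n\<in>{1..<N + 1}. e_unit (x * \<lfloor>real n powr \<tau>\<rfloor>))"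
    unfolding exp_sum_def using f by (intro sum.cong) auto
  have "\<exists>i l b. i < k \<and> l \<le> i \<and> 2 ^ (i - l) \<le> b \<and> b < 2 * 2 ^ (i - l) \<and>
      Z < norm (\<Sum>m\<in>dyadic_block l b. e_unit (x * \<lfloor>real m powr \<tau>\<rfloor>))"
  proof (rule ccontr)
    assume "\<not> ?thesis"
    then have small: "norm (\<Sum>m\<in>dyadic_block l b. e_unit (x * \<lfloor>real m powr \<tau>\<rfloor>)) \<le> Z"
      if "i < k" "l \<le> i" "2 ^ (i - l) \<le> b" "b < 2 * 2 ^ (i - l)" for i l b
      using that not_less by blast
    have "norm (\<Sum>n\<in>{1..<N + 1}. e_unit (x * \<lfloor>real n powr \<tau>\<rfloor>)) \<le> (real k)\<^sup>2 * Z"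
      by (rule norm_initial_sum_le[OF small]) (use N Z in auto)
    moreover have "(real k)\<^sup>2 * Z < 2 * (real k)\<^sup>2 * Z" using Z k by simp
    ultimately show False using large unfolding sum_eq by linarith
  qed
  then obtain i l b where ilb: "i < k" "l \<le> i" "2 ^ (i - l) \<le> b" "b < 2 * 2 ^ (i - l)"
    and big: "Z < norm (\<Sum>m\<in>dyadic_block l b. e_unit (x * \<lfloor>real m powr \<tau>\<rfloor>))" by blast
  have near: "\<exists>a<Q. x \<in> {real a / Q..(real a + 1) / Q}"
  \<comment> \<open>The right endpoint must be put into the last interval, since rounding down would
    give \<open>a = Q\<close>.\<close>
  proof (cases "x = 1")
    case True
    then show ?thesis using Q0 by (intro exI[of _ "Q - 1"]) (auto simp: of_nat_diff)
  next
    case False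
    define a where "a = nat \<lfloor>x * Q\<rfloor>"
    have "x * Q \<ge> 0" "x * Q < Q" using x False Q0 by auto
    then have "real a \<le> x * Q" "x * Q < real a + 1" "a < Q"
      unfolding a_def by (auto simp: nat_less_iff floor_less_iff of_nat_nat)
    then show ?thesis using Q0 by (intro exI[of _ a]) (auto simp: field_simps)
  qed
  then obtain a where a: "a < Q" "x \<in> {real a / Q..(real a + 1) / Q}" by blast
  have dist: "\<bar>real a / Q - x\<bar> \<le> 1 / Q" using a(2) by (auto simp: add_divide_distrib)
  let ?W = "dyadic_block l b"
  let ?F = "\<lambda>m::nat. real_of_int \<lfloor>real m powr \<tau>\<rfloor>"
  have sub: "?W \<subseteq> {2 ^ i..<2 ^ (i + 1)}" using ilb by (intro dyadic_block_subset)
  have le: "(2::nat) ^ (i + 1) \<le> 2 ^ k" using ilb(1) by (intro power_increasing) auto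
  have "norm ((\<Sum>m\<in>?W. e_unit (real a / Q * ?F m)) - (\<Sum>m\<in>?W. e_unit (x * ?F m))) \<le>
      (\<Sum>m\<in>?W. norm (e_unit (real a / Q * ?F m) - e_unit (x * ?F m)))"
    unfolding sum_subtractf[symmetric] by (rule norm_sum)
  also have "\<dots> \<le> (\<Sum>m\<in>?W. 2 * pi * (1 / Q * (2 ^ k) powr \<tau>))"
  proof (rule sum_mono)
    fix m assume "m \<in> ?W"
    then have "m < 2 ^ k" using sub le by auto
    then have "real m < real (2 ^ k)" by (simp only: of_nat_less_iff)
    then have "real m powr \<tau> \<le> (2 ^ k) powr \<tau>" using \<tau> by (intro powr_mono2) auto
    then have Fm: "\<bar>?F m\<bar> \<le> (2 ^ k) powr \<tau>" 
      using order_trans[OF of_int_floor_le[of "real m powr \<tau>"]] by simp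
    have "norm (e_unit (real a / Q * ?F m) - e_unit (x * ?F m)) \<le> 2 * pi * \<bar>real a / Q * ?F m - x * ?F m\<bar>"
      by (rule norm_e_unit_diff_le)
    also have "\<bar>real a / Q * ?F m - x * ?F m\<bar> = \<bar>real a / Q - x\<bar> * \<bar>?F m\<bar>"
      by (simp only: left_diff_distrib[symmetric] abs_mult)
    also have "2 * pi * (\<bar>real a / Q - x\<bar> * \<bar>?F m\<bar>) \<le> 2 * pi * (1 / Q * (2 ^ k) powr \<tau>)"
      using dist Fm by (intro mult_left_mono mult_mono) auto
    finally show "norm (e_unit (real a / Q * ?F m) - e_unit (x * ?F m)) \<le> 2 * pi * (1 / Q * (2 ^ k) powr \<tau>)" .
  qed
  also have "\<dots> = real (card ?W) * (2 * pi * (1 / Q * (2 ^ k) powr \<tau>))" by simp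
  \<comment> \<open>The \<open>16\<close> in the lower bound for \<open>Q\<close> comes from here:
    \<open>2 * pi \<le> 8\<close>, doubled to reach \<open>Z / 2\<close>.\<close>
  also have "\<dots> \<le> 2 ^ k * (8 * (1 / Q * (2 ^ k) powr \<tau>))"
  proof (intro mult_mono)
    have "?W \<subseteq> {..<2 ^ k}" using sub le by auto
    then have "card ?W \<le> card {..<(2::nat) ^ k}" by (intro card_mono) auto
    then have "real (card ?W) \<le> real (2 ^ k)" by (simp only: of_nat_le_iff card_lessThan)
    then show "real (card ?W) \<le> 2 ^ k" by simp
    show "2 * pi \<le> 8" using pi_less_4 by simp
  qed auto
  also have "\<dots> = 8 * (2 ^ k) powr (\<tau> + 1) / Q"
    by (simp add: powr_add)
  also have "\<dots> \<le> Z / 2"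
    using Q Q0 Z by (simp add: field_simps)
  finally have "norm (\<Sum>m\<in>?W. e_unit (x * ?F m)) \<le> norm (\<Sum>m\<in>?W. e_unit (real a / Q * ?F m)) + Z / 2"
    using norm_triangle_sub[of "\<Sum>m\<in>?W. e_unit (x * ?F m)" "\<Sum>m\<in>?W. e_unit (real a / Q * ?F m)"]
    unfolding norm_minus_commute[of "\<Sum>m\<in>?W. e_unit (x * ?F m)"] by linarith
  then have "Z / 2 \<le> norm (\<Sum>m\<in>?W. e_unit (real a / Q * ?F m))" using big by linarith
  then show ?thesis using a ilb by blast
qed

text \<open>The convergence half of the Borel-Cantelli lemma for Hausdorff measures: for every
  \<open>K\<close> the intervals of index at least \<open>K\<close> cover \<open>A\<close>, their
  lengths become arbitrarily small, and the tails of the series tend to \<open>0\<close>.\<close>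

lemma hausdorff_measure_limsup_eq_0:
  fixes A :: "real set" and Q :: "nat \<Rightarrow> nat" and Bad :: "nat \<Rightarrow> nat set"
  assumes s: "s > 0" and Q: "\<And>k. Q k > 0" and fin: "\<And>k. finite (Bad k)"
    and cover: "\<And>x K. x \<in> A \<Longrightarrow> \<exists>k\<ge>K. \<exists>a\<in>Bad k. x \<in> {real a / Q k..(real a + 1) / Q k}"
    and lim: "(\<lambda>k. 1 / real (Q k)) \<longlonglongrightarrow> 0"
    and summ: "summable (\<lambda>k. real (card (Bad k)) * (1 / real (Q k)) powr s)"
  shows "hausdorff_measure s A = 0"
proof -
  define t where "t k = real (card (Bad k)) * (1 / real (Q k)) powr s" for k
  have t0: "t k \<ge> 0" for k by (simp add: t_def)
  have "hausdorff_premeasure s \<delta> A \<le> 0" if \<delta>: "\<delta> > 0" for \<delta>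
  proof (rule ennreal_le_epsilon)
    fix e :: real assume e: "0 < e"
    obtain K1 where K1: "\<And>k. k \<ge> K1 \<Longrightarrow> 1 / real (Q k) < \<delta>"
      using order_tendstoD(2)[OF lim \<delta>] unfolding eventually_sequentially by blast
    obtain K2 where K2: "\<And>n. n \<ge> K2 \<Longrightarrow> norm (\<Sum>i. t (i + n)) < e"
      using suminf_exist_split[OF e summ[folded t_def]] by blast
    define K where "K = max K1 K2"
    have summ': "summable (\<lambda>k. if k \<ge> K then t k else 0)"
      by (rule summable_comparison_test'[OF summ[folded t_def], of 0]) (simp add: t0)
    define g where "g ka = (if fst ka \<ge> K \<and> snd ka \<in> Bad (fst ka) then ennreal ((1 / real (Q (fst ka))) powr s) else 0)" for ka
    \<comment> \<open>A cover is a single sequence, so the pairs \<open>(k, a)\<close> are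
      enumerated by \<open>prod_decode\<close>. Surplus indices carry the empty set, for which
      \<open>diam_pow\<close> is \<open>0\<close>.\<close>
    define U where "U i = (let ka = prod_decode i in if fst ka \<ge> K \<and> snd ka \<in> Bad (fst ka)
        then {real (snd ka) / Q (fst ka)..(real (snd ka) + 1) / Q (fst ka)} else {})" for i
    have diam: "diameter {real a / Q k..(real a + 1) / Q k} = 1 / Q k" for a k
      by (subst diameter_closed_interval) (auto simp: add_divide_distrib divide_right_mono)
    have dU: "diam_pow s (U i) = g (prod_decode i)" for i
    proof -
      have "{real a / Q k..(real a + 1) / Q k} \<noteq> {}" for a k
        by (simp add: divide_right_mono)
      then show ?thesis using s diam unfolding U_def g_def diam_pow_def Let_def by (simp del: diameter_closed_interval)
    qed
    have "U \<in> delta_covers \<delta> A"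
      unfolding delta_covers_def mem_Collect_eq
    proof (intro conjI allI subsetI)
      fix x assume "x \<in> A"
      then obtain k a where ka: "k \<ge> K" "a \<in> Bad k" "x \<in> {real a / Q k..(real a + 1) / Q k}" using cover by blast
      then have "x \<in> U (prod_encode (k, a))" by (simp add: U_def)
      then show "x \<in> (\<Union>i. U i)" by blast
    next
      fix i show "bounded (U i)" by (auto simp: U_def Let_def)
      show "diameter (U i) \<le> \<delta>"
        using K1[of "fst (prod_decode i)"] \<delta> diam by (auto simp: U_def Let_def K_def simp del: diameter_closed_interval)
    qed
    then have "hausdorff_premeasure s \<delta> A \<le> (\<Sum>i. diam_pow s (U i))"
      unfolding hausdorff_premeasure_def by (rule INF_lower)
    also have "\<dots> = (\<Sum>i. g (prod_decode i))" by (simp only: dU)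
    also have "\<dots> = (\<Sum>k. \<Sum>a. g (k, a))"
      by (rule suminf_ennreal_2dimen) simp
    also have "\<dots> = (\<Sum>k. ennreal (if k \<ge> K then t k else 0))"
    proof (rule suminf_cong)
      fix k
      have "(\<Sum>a. g (k, a)) = (\<Sum>a\<in>Bad k. g (k, a))"
        using fin by (intro suminf_finite) (auto simp: g_def)
      also have "\<dots> = (\<Sum>a\<in>Bad k. ennreal (if k \<ge> K then (1 / real (Q k)) powr s else 0))"
        by (intro sum.cong) (auto simp: g_def)
      also have "\<dots> = ennreal (\<Sum>a\<in>Bad k. (if k \<ge> K then (1 / real (Q k)) powr s else 0))"
        by (rule sum_ennreal) auto
      also have "(\<Sum>a\<in>Bad k. (if k \<ge> K then (1 / real (Q k)) powr s else 0)) = (if k \<ge> K then t k else 0)"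
        by (simp add: t_def)
      finally show "(\<Sum>a. g (k, a)) = ennreal (if k \<ge> K then t k else 0)" .
    qed
    also have "\<dots> = ennreal (\<Sum>k. if k \<ge> K then t k else 0)"
    proof (rule suminf_ennreal2)
      show "summable (\<lambda>k. if k \<ge> K then t k else 0)"
        by (rule summ')
    qed (use t0 in auto)
    also have "(\<Sum>k. if k \<ge> K then t k else 0) = (\<Sum>i. t (i + K))"
    proof -
      have "summable (\<lambda>k. if k \<ge> K then t k else 0)"
        by (rule summ')
      from suminf_split_initial_segment[OF this, of K] show ?thesis by simp
    qed
    also have "ennreal (\<Sum>i. t (i + K)) \<le> ennreal e"
      using K2[of K] by (intro ennreal_leI) (simp add: K_def)
    finally show "hausdorff_premeasure s \<delta> A \<le> 0 + ennreal e" by simp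
  qed
  then have "hausdorff_measure s A \<le> 0" unfolding hausdorff_measure_def by (intro SUP_least) auto
  then show ?thesis by simp
qed

text \<open>Split \<open>r\<close> into two equal factors \<open>q ^ d\<close>. One of them turns
  \<open>k ^ d\<close> into the bounded \<open>(k * q ^ k) ^ d\<close>, the other leaves a geometric
  series.\<close>

lemma summable_power_times_geometric:
  fixes r :: real and d :: nat
  assumes "0 < r" "r < 1" and d: "d > 0"
  shows "summable (\<lambda>k. real k ^ d * r ^ k)"
proof -
  define q where "q = r powr (1 / (2 * real d))"
  have q: "0 < q" "q < 1"
    using assms powr_less_mono2[of "1 / (2 * real d)" r 1] by (auto simp: q_def)
  have rq: "r = q ^ d * q ^ d"
  proof -
    have "q ^ d = r powr (1/2)" using assms by (simp add: q_def powr_realpow[symmetric] powr_powr)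
    then show ?thesis using assms by (simp add: powr_add[symmetric])
  qed
  have "(\<lambda>n. real n * q ^ n) \<longlonglongrightarrow> 0" using powser_times_n_limit_0[of q] q by simp
  then have "Bseq (\<lambda>n. real n * q ^ n)" by (rule convergent_imp_Bseq[OF convergentI])
  then obtain B where B: "B > 0" "\<forall>n. norm (real n * q ^ n) \<le> B" by (rule BseqE)
  show ?thesis
  proof (rule summable_comparison_test'[of "\<lambda>k. B ^ d * (q ^ d) ^ k" 0])
    have "q ^ d < 1" using q d by (simp add: power_less_one_iff)
    then show "summable (\<lambda>k. B ^ d * (q ^ d) ^ k)" using q by (intro summable_mult summable_geometric) auto
    fix k :: nat
    have "real k ^ d * r ^ k = (real k * q ^ k) ^ d * (q ^ d) ^ k"
      unfolding rq by (simp add: power_mult_distrib power_mult[symmetric] mult.commute)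
    also have "\<dots> \<le> B ^ d * (q ^ d) ^ k"
      using B(2)[rule_format, of k] q by (intro mult_right_mono power_mono) auto
    finally show "norm (real k ^ d * r ^ k) \<le> B ^ d * (q ^ d) ^ k" using assms by simp
  qed
qed

text \<open>At scale \<open>y = 2 ^ (m + 1)\<close>, up to powers of \<open>m + 1\<close>, the
  threshold \<open>Z\<close> is \<open>y powr \<alpha>\<close>, the grid size \<open>Q\<close> is
  \<open>y powr \<rho>\<close>, and at most \<open>Q * y powr (\<sigma> - 4 * \<alpha>)\<close>
  intervals are bad. The \<open>s\<close>-dimensional sum is thus
  \<open>y powr (- \<kappa>)\<close>. Since \<open>exponent\<close> is strict, there is room for the
  \<open>1 / n\<close> in \<open>\<sigma>\<close> and for the powers of
  \<open>m + 1\<close>.\<close>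

lemma hausdorff_measure_large_sum_set:
  fixes \<tau> \<alpha> s :: real and f :: "nat \<Rightarrow> real"
  assumes \<tau>: "\<tau> \<ge> 1" and f: "\<And>n. n \<ge> 1 \<Longrightarrow> f n = real_of_int \<lfloor>real n powr \<tau>\<rfloor>"
    and \<alpha>: "1/2 < \<alpha>" "\<alpha> < 1" and s: "s > 0"
    and exponent: "(1 - s) * (\<tau> + 1 - \<alpha>) + max (4 - \<tau>) 2 < 4 * \<alpha>"
  shows "hausdorff_measure s (large_sum_set f \<alpha>) = 0"
proof -
  define \<rho> where "\<rho> = \<tau> + 1 - \<alpha>"
  have \<rho>: "\<rho> > 0" using \<tau> \<alpha> by (simp add: \<rho>_def)
  have "4 * \<alpha> - max (4 - \<tau>) 2 - (1 - s) * \<rho> > 0" using exponent by (simp add: \<rho>_def)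
  then obtain n :: nat where n: "n > 0" "inverse (real n) < 4 * \<alpha> - max (4 - \<tau>) 2 - (1 - s) * \<rho>"
    using ex_inverse_of_nat_less by blast
  define \<sigma> where "\<sigma> = max (4 - \<tau>) (2 + 1 / real n)"
  define \<kappa> where "\<kappa> = 4 * \<alpha> - \<sigma> - (1 - s) * \<rho>"
  have \<kappa>: "\<kappa> > 0"
  proof -
    have "\<sigma> \<le> max (4 - \<tau>) 2 + 1 / real n" 
      using divide_nonneg_nonneg[of 1 "real n"] unfolding \<sigma>_def by linarith
    then show ?thesis using n(2) by (simp add: \<kappa>_def inverse_eq_divide)
  qed
  have n1: "n \<ge> 1" using n by simp
  obtain C where C: "C > 0" and count: "\<And>k Q Z. \<lbrakk>Z \<ge> 0; real Q > 2 * (2 ^ k) powr \<tau>\<rbrakk> \<Longrightarrow>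
     real (card {a\<in>{..<Q}. \<exists>i l b. i < k \<and> l \<le> i \<and> 2 ^ (i - l) \<le> b \<and> b < 2 * 2 ^ (i - l) \<and>
       Z \<le> norm (\<Sum>m\<in>dyadic_block l b. e_unit (real a / Q * \<lfloor>real m powr \<tau>\<rfloor>))}) * Z ^ 4
     \<le> C * real Q * (real k)\<^sup>2 * (2 ^ k) powr \<sigma>"
    by (rule card_large_blocks[OF \<tau> n1, folded \<sigma>_def]) (rule that)
  define y :: "nat \<Rightarrow> real" where "y m = 2 ^ (m + 1)" for m
  define k :: "nat \<Rightarrow> real" where "k m = real (m + 1)" for m
  have y: "y m \<ge> 1" "y m > 0" for m unfolding y_def by (rule one_le_power, simp, simp)
  have k: "k m \<ge> 1" "k m > 0" for m unfolding k_def by simp_all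
  \<comment> \<open>Yields \<open>2 * (k m)\<^sup>2 * Z m = (2 ^ m) powr \<alpha>\<close>: the scale
    \<open>y m\<close> is the upper end of the dyadic range of \<open>N\<close>, while
    \<open>N\<close> may be as small as \<open>2 ^ m\<close>.\<close>
  define c where "c = 1 / (2 * 2 powr \<alpha>)"
  have c: "0 < c" "c \<le> 1"
  proof -
    show "0 < c" by (simp add: c_def)
    have "2 powr \<alpha> \<ge> 1" using \<alpha> by (intro ge_one_powr_ge_zero) auto
    then show "c \<le> 1" by (simp add: c_def)
  qed
  define Z where "Z m = c * y m powr \<alpha> / (k m)\<^sup>2" for m
  define V where "V m = y m powr (\<tau> + 1) / Z m" for m
  \<comment> \<open>The \<open>16\<close> is the mesh condition for passing to grid points. As
    \<open>V m \<ge> y m powr \<tau>\<close>, it also ensures that the modulus exceeds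
    \<open>2 * y m powr \<tau>\<close>, as the fourth moment bound requires.\<close>
  define Q where "Q m = nat \<lceil>16 * V m\<rceil>" for m
  define Bad where "Bad m = {a\<in>{..<Q m}. \<exists>i l b. i < m + 1 \<and> l \<le> i \<and> 2 ^ (i - l) \<le> b \<and> b < 2 * 2 ^ (i - l) \<and>
       Z m / 2 \<le> norm (\<Sum>j\<in>dyadic_block l b. e_unit (real a / Q m * \<lfloor>real j powr \<tau>\<rfloor>))}" for m
  have Z: "Z m > 0" for m using c y[of m] k[of m] by (simp add: Z_def)
  have V: "V m \<ge> y m powr \<tau>" "V m \<ge> y m" for m
  proof -
    have "Z m \<le> y m"
    proof -
      have "(k m)\<^sup>2 \<ge> 1" using k[of m] by simp
      have "Z m \<le> c * y m powr \<alpha> / 1" unfolding Z_def using \<open>(k m)\<^sup>2 \<ge> 1\<close> c by (intro divide_left_mono) auto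
      also have "\<dots> \<le> 1 * y m powr 1" using c \<alpha> y[of m] by (simp only: div_by_1) (intro mult_mono powr_mono; simp)
      finally show ?thesis using y[of m] by simp
    qed
    then have "y m powr (\<tau> + 1) / y m \<le> V m" unfolding V_def using Z[of m] y[of m] by (intro divide_left_mono) auto
    moreover have "y m powr (\<tau> + 1) / y m = y m powr \<tau>" using y[of m] by (simp add: powr_add)
    ultimately show 1: "V m \<ge> y m powr \<tau>" by simp
    have "y m powr 1 \<le> y m powr \<tau>" using \<tau> y[of m] by (intro powr_mono) auto
    then show "V m \<ge> y m" using 1 y[of m] by simp
  qed
  have V0: "V m \<ge> 1" "V m > 0" for m using V(2)[of m] y(1)[of m] by linarith+
  have Qb: "real (Q m) \<ge> 16 * V m" "real (Q m) \<le> 32 * V m" for m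
    using V0[of m] unfolding Q_def by linarith+
  have Q0: "Q m > 0" for m using Qb(1)[of m] V0[of m] by (smt (verit) of_nat_0_less_iff)
  have Qt: "real (Q m) > 2 * (2 ^ (m + 1)) powr \<tau>" for m
    using Qb(1)[of m] V(1)[of m] V0[of m] unfolding y_def by linarith
  define E where "E = 16 * C * (16 powr (1 - s) + 32 powr (1 - s)) * c powr (s - 1) / c ^ 4"
  define r where "r = 2 powr (- \<kappa>)"
  have r: "0 < r" "r < 1"
    using \<kappa> powr_less_mono[of "- \<kappa>" 0 2] by (auto simp: r_def)
  have term_le: "real (card (Bad m)) * (1 / real (Q m)) powr s \<le> E * ((k m) ^ 12 * r ^ (m + 1))" for m
  proof -
    have "real (card (Bad m)) * (Z m / 2) ^ 4 \<le> C * real (Q m) * (k m)\<^sup>2 * y m powr \<sigma>"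
      using count[of "Z m / 2" "m + 1" "Q m"] Z[of m] Qt[of m] unfolding Bad_def y_def k_def by simp
    then have "real (card (Bad m)) \<le> C * real (Q m) * (k m)\<^sup>2 * y m powr \<sigma> / (Z m / 2) ^ 4"
      using Z[of m] by (simp add: le_divide_eq)
    then have "real (card (Bad m)) * (1 / real (Q m)) powr s \<le>
        C * real (Q m) * (k m)\<^sup>2 * y m powr \<sigma> / (Z m / 2) ^ 4 * (1 / real (Q m)) powr s"
      by (intro mult_right_mono) auto
    also have "\<dots> = 16 * C * (k m)\<^sup>2 * y m powr \<sigma> / (Z m) ^ 4 * (real (Q m) powr (1 - s))"
    proof -
      have "real (Q m) * (1 / real (Q m)) powr s = real (Q m) powr (1 - s)"
        using Q0[of m] by (simp add: powr_diff powr_divide)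
      then show ?thesis by (simp add: power_divide mult_ac)
    qed
    \<comment> \<open>\<open>Q m\<close> lies between \<open>16 * V m\<close> and
      \<open>32 * V m\<close>; the sum of the two constants covers both signs of
      \<open>1 - s\<close>.\<close>
    also have "\<dots> \<le> 16 * C * (k m)\<^sup>2 * y m powr \<sigma> / (Z m) ^ 4 * ((16 powr (1 - s) + 32 powr (1 - s)) * V m powr (1 - s))"
    proof (rule mult_left_mono)
      have "real (Q m) powr (1 - s) \<le> max ((16 * V m) powr (1 - s)) ((32 * V m) powr (1 - s))"
      proof (cases "s \<le> 1")
        case True
        then have "real (Q m) powr (1 - s) \<le> (32 * V m) powr (1 - s)" using Qb[of m] by (intro powr_mono2) auto
        then show ?thesis by simp
      next
        case False
        then have "real (Q m) powr (1 - s) \<le> (16 * V m) powr (1 - s)" using Qb[of m] V0[of m] by (intro powr_mono2') auto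
        then show ?thesis by simp
      qed
      also have "\<dots> \<le> (16 * V m) powr (1 - s) + (32 * V m) powr (1 - s)" by (auto simp: max_def)
      also have "\<dots> = (16 powr (1 - s) + 32 powr (1 - s)) * V m powr (1 - s)"
        using V0[of m] by (simp add: powr_mult distrib_right)
      finally show "real (Q m) powr (1 - s) \<le> (16 powr (1 - s) + 32 powr (1 - s)) * V m powr (1 - s)" .
    qed (use C k[of m] y[of m] Z[of m] in \<open>auto intro!: divide_nonneg_nonneg mult_nonneg_nonneg\<close>)
    also have "\<dots> \<le> E * ((k m) ^ 12 * y m powr (- \<kappa>))"
    proof -
      have Vs: "V m powr (1 - s) \<le> c powr (s - 1) * (y m powr (\<rho> * (1 - s)) * (k m)\<^sup>2)"
      proof -
        have "V m = (y m powr \<rho> * (k m)\<^sup>2) / c"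
          using c y[of m] k[of m] unfolding V_def Z_def \<rho>_def by (simp add: powr_diff powr_add field_simps)
        then have "V m powr (1 - s) = (y m powr (\<rho> * (1 - s)) * ((k m)\<^sup>2) powr (1 - s)) / c powr (1 - s)"
          using c y[of m] k[of m] by (simp add: powr_divide powr_mult powr_powr)
        also have "\<dots> = c powr (s - 1) * (y m powr (\<rho> * (1 - s)) * ((k m)\<^sup>2) powr (1 - s))"
          using c powr_minus_divide[of c "1 - s"] by simp
        also have "\<dots> \<le> c powr (s - 1) * (y m powr (\<rho> * (1 - s)) * ((k m)\<^sup>2) powr 1)"
          using k[of m] s by (intro mult_left_mono powr_mono) auto
        finally show ?thesis using k[of m] by simp
      qed
      have Z4: "(Z m) ^ 4 = c ^ 4 * y m powr (4 * \<alpha>) / (k m) ^ 8"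
      proof -
        have "(y m powr \<alpha>) ^ 4 = y m powr (4 * \<alpha>)"
          using y[of m] by (simp add: powr_realpow[symmetric] powr_powr mult.commute)
        then show ?thesis by (simp add: Z_def power_divide power_mult_distrib power_mult[symmetric])
      qed
      have "16 * C * (k m)\<^sup>2 * y m powr \<sigma> / (Z m) ^ 4 * ((16 powr (1 - s) + 32 powr (1 - s)) * V m powr (1 - s))
         \<le> 16 * C * (k m)\<^sup>2 * y m powr \<sigma> / (Z m) ^ 4 * ((16 powr (1 - s) + 32 powr (1 - s)) *
           (c powr (s - 1) * (y m powr (\<rho> * (1 - s)) * (k m)\<^sup>2)))"
        using Vs C k[of m] y[of m] Z[of m] by (intro mult_left_mono) (auto intro!: divide_nonneg_nonneg mult_nonneg_nonneg)
      also have "\<dots> = 16 * C * (16 powr (1 - s) + 32 powr (1 - s)) * c powr (s - 1) / c ^ 4 *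
          ((k m)\<^sup>2 * (k m) ^ 8 * (k m)\<^sup>2 * (y m powr \<sigma> / y m powr (4 * \<alpha>) * y m powr (\<rho> * (1 - s))))"
        unfolding Z4 by (simp add: mult_ac)
      \<comment> \<open>The exponent \<open>12\<close> collects \<open>2\<close> from the number of
        pairs of levels, \<open>8\<close> from \<open>Z ^ 4\<close>, and \<open>2\<close> from
        \<open>V powr (1 - s)\<close>, where \<open>k m \<ge> 1\<close> and \<open>s > 0\<close>
        allow \<open>1 - s\<close> to be replaced by \<open>1\<close>.\<close>
      also have "(k m)\<^sup>2 * (k m) ^ 8 * (k m)\<^sup>2 = (k m) ^ 12" by (simp flip: power_add)
      also have "y m powr \<sigma> / y m powr (4 * \<alpha>) * y m powr (\<rho> * (1 - s)) = y m powr (- \<kappa>)"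
        unfolding \<kappa>_def powr_diff[symmetric] powr_add[symmetric] by (simp add: algebra_simps)
      also have "16 * C * (16 powr (1 - s) + 32 powr (1 - s)) * c powr (s - 1) / c ^ 4 * ((k m) ^ 12 * y m powr (- \<kappa>))
          \<le> E * ((k m) ^ 12 * y m powr (- \<kappa>))"
      proof (rule mult_right_mono)
        show "16 * C * (16 powr (1 - s) + 32 powr (1 - s)) * c powr (s - 1) / c ^ 4 \<le> E"
          by (simp add: E_def)
      qed (use k[of m] y[of m] in auto)
      finally show ?thesis .
    qed
    also have "y m powr (- \<kappa>) = r ^ (m + 1)"
    proof -
      have "y m powr (- \<kappa>) = (2 powr real (m + 1)) powr (- \<kappa>)" unfolding y_def by (simp only: powr_realpow zero_less_numeral)
      also have "\<dots> = (2 powr (- \<kappa>)) powr real (m + 1)" by (simp add: powr_powr mult.commute)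
      also have "\<dots> = r ^ (m + 1)" unfolding r_def by (rule powr_realpow) simp
      finally show ?thesis .
    qed
    finally show ?thesis .
  qed
  show ?thesis
  proof (rule hausdorff_measure_limsup_eq_0[of s Q Bad])
    show "s > 0" by fact
    show "Q m > 0" for m by (rule Q0)
    show "finite (Bad m)" for m by (simp add: Bad_def)
    show "(\<lambda>m. 1 / real (Q m)) \<longlonglongrightarrow> 0"
    proof (rule tendsto_sandwich[of "\<lambda>_. 0" _ _ "\<lambda>m. (1/2) ^ m"])
      show "\<forall>\<^sub>F m in sequentially. 1 / real (Q m) \<le> (1/2) ^ m"
      proof (rule always_eventually, rule allI)
        fix m
        have "(2::real) ^ m \<le> y m" by (simp add: y_def)
        then have "2 ^ m \<le> real (Q m)" using Qb(1)[of m] V(2)[of m] V0[of m] by linarith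
        then show "1 / real (Q m) \<le> (1/2) ^ m" unfolding power_divide power_one using Q0[of m] by (intro divide_left_mono) auto
      qed
      show "(\<lambda>m. (1/2::real) ^ m) \<longlonglongrightarrow> 0" by (rule LIMSEQ_realpow_zero) auto
    qed auto
    show "summable (\<lambda>m. real (card (Bad m)) * (1 / real (Q m)) powr s)"
    proof (rule summable_comparison_test'[of "\<lambda>m. E * ((k m) ^ 12 * r ^ (m + 1))" 0])
      have "summable (\<lambda>m. real m ^ 12 * r ^ m)" using r by (intro summable_power_times_geometric) auto
      then have "summable (\<lambda>m. real (m + 1) ^ 12 * r ^ (m + 1))" by (subst (asm) summable_iff_shift[of _ 1, symmetric])
      then show "summable (\<lambda>m. E * ((k m) ^ 12 * r ^ (m + 1)))" unfolding k_def by (rule summable_mult)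
      fix m :: nat
      have "real (card (Bad m)) * (1 / real (Q m)) powr s \<ge> 0" by simp
      then show "norm (real (card (Bad m)) * (1 / real (Q m)) powr s) \<le> E * ((k m) ^ 12 * r ^ (m + 1))"
        using term_le[of m] unfolding real_norm_def by linarith
    qed
    fix x K assume "x \<in> large_sum_set f \<alpha>"
    then have x: "x \<in> {0..1}" and inf: "infinite {N::nat. 1 \<le> N \<and> norm (exp_sum f x N) \<ge> real N powr \<alpha>}"
      by (auto simp: large_sum_set_def)
    \<comment> \<open>Infinitely many large sums provide one with \<open>N\<close> beyond
      \<open>2 ^ K\<close>, whose dyadic index is then at least \<open>K\<close>.\<close>
    obtain N where N: "N > 2 ^ K" "1 \<le> N" "norm (exp_sum f x N) \<ge> real N powr \<alpha>"
      using inf unfolding infinite_nat_iff_unbounded by blast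
    obtain m where m: "2 ^ m \<le> N" "N < 2 ^ (m + 1)" using ex_power_ivl1[of 2 N] N(2) by auto
    have "(2::nat) ^ K < 2 ^ (m + 1)" using N m by linarith
    then have "K < m + 1" by (rule power_less_imp_less_exp[rotated]) simp
    then have mK: "m \<ge> K" by simp
    have "real (2 ^ m) \<le> real N" using m(1) by (simp only: of_nat_le_iff)
    then have "(2 ^ m) powr \<alpha> \<le> real N powr \<alpha>" using \<alpha> by (intro powr_mono2) auto
    moreover have "2 * (real (m + 1))\<^sup>2 * Z m = (2 ^ m) powr \<alpha>"
    proof -
      have "y m powr \<alpha> = 2 powr \<alpha> * (2 ^ m) powr \<alpha>" unfolding y_def by (simp add: powr_mult)
      then show ?thesis unfolding Z_def c_def k_def[symmetric] using k[of m] by simp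
    qed
    ultimately have large: "2 * (real (m + 1))\<^sup>2 * Z m \<le> norm (exp_sum f x N)" using N(3) by linarith
    have "\<exists>a\<in>Bad m. x \<in> {real a / Q m..(real a + 1) / Q m}"
      unfolding Bad_def
      by (rule large_sum_near_grid[OF \<tau> f Z _ m(2) x large])
         (use Qb(1)[of m] in \<open>simp_all add: V_def y_def\<close>)
    then show "\<exists>m\<ge>K. \<exists>a\<in>Bad m. x \<in> {real a / Q m..(real a + 1) / Q m}" using mK by blast
  qed
qed

theorem theorem3p4:
  fixes \<tau> \<alpha> :: real and f :: "nat \<Rightarrow> real"
  assumes "\<tau> \<ge> 1"
    and "\<And>n. n \<ge> 1 \<Longrightarrow> f n = real_of_int \<lfloor>real n powr \<tau>\<rfloor>"
    and "1/2 < \<alpha>" and "\<alpha> < 1"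
  shows "hausdorff_dim (large_sum_set f \<alpha>) \<le>
    ereal (if \<tau> < 2 then 1 - (4 * \<alpha> + \<tau> - 4) / (\<tau> + 1 - \<alpha>)
           else 1 - (4 * \<alpha> - 2) / (\<tau> + 1 - \<alpha>))"
proof -
  define \<rho> where "\<rho> = \<tau> + 1 - \<alpha>"
  define \<sigma> where "\<sigma> = max (4 - \<tau>) 2"
  define d where "d = 1 - (4 * \<alpha> - \<sigma>) / \<rho>"
  have \<rho>: "\<rho> > 0" using assms by (simp add: \<rho>_def)
  have d_eq: "(if \<tau> < 2 then 1 - (4 * \<alpha> + \<tau> - 4) / (\<tau> + 1 - \<alpha>) else 1 - (4 * \<alpha> - 2) / (\<tau> + 1 - \<alpha>)) = d"
    by (auto simp: d_def \<sigma>_def \<rho>_def max_def algebra_simps)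
  \<comment> \<open>In the two cases this reads \<open>5 * \<alpha> < 5\<close> and
    \<open>5 * \<alpha> < \<tau> + 3\<close>. It makes \<open>d\<close> positive, so every
    \<open>d + e\<close> is an admissible exponent in the infimum.\<close>
  have "4 * \<alpha> - \<sigma> < \<rho>" using assms by (auto simp: \<sigma>_def \<rho>_def max_def)
  then have d0: "d > 0" using \<rho> by (simp add: d_def)
  have "hausdorff_dim (large_sum_set f \<alpha>) \<le> ereal d + ereal e" if e: "e > 0" for e
  proof -
    have "(1 - (d + e)) * \<rho> = 4 * \<alpha> - \<sigma> - e * \<rho>" using \<rho> by (simp add: d_def field_simps)
    moreover have "e * \<rho> > 0" using e \<rho> by simp
    ultimately have "(1 - (d + e)) * (\<tau> + 1 - \<alpha>) + max (4 - \<tau>) 2 < 4 * \<alpha>"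
      unfolding \<rho>_def \<sigma>_def by linarith
    then have "hausdorff_measure (d + e) (large_sum_set f \<alpha>) = 0"
      using assms d0 e by (intro hausdorff_measure_large_sum_set) auto
    then have "hausdorff_dim (large_sum_set f \<alpha>) \<le> ereal (d + e)"
      unfolding hausdorff_dim_def using d0 e by (intro INF_lower) auto
    then show ?thesis by simp
  qed
  then have "hausdorff_dim (large_sum_set f \<alpha>) \<le> ereal d" by (rule ereal_le_epsilon2)
  then show ?thesis unfolding d_eq .
qed

end
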